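(* Let $\Omega$ be a domain contained in a strip of $\mathbb{R}^2$ (the region between two parallel straight lines), such that $\partial\Omega$ has non-negative curvature with respect to $\Omega$, let $\phi\colon\partial\Omega\to\mathbb{R}$ be a piecewise $C^2$ function, and suppose that there exist $m,M\in\mathbb{R}$ such that $m<\phi<M$. Then the solution to the Dirichlet problem for the minimal surface equation in the Heisenberg group $\mathrm{Nil}_3$ $$\begin{cases}H_u=0&\text{in }\Omega,\\ u=\phi&\text{on }\partial\Omega\end{cases}$$ is unique and satisfies $m<u<M$.
   Context: $\mathrm{Nil}_3=\mathrm{Nil}_3(\tau)$, $\tau$ a (non-zero) real constant, is the Heisenberg group: $\mathbb{R}^3$ with the metric $dx^2+dy^2+\left[\tau(y\,dx-x\,dy)+dz\right]^2$. It is a Killing submersion $\pi(x,y,z)=(x,y)$ over the Euclidean plane with Killing field $\xi=\partial_z$ of unit length. The graph of $u$ over a domain of $\mathbb{R}^2$ is the surface $z=u(x,y)$ (Killing graph with respect to the section $z=0$). Its mean curvature is $H_u=\frac12\operatorname{div}\left(\frac{Gu}{\sqrt{1+\|Gu\|^2}}\right)$ with $Gu=(u_x+\tau y,\ u_y-\tau x)$ and Euclidean divergence and norm; the graph is minimal if $H_u=0$. "Non-negative curvature with respect to $\Omega$" means non-negative geodesic curvature with respect to the inner normal to $\Omega$. The boundary function $\phi$ may have jump discontinuities at a discrete closed set of points; the condition $u=\phi$ on $\partial\Omega$ means that $u$ extends continuously with value $\phi$ at the continuity points of $\phi$. *)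

theory Defs
  imports "HOL-Analysis.Analysis"
begin

type_synonym plane = "real \<times> real"

definition strip :: "plane \<Rightarrow> real \<Rightarrow> real \<Rightarrow> plane set" where
  "strip n a b = {p. a < n \<bullet> p \<and> n \<bullet> p < b}"


definition pdx :: "(plane \<Rightarrow> real) \<Rightarrow> plane \<Rightarrow> real" where
  "pdx f p = frechet_derivative f (at p) (1, 0)"

definition pdy :: "(plane \<Rightarrow> real) \<Rightarrow> plane \<Rightarrow> real" where
  "pdy f p = frechet_derivative f (at p) (0, 1)"

definition C1_on :: "plane set \<Rightarrow> (plane \<Rightarrow> real) \<Rightarrow> bool" where
  "C1_on S f \<longleftrightarrow>
     (\<forall>p\<in>S. f differentiable at p) \<and> continuous_on S (pdx f) \<and> continuous_on S (pdy f)"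

(* For open S. *)
definition C2_on :: "plane set \<Rightarrow> (plane \<Rightarrow> real) \<Rightarrow> bool" where
  "C2_on S f \<longleftrightarrow> C1_on S f \<and> C1_on S (pdx f) \<and> C1_on S (pdy f)"

definition divergence :: "(plane \<Rightarrow> plane) \<Rightarrow> plane \<Rightarrow> real" where
  "divergence X p = pdx (\<lambda>q. fst (X q)) p + pdy (\<lambda>q. snd (X q)) p"

(* The generalized gradient Gu of the Killing graph z = u(x,y) in Nil_3(tau), that is, R^3 with
   the metric dx^2 + dy^2 + (tau (y dx - x dy) + dz)^2, and the mean curvature of that graph. *)

definition nil3_gradient :: "real \<Rightarrow> (plane \<Rightarrow> real) \<Rightarrow> plane \<Rightarrow> plane" where
  "nil3_gradient \<tau> u p = (pdx u p + \<tau> * snd p, pdy u p - \<tau> * fst p)"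

definition nil3_mean_curvature :: "real \<Rightarrow> (plane \<Rightarrow> real) \<Rightarrow> plane \<Rightarrow> real" where
  "nil3_mean_curvature \<tau> u p =
     1/2 * divergence
       (\<lambda>q. nil3_gradient \<tau> u q /\<^sub>R sqrt (1 + (norm (nil3_gradient \<tau> u q))\<^sup>2)) p"


definition velocity :: "(real \<Rightarrow> 'a::real_normed_vector) \<Rightarrow> real \<Rightarrow> 'a" where
  "velocity c t = vector_derivative c (at t)"

definition acceleration :: "(real \<Rightarrow> 'a::real_normed_vector) \<Rightarrow> real \<Rightarrow> 'a" where
  "acceleration c t = velocity (velocity c) t"

(* For open I. *)
definition C2_curve_on :: "real set \<Rightarrow> (real \<Rightarrow> 'a::real_normed_vector) \<Rightarrow> bool" where
  "C2_curve_on I c \<longleftrightarrow>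
     (\<forall>t\<in>I. c differentiable at t) \<and> (\<forall>t\<in>I. velocity c differentiable at t) \<and>
     continuous_on I (acceleration c)"

(* c parametrizes S near p, by an open interval around 0. *)
definition local_param :: "plane set \<Rightarrow> plane \<Rightarrow> real \<Rightarrow> (real \<Rightarrow> plane) \<Rightarrow> bool" where
  "local_param S p \<delta> c \<longleftrightarrow>
     0 < \<delta> \<and> c 0 = p \<and>
     (\<exists>U g. open U \<and> homeomorphism {-\<delta><..<\<delta>} (S \<inter> U) c g)"

definition regular_C2_param :: "plane set \<Rightarrow> plane \<Rightarrow> real \<Rightarrow> (real \<Rightarrow> plane) \<Rightarrow> bool" where
  "regular_C2_param S p \<delta> c \<longleftrightarrow>
     local_param S p \<delta> c \<and> C2_curve_on {-\<delta><..<\<delta>} c \<and> (\<forall>t\<in>{-\<delta><..<\<delta>}. velocity c t \<noteq> 0)"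

(* nu is the unit normal to the boundary curve c at c t that points into Omega. Requiring that
   the other side is outside Omega rules out slits. *)
definition inner_unit_normal :: "plane set \<Rightarrow> (real \<Rightarrow> plane) \<Rightarrow> real \<Rightarrow> plane \<Rightarrow> bool" where
  "inner_unit_normal \<Omega> c t \<nu> \<longleftrightarrow>
     norm \<nu> = 1 \<and> \<nu> \<bullet> velocity c t = 0 \<and>
     (\<exists>\<epsilon>>0. \<forall>s. 0 < s \<and> s < \<epsilon> \<longrightarrow> c t + s *\<^sub>R \<nu> \<in> \<Omega> \<and> c t - s *\<^sub>R \<nu> \<notin> \<Omega>)"

(* Signed with respect to the unit normal nu. *)
definition geodesic_curvature :: "(real \<Rightarrow> plane) \<Rightarrow> plane \<Rightarrow> real \<Rightarrow> real" where
  "geodesic_curvature c \<nu> t = (acceleration c t \<bullet> \<nu>) / (norm (velocity c t))\<^sup>2"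

(* The boundary is a C^2 curve with non-negative curvature, except at a closed discrete (possibly
   empty) set K of corners. At a corner, where the curvature is not defined, non-negativity means
   that the interior angle is at most pi, i.e. that the domain is locally convex. *)
definition nonneg_curved_boundary :: "plane set \<Rightarrow> bool" where
  "nonneg_curved_boundary \<Omega> \<longleftrightarrow>
     (\<exists>K. K \<subseteq> frontier \<Omega> \<and> closed K \<and> discrete K \<and>
        (\<forall>p \<in> frontier \<Omega> - K. \<exists>\<delta> c. regular_C2_param (frontier \<Omega>) p \<delta> c \<and>
           (\<forall>t\<in>{-\<delta><..<\<delta>}. \<exists>\<nu>. inner_unit_normal \<Omega> c t \<nu> \<and> 0 \<le> geodesic_curvature c \<nu> t)) \<and>
        (\<forall>p\<in>K. \<exists>r>0. convex (\<Omega> \<inter> ball p r)))"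

(* C^2 along the boundary except at a closed discrete set D, at the points of which both
   one-sided limits exist. The value at a point of D is arbitrary. *)
definition piecewise_C2_on_boundary :: "plane set \<Rightarrow> (plane \<Rightarrow> real) \<Rightarrow> bool" where
  "piecewise_C2_on_boundary \<Omega> \<phi> \<longleftrightarrow>
     (\<exists>D. D \<subseteq> frontier \<Omega> \<and> closed D \<and> discrete D \<and>
        (\<forall>p \<in> frontier \<Omega> - D. \<exists>\<delta> c. regular_C2_param (frontier \<Omega>) p \<delta> c \<and>
           C2_curve_on {-\<delta><..<\<delta>} (\<phi> \<circ> c)) \<and>
        (\<forall>p\<in>D. \<exists>\<delta> c. local_param (frontier \<Omega>) p \<delta> c \<and>
           (\<exists>l. ((\<phi> \<circ> c) \<longlongrightarrow> l) (at_left 0)) \<and> (\<exists>l. ((\<phi> \<circ> c) \<longlongrightarrow> l) (at_right 0))))"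

(* A classical solution. The boundary value is attained only at the continuity points of phi;
   no condition is imposed at its jumps or at infinity. *)
definition solves_dirichlet ::
    "real \<Rightarrow> plane set \<Rightarrow> (plane \<Rightarrow> real) \<Rightarrow> (plane \<Rightarrow> real) \<Rightarrow> bool" where
  "solves_dirichlet \<tau> \<Omega> \<phi> u \<longleftrightarrow>
     C2_on \<Omega> u \<and> (\<forall>p\<in>\<Omega>. nil3_mean_curvature \<tau> u p = 0) \<and>
     (\<forall>p\<in>frontier \<Omega>. continuous (at p within frontier \<Omega>) \<phi> \<longrightarrow> (u \<longlongrightarrow> \<phi> p) (at p within \<Omega>))"

end

theory Submission
  imports Defs
begin

text \<open>
The theorem is a comparison principle at infinity: no growth of the solutions is assumed, so the
ends of the strip have to be controlled by integral estimates. Write \<open>Gu\<close> for the generalized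
gradient and \<open>X u = Gu / sqrt (1 + |Gu|\<^sup>2)\<close>, so that \<open>u\<close> is minimal iff \<open>div (X u) = 0\<close>. Constants are
minimal, because then \<open>Gu\<close> is a rotation field.

Everything is tested with functions \<open>\<zeta> \<rho> powr (-g) T(w)\<close>. Here \<open>w\<close> is a difference of two minimal graphs
that is asymptotically nonpositive at the boundary away from the jumps. The profile \<open>T\<close> vanishes on
\<open>w \<le> \<epsilon>\<close>, and \<open>\<rho> = sqrt (K\<^sup>2 + s\<^sup>2)\<close>, where \<open>s\<close> is a coordinate along the strip. The cutoff \<open>\<zeta>\<close> vanishes
near the jumps and far away. Such a function is \<open>C\<^sup>1\<close> with compact support in the domain, so the
divergence theorem needs no regularity of the boundary (\<open>integral_by_parts\<close>). Points have capacity
zero in the plane and \<open>\<rho> powr (-g)\<close> decays, so for bounded \<open>T\<close> the terms with \<open>grad \<zeta>\<close> can be made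
arbitrarily small (\<open>strip_cutoff\<close>, \<open>exhaustion\<close>).

(1) Moments (\<open>second_moment\<close>). Let \<open>w = \<plusminus>(u - c)\<close> with \<open>c\<close> constant. From
\<open>|grad u| \<le> grad u \<bullet> X u + 1 + 2|\<tau>||p|\<close> and \<open>div (X u) = 0\<close> one controls \<open>|grad T(w)|\<close>, and the
Poincare inequality across the strip then controls \<open>T(w)\<close>. A large \<open>K\<close> absorbs the derivative of
the weight. Applied to truncations of \<open>w\<close> and of \<open>w\<^sup>2\<close>, this bounds the integral of
\<open>\<rho> powr (-(3 + \<alpha>)) w\<^sup>2\<close> by a constant times \<open>1 / \<alpha>\<close>, the truncation being removed at the end.

(2) Energy (\<open>energy_estimate\<close>, \<open>comparison_principle\<close>). In the manner of Collin and Krust, the field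
\<open>Z = X u - X v\<close> is divergence free and satisfies
\<open>grad w \<bullet> Z \<ge> (W u + W v) / 2 |Z|\<^sup>2\<close>, where \<open>W u = sqrt (1 + |Gu|\<^sup>2)\<close>. With the weight \<open>\<rho> powr (-\<alpha>)\<close> the
energy is at most of order \<open>\<alpha>\<^sup>2\<close> times the integral of \<open>\<rho> powr (-(2 + \<alpha>)) w\<^sup>2 / (W u + W v)\<close>. If \<open>v\<close> is
constant then \<open>W v\<close> is at least of order \<open>\<rho>\<close>, since \<open>\<tau> \<noteq> 0\<close>, and by (1) the integral is of order \<open>1 / \<alpha>\<close>; if
\<open>w\<close> is bounded the integral is of order \<open>1 / \<alpha>\<close> as well. Letting \<open>\<alpha>\<close> tend to 0, the energy vanishes on \<open>w > 0\<close>,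
so \<open>w\<close> is locally constant there, which contradicts the boundary condition.

The first case gives \<open>m \<le> u \<le> M\<close> (\<open>one_sided_bound\<close>), and the second one then gives uniqueness
(\<open>bounded_comparison\<close>). The strict inequalities follow from the Hopf maximum principle
(\<open>strong_minimum_principle\<close>). A boundary point at which the data are continuous exists because a
closed discrete set does not separate the plane (\<open>frontier_not_subset_discrete\<close>).
\<close>

section \<open>Gradients and integration by parts in the plane\<close>

text \<open>The gradient, meaningful where the function is differentiable.\<close>

definition grad :: "(plane \<Rightarrow> real) \<Rightarrow> plane \<Rightarrow> plane" where
  "grad f p = (pdx f p, pdy f p)"

lemma grad_eqI:
  assumes "(f has_derivative (\<lambda>h. g \<bullet> h)) (at p)"
  shows "grad f p = g"
proof -
  have "frechet_derivative f (at p) = (\<lambda>h. g \<bullet> h)"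
    using frechet_derivative_at[OF assms] by simp
  then show ?thesis by (simp add: grad_def pdx_def pdy_def inner_prod_def prod_eq_iff)
qed

lemma has_derivative_grad:
  assumes "f differentiable at p"
  shows "(f has_derivative (\<lambda>h. grad f p \<bullet> h)) (at p)"
proof -
  have D: "(f has_derivative frechet_derivative f (at p)) (at p)"
    using assms frechet_derivative_works by blast
  have "frechet_derivative f (at p) h = grad f p \<bullet> h" for h
  proof -
    interpret linear "frechet_derivative f (at p)"
      using assms by (rule linear_frechet_derivative)
    have "h = fst h *\<^sub>R (1, 0) + snd h *\<^sub>R (0, 1)" by (simp add: prod_eq_iff)
    then have "frechet_derivative f (at p) h =
        fst h *\<^sub>R frechet_derivative f (at p) (1, 0) + snd h *\<^sub>R frechet_derivative f (at p) (0, 1)"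
      by (metis add scale)
    then show ?thesis by (simp add: grad_def pdx_def pdy_def inner_prod_def)
  qed
  then have "frechet_derivative f (at p) = (\<lambda>h. grad f p \<bullet> h)" by (rule ext)
  with D show ?thesis by simp
qed

lemma pdx_grad: "pdx f p = fst (grad f p)" and pdy_grad: "pdy f p = snd (grad f p)"
  by (simp_all add: grad_def)

lemma C1_on_grad:
  "C1_on S f \<longleftrightarrow> (\<forall>p\<in>S. f differentiable at p) \<and> continuous_on S (grad f)"
proof -
  have "continuous_on S (grad f) \<longleftrightarrow> continuous_on S (pdx f) \<and> continuous_on S (pdy f)"
  proof
    assume c: "continuous_on S (grad f)"
    have "continuous_on S (\<lambda>p. fst (grad f p))" "continuous_on S (\<lambda>p. snd (grad f p))"
      using c by (intro continuous_intros; assumption)+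
    then show "continuous_on S (pdx f) \<and> continuous_on S (pdy f)"
      by (simp add: grad_def)
  next
    assume "continuous_on S (pdx f) \<and> continuous_on S (pdy f)"
    then have "continuous_on S (\<lambda>p. (pdx f p, pdy f p))" by (intro continuous_intros) auto
    then show "continuous_on S (grad f)" by (simp add: grad_def[abs_def])
  qed
  then show ?thesis by (auto simp: C1_on_def)
qed

lemma C1_on_differentiable: "C1_on S f \<Longrightarrow> p \<in> S \<Longrightarrow> f differentiable at p"
  by (simp add: C1_on_def)

lemma C1_on_continuous_grad: "C1_on S f \<Longrightarrow> continuous_on S (grad f)"
  by (simp add: C1_on_grad)

lemma C1_on_continuous: "C1_on S f \<Longrightarrow> continuous_on S f"
  by (meson C1_on_def continuous_at_imp_continuous_on differentiable_imp_continuous_within)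

lemma C1_on_subset: "C1_on S f \<Longrightarrow> T \<subseteq> S \<Longrightarrow> C1_on T f"
  by (auto simp: C1_on_def intro: continuous_on_subset)

lemma C1_onI:
  assumes "\<And>p. p \<in> S \<Longrightarrow> (f has_derivative (\<lambda>h. g p \<bullet> h)) (at p)" "continuous_on S g"
  shows "C1_on S f"
proof -
  have "grad f p = g p" if "p \<in> S" for p using assms(1)[OF that] by (rule grad_eqI)
  then have "continuous_on S (grad f)" using assms(2) by (subst continuous_on_cong[OF refl]) auto
  then show ?thesis using assms(1) by (auto simp: C1_on_grad differentiable_def)
qed

lemma grad_cong:
  assumes "open U" "p \<in> U" "\<And>q. q \<in> U \<Longrightarrow> f q = g q"
  shows "grad f p = grad g p"
proof -
  have "(f has_derivative D) (at p) \<longleftrightarrow> (g has_derivative D) (at p)" for D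
    using assms by (metis has_derivative_transform_within_open)
  then show ?thesis by (simp add: grad_def pdx_def pdy_def frechet_derivative_def)
qed

lemma C1_on_cong:
  assumes "open S" "\<And>q. q \<in> S \<Longrightarrow> f q = g q" "C1_on S f"
  shows "C1_on S g"
proof (rule C1_onI)
  fix p assume p: "p \<in> S"
  have "(f has_derivative (\<lambda>h. grad f p \<bullet> h)) (at p)"
    using assms(3) p by (intro has_derivative_grad C1_on_differentiable)
  then show "(g has_derivative (\<lambda>h. grad f p \<bullet> h)) (at p)"
    using assms p by (metis has_derivative_transform_within_open)
qed (rule C1_on_continuous_grad[OF assms(3)])

lemma
  assumes "f differentiable at p" "g differentiable at p"
  shows grad_mult: "grad (\<lambda>q. f q * g q) p = f p *\<^sub>R grad g p + g p *\<^sub>R grad f p"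
    and grad_add: "grad (\<lambda>q. f q + g q) p = grad f p + grad g p"
    and grad_diff: "grad (\<lambda>q. f q - g q) p = grad f p - grad g p"
proof -
  note d = assms[THEN has_derivative_grad]
  show "grad (\<lambda>q. f q * g q) p = f p *\<^sub>R grad g p + g p *\<^sub>R grad f p"
    by (rule grad_eqI, rule derivative_eq_intros, (rule d)+) (auto simp: algebra_simps)
  show "grad (\<lambda>q. f q + g q) p = grad f p + grad g p"
    by (rule grad_eqI, rule derivative_eq_intros, (rule d)+) (auto simp: algebra_simps)
  show "grad (\<lambda>q. f q - g q) p = grad f p - grad g p"
    by (rule grad_eqI, rule derivative_eq_intros, (rule d)+) (auto simp: algebra_simps)
qed

lemma has_derivative_compose_grad:
  assumes "f differentiable at p" "(T has_real_derivative T') (at (f p))"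
  shows "((\<lambda>q. T (f q)) has_derivative (\<lambda>h. (T' *\<^sub>R grad f p) \<bullet> h)) (at p)"
  using has_derivative_compose[OF has_derivative_grad[OF assms(1)]
      assms(2)[unfolded has_field_derivative_def]]
  by (simp add: mult.commute)

lemma grad_compose:
  assumes "f differentiable at p" "(T has_real_derivative T') (at (f p))"
  shows "grad (\<lambda>q. T (f q)) p = T' *\<^sub>R grad f p"
  using has_derivative_compose_grad[OF assms] by (rule grad_eqI)

lemma C1_on_mult:
  assumes "C1_on S f" "C1_on S g"
  shows "C1_on S (\<lambda>q. f q * g q)"
proof (rule C1_onI)
  fix p assume p: "p \<in> S"
  show "((\<lambda>q. f q * g q) has_derivative (\<lambda>h. (f p *\<^sub>R grad g p + g p *\<^sub>R grad f p) \<bullet> h)) (at p)"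
    by (rule derivative_eq_intros, (rule has_derivative_grad C1_on_differentiable assms p)+)
      (auto simp: algebra_simps)
qed (intro continuous_intros C1_on_continuous C1_on_continuous_grad assms)

lemma C1_on_add:
  assumes "C1_on S f" "C1_on S g"
  shows "C1_on S (\<lambda>q. f q + g q)"
proof (rule C1_onI)
  fix p assume p: "p \<in> S"
  show "((\<lambda>q. f q + g q) has_derivative (\<lambda>h. (grad f p + grad g p) \<bullet> h)) (at p)"
    by (rule derivative_eq_intros, (rule has_derivative_grad C1_on_differentiable assms p)+)
      (auto simp: algebra_simps)
qed (intro continuous_intros C1_on_continuous C1_on_continuous_grad assms)

lemma C1_on_diff:
  assumes "C1_on S f" "C1_on S g"
  shows "C1_on S (\<lambda>q. f q - g q)"
proof (rule C1_onI)
  fix p assume p: "p \<in> S"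
  show "((\<lambda>q. f q - g q) has_derivative (\<lambda>h. (grad f p - grad g p) \<bullet> h)) (at p)"
    by (rule derivative_eq_intros, (rule has_derivative_grad C1_on_differentiable assms p)+)
      (auto simp: algebra_simps)
qed (intro continuous_intros C1_on_continuous C1_on_continuous_grad assms)

lemma C1_on_const [simp]: "C1_on S (\<lambda>q. c)"
  by (rule C1_onI[where g="\<lambda>_. 0"]) auto

lemma C1_on_inner [simp]: "C1_on S (\<lambda>q. e \<bullet> q)"
  by (rule C1_onI[where g="\<lambda>_. e"]) (auto intro!: derivative_eq_intros)

lemma grad_inner [simp]: "grad (\<lambda>q. e \<bullet> q) p = e"
  by (rule grad_eqI) (auto intro!: derivative_eq_intros)

lemma grad_const [simp]: "grad (\<lambda>q. c) p = 0"
  by (rule grad_eqI) auto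

lemma C1_on_compose:
  assumes "C1_on S f" "\<And>p. p \<in> S \<Longrightarrow> (T has_real_derivative T' (f p)) (at (f p))"
    and "continuous_on (f ` S) T'"
  shows "C1_on S (\<lambda>q. T (f q))"
proof (rule C1_onI)
  fix p assume p: "p \<in> S"
  show "((\<lambda>q. T (f q)) has_derivative (\<lambda>h. (T' (f p) *\<^sub>R grad f p) \<bullet> h)) (at p)"
    by (intro has_derivative_compose_grad C1_on_differentiable[OF assms(1)] assms(2) p)
next
  have "continuous_on S (\<lambda>p. T' (f p))"
    using continuous_on_compose2[OF assms(3) C1_on_continuous[OF assms(1)]] by auto
  then show "continuous_on S (\<lambda>p. T' (f p) *\<^sub>R grad f p)"
    by (intro continuous_intros C1_on_continuous_grad assms)
qed

text \<open>A \<open>C\<^sup>1\<close> function on an open set that vanishes off a compact subset stays \<open>C\<^sup>1\<close> when it is extended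
by zero to the plane.\<close>

lemma C1_on_extend_zero:
  assumes "open \<Omega>" "compact C" "C \<subseteq> \<Omega>" "C1_on \<Omega> f" "\<And>p. p \<in> \<Omega> - C \<Longrightarrow> f p = 0"
  shows "C1_on UNIV (\<lambda>p. if p \<in> C then f p else 0)"
    and "grad (\<lambda>p. if p \<in> C then f p else 0) p = (if p \<in> C then grad f p else 0)"
proof -
  define F where "F = (\<lambda>p. if p \<in> C then f p else 0)"
  have oC: "open (- C)" using assms(2) by (simp add: compact_imp_closed open_Compl)
  have F: "F q = f q" if "q \<in> \<Omega>" for q using assms(5) that by (auto simp: F_def)
  have F0: "F q = 0" if "q \<in> - C" for q using that by (auto simp: F_def)
  have C1: "C1_on \<Omega> F" by (rule C1_on_cong[OF assms(1) _ assms(4)]) (simp add: F)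
  have C2: "C1_on (- C) F" by (rule C1_on_cong[OF oC _ C1_on_const[of _ 0]]) (simp add: F0)
  have "UNIV = \<Omega> \<union> - C" using assms(3) by auto
  moreover have "C1_on (\<Omega> \<union> - C) F"
    using C1 C2 assms(1) oC unfolding C1_on_grad
    by (auto intro: continuous_on_open_Un)
  ultimately show "C1_on UNIV (\<lambda>p. if p \<in> C then f p else 0)" by (simp add: F_def)
  show "grad (\<lambda>p. if p \<in> C then f p else 0) p = (if p \<in> C then grad f p else 0)"
  proof (cases "p \<in> C")
    case True
    then have "grad F p = grad f p" using assms(3) F by (intro grad_cong[OF assms(1)]) auto
    then show ?thesis using True by (simp add: F_def)
  next
    case False
    then have "grad F p = grad (\<lambda>_. 0) p" using F0 by (intro grad_cong[OF oC]) auto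
    then show ?thesis using False by (simp add: F_def)
  qed
qed

lemma integral_grad_eq_0:
  assumes F: "C1_on UNIV F" and C: "compact C" and 0: "\<And>p. p \<notin> C \<Longrightarrow> F p = 0"
    and G0: "\<And>p. p \<notin> C \<Longrightarrow> grad F p = 0"
  shows "(LINT p|lborel. grad F p) = 0" and "integrable lborel (grad F)"
proof -
  have "bounded C" using C by (rule compact_imp_bounded)
  then obtain R where R: "\<And>p. p \<in> C \<Longrightarrow> norm p < R"
    by (meson bounded_pos gt_ex le_less_trans bounded_pos_less)
  have out: "F (x, y) = 0 \<and> grad F (x, y) = 0" if "\<bar>x\<bar> \<ge> R \<or> \<bar>y\<bar> \<ge> R" for x y
  proof -
    have "norm (x, y) \<ge> R"
      using that norm_fst_le[of x y] norm_snd_le[of y x] by auto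
    then have "(x, y) \<notin> C" using R by fastforce
    then show ?thesis using 0 G0 by auto
  qed
  have cg: "continuous_on UNIV (grad F)" using F by (rule C1_on_continuous_grad)
  have "integrable lborel (\<lambda>p. indicator C p *\<^sub>R grad F p)"
    by (rule borel_integrable_compact[OF C]) (use cg continuous_on_subset in blast)
  also have "(\<lambda>p. indicator C p *\<^sub>R grad F p) = grad F"
    using G0 by (auto simp: indicator_def)
  finally show int: "integrable lborel (grad F)" .
  have D: "(F has_derivative (\<lambda>h. grad F p \<bullet> h)) (at p)" for p
    using F by (intro has_derivative_grad C1_on_differentiable) auto
  have Dx: "((\<lambda>x. F (x, y)) has_vector_derivative fst (grad F (x, y))) (at x)" for x y
  proof -
    have "((\<lambda>x. F (x, y)) has_derivative (\<lambda>h. grad F (x, y) \<bullet> (h, 0))) (at x)"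
      by (rule has_derivative_compose[OF _ D]) (auto intro!: derivative_eq_intros)
    then show ?thesis by (simp add: has_vector_derivative_def inner_prod_def mult.commute)
  qed
  have Dy: "((\<lambda>y. F (x, y)) has_vector_derivative snd (grad F (x, y))) (at y)" for x y
  proof -
    have "((\<lambda>y. F (x, y)) has_derivative (\<lambda>h. grad F (x, y) \<bullet> (0, h))) (at y)"
      by (rule has_derivative_compose[OF _ D]) (auto intro!: derivative_eq_intros)
    then show ?thesis by (simp add: has_vector_derivative_def inner_prod_def mult.commute)
  qed
  \<comment> \<open>Fundamental theorem of calculus along a line that leaves the support at both ends.\<close>
  have line: "(LINT x|lborel. g x) = 0"
    if "\<And>x. (f has_vector_derivative g x) (at x)" "continuous_on UNIV g"
      and "\<And>x. \<bar>x\<bar> \<ge> R \<Longrightarrow> f x = 0 \<and> g x = 0" for f g :: "real \<Rightarrow> real"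
  proof (cases "R \<ge> 0")
    case True
    have "g x = indicator {-R..R} x *\<^sub>R g x" for x
      using that(3)[of x] by (cases "\<bar>x\<bar> \<ge> R") (auto simp: indicator_def)
    then have "(LINT x|lborel. g x) = (LINT x|lborel. indicator {-R..R} x *\<^sub>R g x)"
      by presburger
    also have "\<dots> = f R - f (-R)"
      by (rule integral_FTC_atLeastAtMost)
        (use True that in \<open>auto intro: has_vector_derivative_at_within continuous_on_subset\<close>)
    also have "\<dots> = 0" using that(3)[of R] that(3)[of "-R"] True by auto
    finally show ?thesis .
  next
    case False
    then have "g x = 0" for x using that(3)[of x] by auto
    then show ?thesis by simp
  qed
  have c1: "continuous_on UNIV (\<lambda>x. fst (grad F (x, y)))" for y
    by (intro continuous_intros continuous_on_compose2[OF cg]) auto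
  have c2: "continuous_on UNIV (\<lambda>y. snd (grad F (x, y)))" for x
    by (intro continuous_intros continuous_on_compose2[OF cg]) auto
  have line1: "(LINT x|lborel. fst (grad F (x, y))) = 0" for y
    by (rule line[where f="\<lambda>x. F (x, y)"]) (use Dx c1 out in auto)
  have line2: "(LINT y|lborel. snd (grad F (x, y))) = 0" for x
    by (rule line[where f="\<lambda>y. F (x, y)"]) (use Dy c2 out in auto)
  have i1: "integrable (lborel \<Otimes>\<^sub>M lborel) (case_prod (\<lambda>x y. fst (grad F (x, y))))"
    using integrable_fst[OF int] by (simp add: lborel_prod case_prod_unfold)
  have i2: "integrable (lborel \<Otimes>\<^sub>M lborel) (case_prod (\<lambda>x y. snd (grad F (x, y))))"
    using integrable_snd[OF int] by (simp add: lborel_prod case_prod_unfold)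
  have "(LINT p|lborel. fst (grad F p)) = (LINT y|lborel. (LINT x|lborel. fst (grad F (x, y))))"
    using lborel_pair.integral_snd[OF i1] by (simp add: lborel_prod case_prod_unfold)
  also have "\<dots> = 0"
    by (simp add: line1)
  finally have 1: "(LINT p|lborel. fst (grad F p)) = 0" .
  have "(LINT p|lborel. snd (grad F p)) = (LINT x|lborel. (LINT y|lborel. snd (grad F (x, y))))"
    using lborel_pair.integral_fst[OF i2] by (simp add: lborel_prod case_prod_unfold)
  also have "\<dots> = 0"
    by (simp add: line2)
  finally have 2: "(LINT p|lborel. snd (grad F p)) = 0" .
  show "(LINT p|lborel. grad F p) = 0"
    using 1 2 integral_fst[OF int] integral_snd[OF int] by (simp add: prod_eq_iff)
qed

lemma set_integrable_continuous_compact: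
  fixes f :: "'a::euclidean_space \<Rightarrow> real"
  assumes "compact C" "continuous_on C f"
  shows "set_integrable lborel C f"
  unfolding set_integrable_def using borel_integrable_compact[OF assms] by simp

text \<open>The divergence theorem for \<open>f Y\<close>, with no boundary term because \<open>f\<close> vanishes off a compact
subset of the open set.\<close>

lemma integral_by_parts:
  assumes \<Omega>: "open \<Omega>" and C: "compact C" "C \<subseteq> \<Omega>"
    and f: "C1_on \<Omega> f" "\<And>p. p \<in> \<Omega> - C \<Longrightarrow> f p = 0"
    and Y: "C1_on \<Omega> (\<lambda>q. fst (Y q))" "C1_on \<Omega> (\<lambda>q. snd (Y q))"
  shows "(LINT p:C|lborel. grad f p \<bullet> Y p + f p * divergence Y p) = 0"
proof -
  have *: "(LINT p:C|lborel. fst (grad (\<lambda>q. f q * g q) p)) = 0 \<and>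
      (LINT p:C|lborel. snd (grad (\<lambda>q. f q * g q) p)) = 0"
    if g: "C1_on \<Omega> g" for g
  proof -
    define F where "F = (\<lambda>p. if p \<in> C then f p * g p else 0)"
    note ext = C1_on_extend_zero[OF \<Omega> C C1_on_mult[OF f(1) g], folded F_def]
    have F: "C1_on UNIV F" and gF: "\<And>p. grad F p = (if p \<in> C then grad (\<lambda>q. f q * g q) p else 0)"
      using ext f(2) by auto
    have F0: "F p = 0" "grad F p = 0" if "p \<notin> C" for p
      using that by (simp_all add: gF) (simp add: F_def)
    have z: "(LINT p|lborel. grad F p) = 0" and i: "integrable lborel (grad F)"
      by (rule integral_grad_eq_0[OF F C(1)]; fact F0)+
    have "(LINT p|lborel. fst (grad F p)) = 0" "(LINT p|lborel. snd (grad F p)) = 0"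
      using integral_fst[OF i] integral_snd[OF i] by (simp_all only: z fst_zero snd_zero)
    moreover have "fst (grad F p) = indicator C p *\<^sub>R fst (grad (\<lambda>q. f q * g q) p)"
      "snd (grad F p) = indicator C p *\<^sub>R snd (grad (\<lambda>q. f q * g q) p)" for p
      by (auto simp: gF indicator_def)
    ultimately show ?thesis by (simp add: set_lebesgue_integral_def)
  qed
  have cont: "continuous_on C (\<lambda>p. fst (grad (\<lambda>q. f q * g q) p))"
    "continuous_on C (\<lambda>p. snd (grad (\<lambda>q. f q * g q) p))" if g: "C1_on \<Omega> g" for g
    using continuous_on_subset[OF C1_on_continuous_grad[OF C1_on_mult[OF f(1) g]] C(2)]
    by (intro continuous_intros; assumption)+
  have "(LINT p:C|lborel. grad f p \<bullet> Y p + f p * divergence Y p) =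
    (LINT p:C|lborel. fst (grad (\<lambda>q. f q * fst (Y q)) p) + snd (grad (\<lambda>q. f q * snd (Y q)) p))"
  proof (rule set_lebesgue_integral_cong)
    show "\<forall>p. p \<in> C \<longrightarrow> grad f p \<bullet> Y p + f p * divergence Y p =
      fst (grad (\<lambda>q. f q * fst (Y q)) p) + snd (grad (\<lambda>q. f q * snd (Y q)) p)"
    proof (intro allI impI)
      fix p assume "p \<in> C"
      then have p: "p \<in> \<Omega>" using C by auto
      note d = C1_on_differentiable[OF f(1) p] C1_on_differentiable[OF Y(1) p]
        C1_on_differentiable[OF Y(2) p]
      show "grad f p \<bullet> Y p + f p * divergence Y p =
        fst (grad (\<lambda>q. f q * fst (Y q)) p) + snd (grad (\<lambda>q. f q * snd (Y q)) p)"
        using d by (simp add: grad_mult divergence_def pdx_grad pdy_grad inner_prod_def algebra_simps)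
    qed
  qed (use C in \<open>auto simp: compact_imp_closed\<close>)
  also have "\<dots> = (LINT p:C|lborel. fst (grad (\<lambda>q. f q * fst (Y q)) p)) +
     (LINT p:C|lborel. snd (grad (\<lambda>q. f q * snd (Y q)) p))"
    by (intro set_integral_add set_integrable_continuous_compact C cont Y)
  also have "\<dots> = 0" using * Y by simp
  finally show ?thesis .
qed

section \<open>Weights along a strip\<close>

text \<open>The weight \<open>\<rho>\<close>: a smooth version of \<open>K + |e \<bullet> p|\<close>. Its powers are slowly varying, in that the
gradient of \<open>\<rho> powr (-g)\<close> is at most \<open>g / K\<close> times \<open>\<rho> powr (-g)\<close>.\<close>

definition wt :: "plane \<Rightarrow> real \<Rightarrow> plane \<Rightarrow> real" where
  "wt e K p = sqrt (K\<^sup>2 + (e \<bullet> p)\<^sup>2)"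

lemma wt_ge: "K \<ge> 0 \<Longrightarrow> wt e K p \<ge> K" "wt e K p \<ge> \<bar>e \<bullet> p\<bar>"
  unfolding wt_def by (auto intro: real_le_rsqrt)

lemma wt_pos: "K > 0 \<Longrightarrow> wt e K p > 0"
  using wt_ge(1)[of K e p] by linarith

lemma wt_powr_has_derivative:
  assumes "K > 0"
  shows "((\<lambda>q. wt e K q powr (-g)) has_derivative
     (\<lambda>h. ((- g * wt e K p powr (-g-2) * (e \<bullet> p)) *\<^sub>R e) \<bullet> h)) (at p)"
proof -
  have pos: "K\<^sup>2 + (e \<bullet> p)\<^sup>2 > 0" using assms by (simp add: add_pos_nonneg)
  have w: "wt e K q = (K\<^sup>2 + (e \<bullet> q)\<^sup>2) powr (1/2)" for q
    by (simp add: wt_def powr_half_sqrt)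
  have eq: "wt e K q powr (-g) = (K\<^sup>2 + (e \<bullet> q)\<^sup>2) powr (-g/2)" for q
    unfolding w powr_powr by simp
  have eq2: "wt e K p powr (-g-2) = (K\<^sup>2 + (e \<bullet> p)\<^sup>2) powr (-g/2-1)"
    unfolding w powr_powr by (simp add: diff_divide_distrib)
  have "((\<lambda>t. (K\<^sup>2 + t\<^sup>2) powr (-g/2)) has_real_derivative
     (-g/2) * (K\<^sup>2 + (e \<bullet> p)\<^sup>2) powr (-g/2-1) * (2 * (e \<bullet> p))) (at (e \<bullet> p))"
    using pos by (auto intro!: derivative_eq_intros)
  from has_derivative_compose_grad[of "\<lambda>q. e \<bullet> q", OF _ this]
  show ?thesis
    unfolding eq eq2 by (simp add: mult_ac)
qed

lemma continuous_wt [continuous_intros]: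
  "continuous_on S (wt e K)" "continuous_on S (\<lambda>p. wt e K p)"
  unfolding wt_def by (intro continuous_intros)+

lemma continuous_wt_powr:
  "K > 0 \<Longrightarrow> continuous_on S (\<lambda>p. wt e K p powr g)"
  using wt_pos[of K e] by (intro continuous_intros) (auto simp: less_le)

lemma C1_on_wt_powr: "K > 0 \<Longrightarrow> C1_on S (\<lambda>q. wt e K q powr (-g))"
  by (rule C1_onI[OF wt_powr_has_derivative]) (auto intro!: continuous_intros continuous_wt_powr)

lemma norm_grad_wt_powr:
  assumes "K > 0" "g \<ge> 0" "norm e = 1"
  shows "norm (grad (\<lambda>q. wt e K q powr (-g)) p) \<le> g * wt e K p powr (-g-1)"
proof -
  have "norm (grad (\<lambda>q. wt e K q powr (-g)) p) = g * wt e K p powr (-g-2) * \<bar>e \<bullet> p\<bar>"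
    unfolding grad_eqI[OF wt_powr_has_derivative[OF assms(1)]] using assms
    by (simp add: abs_mult)
  also have "\<dots> \<le> g * wt e K p powr (-g-2) * wt e K p"
    using wt_ge(2)[of e p K] assms by (intro mult_left_mono) auto
  also have "wt e K p powr (-g-2) * wt e K p = wt e K p powr (-g-1)"
  proof -
    have "-g-1 = (-g-2) + 1" by simp
    then have "wt e K p powr (-g-1) = wt e K p powr ((-g-2) + 1)" by (rule arg_cong)
    also have "\<dots> = wt e K p powr (-g-2) * wt e K p powr 1" by (rule powr_add)
    also have "wt e K p powr 1 = wt e K p" using wt_pos[OF assms(1), of e p] by simp
    finally show ?thesis by (rule sym)
  qed
  then have "g * wt e K p powr (-g-2) * wt e K p = g * wt e K p powr (-g-1)"
    by (simp add: mult.assoc)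
  finally show ?thesis by simp
qed

lemma nn_integral_powr_tail:
  fixes g :: real
  assumes "g > 1"
  shows "(\<integral>\<^sup>+y. ennreal ((1 + \<bar>y\<bar>) powr (-g)) \<partial>lborel) \<le> ennreal (2 / (g - 1))"
proof -
  define f where "f y = (1 + \<bar>y\<bar>) powr (-g)" for y :: real
  have [measurable]: "f \<in> borel_measurable borel" unfolding f_def by measurable
  have "((\<lambda>x. (1 + x) powr (1-g)) \<longlongrightarrow> 0) at_top"
  proof (rule tendsto_neg_powr)
    show "filterlim (\<lambda>x. 1 + x :: real) at_top at_top"
      by (rule filterlim_tendsto_add_at_top[OF tendsto_const filterlim_ident])
  qed (use assms in auto)
  then have lim: "((\<lambda>x. - ((1 + x) powr (1-g)) / (g-1)) \<longlongrightarrow> 0) at_top"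
    using tendsto_divide[OF tendsto_minus tendsto_const[of "g-1"]] assms by fastforce
  have half: "(\<integral>\<^sup>+y. ennreal (f y) * indicator {0..} y \<partial>lborel) = ennreal (1 / (g - 1))"
  proof -
    have "(\<integral>\<^sup>+y. ennreal ((1 + y) powr (-g)) * indicator {0..} y \<partial>lborel) =
      0 - (- ((1 + 0) powr (1-g)) / (g-1))"
    proof (rule nn_integral_FTC_atLeast[OF _ _ _ lim])
      fix x :: real assume "0 \<le> x"
      then show "((\<lambda>x. - ((1 + x) powr (1-g)) / (g-1)) has_real_derivative (1 + x) powr (-g)) (at x)"
        using assms by (auto intro!: derivative_eq_intros simp: minus_divide_left[symmetric])
           (simp add: field_simps)
    qed auto
    moreover have "ennreal (f y) * indicator {0..} y = ennreal ((1 + y) powr (-g)) * indicator {0..} y" for y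
      by (auto simp: f_def indicator_def)
    ultimately show ?thesis by simp
  qed
  have "(\<integral>\<^sup>+y. ennreal (f y) * indicator {..0} y \<partial>lborel) =
      ennreal \<bar>-1\<bar> * (\<integral>\<^sup>+y. ennreal (f (0 + (-1) * y)) * indicator {..0} (0 + (-1) * y) \<partial>lborel)"
    by (rule nn_integral_real_affine) auto
  also have "\<dots> = (\<integral>\<^sup>+y. ennreal (f y) * indicator {0..} y \<partial>lborel)"
    by (auto simp: f_def indicator_def intro!: nn_integral_cong)
  finally have half2: "(\<integral>\<^sup>+y. ennreal (f y) * indicator {..0} y \<partial>lborel) = ennreal (1 / (g - 1))"
    using half by simp
  have "(\<integral>\<^sup>+y. ennreal (f y) \<partial>lborel) \<le>
    (\<integral>\<^sup>+y. ennreal (f y) * indicator {0..} y + ennreal (f y) * indicator {..0} y \<partial>lborel)"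
    by (intro nn_integral_mono) (auto simp: indicator_def)
  also have "\<dots> = ennreal (1 / (g - 1)) + ennreal (1 / (g - 1))"
    by (subst nn_integral_add) (auto simp: half half2)
  also have "\<dots> = ennreal (2 / (g - 1))"
    using assms by (subst ennreal_plus[symmetric]) auto
  finally show ?thesis by (simp add: f_def)
qed

lemma nn_integral_indicator_affine:
  fixes a b c d :: real
  assumes "c \<noteq> 0" "a \<le> b"
  shows "(\<integral>\<^sup>+x. indicator {a..b} (d + c * x) \<partial>lborel) = ennreal ((b - a) / \<bar>c\<bar>)"
proof -
  have "ennreal (b - a) = ennreal \<bar>c\<bar> * (\<integral>\<^sup>+x. indicator {a..b} (d + c * x) \<partial>lborel)"
    using nn_integral_real_affine[of "indicator {a..b}" c d] assms by simp
  then have "ennreal (1 / \<bar>c\<bar>) * ennreal (b - a) =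
    ennreal (1 / \<bar>c\<bar>) * ennreal \<bar>c\<bar> * (\<integral>\<^sup>+x. indicator {a..b} (d + c * x) \<partial>lborel)"
    by (simp add: mult.assoc)
  also have "ennreal (1 / \<bar>c\<bar>) * ennreal \<bar>c\<bar> = 1"
    using assms by (simp add: ennreal_mult[symmetric])
  finally show ?thesis using assms by (simp add: ennreal_mult[symmetric] field_simps)
qed

lemma nn_integral_strip:
  fixes a b :: real and n :: plane
  assumes [measurable]: "g \<in> borel_measurable borel" and "a \<le> b"
  shows "fst n \<noteq> 0 \<Longrightarrow> (\<integral>\<^sup>+p. indicator {a..b} (n \<bullet> p) * g (snd p) \<partial>lborel) =
      ennreal ((b - a) / \<bar>fst n\<bar>) * (\<integral>\<^sup>+y. g y \<partial>lborel)"
    and "snd n \<noteq> 0 \<Longrightarrow> (\<integral>\<^sup>+p. indicator {a..b} (n \<bullet> p) * g (fst p) \<partial>lborel) =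
      ennreal ((b - a) / \<bar>snd n\<bar>) * (\<integral>\<^sup>+y. g y \<partial>lborel)"
proof -
  have meas: "(\<lambda>p. indicator {a..b} (n \<bullet> p) * g (h p)) \<in> borel_measurable (lborel \<Otimes>\<^sub>M lborel)"
    if h: "continuous_on UNIV h" for h :: "plane \<Rightarrow> real"
  proof -
    have [measurable]: "h \<in> borel_measurable borel"
      using h by (rule borel_measurable_continuous_onI)
    have [measurable]: "(\<lambda>p. n \<bullet> p) \<in> borel_measurable borel"
      by (intro borel_measurable_continuous_onI continuous_intros)
    have "(\<lambda>p. indicator {a..b} (n \<bullet> p) * g (h p)) \<in> borel_measurable borel" by measurable
    then show ?thesis by (simp add: lborel_prod)
  qed
  have m1: "(\<lambda>p. indicator {a..b} (n \<bullet> p) * g (snd p)) \<in> borel_measurable (lborel \<Otimes>\<^sub>M lborel)"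
    and m2: "(\<lambda>p. indicator {a..b} (n \<bullet> p) * g (fst p)) \<in> borel_measurable (lborel \<Otimes>\<^sub>M lborel)"
    by (intro meas continuous_intros)+
  {
    assume n: "fst n \<noteq> 0"
    have "(\<integral>\<^sup>+p. indicator {a..b} (n \<bullet> p) * g (snd p) \<partial>lborel) =
      (\<integral>\<^sup>+y. (\<integral>\<^sup>+x. indicator {a..b} (n \<bullet> (x, y)) * g y \<partial>lborel) \<partial>lborel)"
      using lborel_pair.nn_integral_snd[OF m1] by (simp add: lborel_prod)
    also have "\<dots> = (\<integral>\<^sup>+y. ennreal ((b - a) / \<bar>fst n\<bar>) * g y \<partial>lborel)"
    proof (rule nn_integral_cong)
      fix y
      have "(\<integral>\<^sup>+x. indicator {a..b} (n \<bullet> (x, y)) * g y \<partial>lborel) =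
        (\<integral>\<^sup>+x. indicator {a..b} (snd n * y + fst n * x) \<partial>lborel) * g y"
        by (subst nn_integral_multc[symmetric]) (auto simp: inner_prod_def add.commute)
      then show "(\<integral>\<^sup>+x. indicator {a..b} (n \<bullet> (x, y)) * g y \<partial>lborel) = ennreal ((b - a) / \<bar>fst n\<bar>) * g y"
        using nn_integral_indicator_affine[OF n assms(2)] by simp
    qed
    also have "\<dots> = ennreal ((b - a) / \<bar>fst n\<bar>) * (\<integral>\<^sup>+y. g y \<partial>lborel)"
      by (rule nn_integral_cmult) simp
    finally show "(\<integral>\<^sup>+p. indicator {a..b} (n \<bullet> p) * g (snd p) \<partial>lborel) =
      ennreal ((b - a) / \<bar>fst n\<bar>) * (\<integral>\<^sup>+y. g y \<partial>lborel)" .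
  }
  {
    assume n: "snd n \<noteq> 0"
    have "(\<integral>\<^sup>+p. indicator {a..b} (n \<bullet> p) * g (fst p) \<partial>lborel) =
      (\<integral>\<^sup>+x. (\<integral>\<^sup>+y. indicator {a..b} (n \<bullet> (x, y)) * g x \<partial>lborel) \<partial>lborel)"
      using lborel.nn_integral_fst[OF m2] by (simp add: lborel_prod)
    also have "\<dots> = (\<integral>\<^sup>+x. ennreal ((b - a) / \<bar>snd n\<bar>) * g x \<partial>lborel)"
    proof (rule nn_integral_cong)
      fix x
      have "(\<integral>\<^sup>+y. indicator {a..b} (n \<bullet> (x, y)) * g x \<partial>lborel) =
        (\<integral>\<^sup>+y. indicator {a..b} (fst n * x + snd n * y) \<partial>lborel) * g x"
        by (subst nn_integral_multc[symmetric]) (auto simp: inner_prod_def)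
      then show "(\<integral>\<^sup>+y. indicator {a..b} (n \<bullet> (x, y)) * g x \<partial>lborel) = ennreal ((b - a) / \<bar>snd n\<bar>) * g x"
        using nn_integral_indicator_affine[OF n assms(2)] by simp
    qed
    also have "\<dots> = ennreal ((b - a) / \<bar>snd n\<bar>) * (\<integral>\<^sup>+y. g y \<partial>lborel)"
      by (rule nn_integral_cmult) simp
    finally show "(\<integral>\<^sup>+p. indicator {a..b} (n \<bullet> p) * g (fst p) \<partial>lborel) =
      ennreal ((b - a) / \<bar>snd n\<bar>) * (\<integral>\<^sup>+y. g y \<partial>lborel)" .
  }
qed

text \<open>The unit vector \<open>e\<close> measures the position along the closed strip \<open>a \<le> n \<bullet> p \<le> b\<close>: the norm grows at
most linearly in \<open>e \<bullet> p\<close>, with constant \<open>L\<close>, and the integrals of \<open>\<rho> powr (-g)\<close> behave as in dimension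
one. They are stated over compact subsets of the strip, uniformly.\<close>

definition strip_axis :: "plane \<Rightarrow> real \<Rightarrow> real \<Rightarrow> plane \<Rightarrow> real \<Rightarrow> real \<Rightarrow> bool" where
  "strip_axis n a b e L A \<longleftrightarrow> norm e = 1 \<and> L \<ge> 1 \<and> A \<ge> 0 \<and>
     (\<forall>p. a \<le> n \<bullet> p \<and> n \<bullet> p \<le> b \<longrightarrow> norm p \<le> L * (1 + \<bar>e \<bullet> p\<bar>)) \<and>
     (\<forall>K g C. 1 \<le> K \<longrightarrow> 1 < g \<longrightarrow> g \<le> 2 \<longrightarrow> compact C \<longrightarrow> C \<subseteq> {p. a \<le> n \<bullet> p \<and> n \<bullet> p \<le> b} \<longrightarrow>
        (LINT p:C|lborel. wt e K p powr (-g)) \<le> A / (g - 1))"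

lemma wt_powr_le:
  assumes "1 \<le> K" "0 < g" "g \<le> 2"
  shows "wt e K p powr (-g) \<le> 4 * (1 + \<bar>e \<bullet> p\<bar>) powr (-g)"
proof -
  have "(1 + \<bar>e \<bullet> p\<bar>) / 2 \<le> wt e K p"
    using wt_ge(1)[of K e p] wt_ge(2)[of e p K] assms(1) by simp
  then have "wt e K p powr (-g) \<le> ((1 + \<bar>e \<bullet> p\<bar>) / 2) powr (-g)"
    using assms by (intro powr_mono2') auto
  also have "\<dots> = 2 powr g * (1 + \<bar>e \<bullet> p\<bar>) powr (-g)"
    by (simp add: powr_divide powr_minus field_simps)
  also have "\<dots> \<le> 2 powr 2 * (1 + \<bar>e \<bullet> p\<bar>) powr (-g)"
    using assms by (intro mult_right_mono powr_mono) auto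
  finally show ?thesis by simp
qed

text \<open>It is not necessary that \<open>e\<close> be orthogonal to \<open>n\<close>. A coordinate vector not parallel to \<open>n\<close> will do,
and then no rotation of the plane is needed to apply Fubini.\<close>

lemma ex_strip_axis:
  fixes n :: plane
  assumes "n \<noteq> 0" "a \<le> b"
  shows "\<exists>e L A. strip_axis n a b e L A"
proof -
  define S where "S = {p::plane. a \<le> n \<bullet> p \<and> n \<bullet> p \<le> b}"
  have main: ?thesis
    if e: "norm e = 1" and cd: "c \<noteq> 0"
      and dec: "\<And>p. n \<bullet> p = c * (x p) + d * (e \<bullet> p)" and np: "\<And>p. norm p \<le> \<bar>x p\<bar> + \<bar>e \<bullet> p\<bar>"
      and nn: "\<And>g. g \<in> borel_measurable borel \<Longrightarrow>
        (\<integral>\<^sup>+p. indicator {a..b} (n \<bullet> p) * g (e \<bullet> p) \<partial>lborel) =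
          ennreal ((b - a) / \<bar>c\<bar>) * (\<integral>\<^sup>+y. g y \<partial>lborel)"
    for e :: plane and c d :: real and x :: "plane \<Rightarrow> real"
  proof -
    define L where "L = 1 + (\<bar>a\<bar> + \<bar>b\<bar> + \<bar>d\<bar>) / \<bar>c\<bar>"
    define A where "A = 4 * ((b - a) / \<bar>c\<bar> * 2)"
    have L: "norm p \<le> L * (1 + \<bar>e \<bullet> p\<bar>)" if "a \<le> n \<bullet> p" "n \<bullet> p \<le> b" for p
    proof -
      have "\<bar>c\<bar> * \<bar>x p\<bar> = \<bar>n \<bullet> p - d * (e \<bullet> p)\<bar>" using dec[of p] by (simp add: abs_mult)
      also have "\<dots> \<le> \<bar>n \<bullet> p\<bar> + \<bar>d\<bar> * \<bar>e \<bullet> p\<bar>" by (metis abs_mult abs_triangle_ineq4)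
      also have "\<bar>n \<bullet> p\<bar> \<le> \<bar>a\<bar> + \<bar>b\<bar>" using that by linarith
      finally have "\<bar>x p\<bar> \<le> (\<bar>a\<bar> + \<bar>b\<bar> + \<bar>d\<bar> * \<bar>e \<bullet> p\<bar>) / \<bar>c\<bar>"
        using cd by (simp add: field_simps)
      also have "\<dots> \<le> ((\<bar>a\<bar> + \<bar>b\<bar> + \<bar>d\<bar>) * (1 + \<bar>e \<bullet> p\<bar>)) / \<bar>c\<bar>"
        using cd by (intro divide_right_mono) (auto simp: algebra_simps)
      finally show ?thesis using np[of p] by (simp add: L_def algebra_simps)
    qed
    have A: "(LINT p:C|lborel. wt e K p powr (-g)) \<le> A / (g - 1)"
      if K: "1 \<le> K" and g: "1 < g" "g \<le> 2" and C: "compact C" "C \<subseteq> S" for K g C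
    proof -
      have si: "set_integrable lborel C (\<lambda>p. wt e K p powr (-g))"
        using C(1) K by (intro set_integrable_continuous_compact continuous_wt_powr) auto
      have "ennreal (LINT p:C|lborel. wt e K p powr (-g)) =
        (\<integral>\<^sup>+p. ennreal (indicator C p * wt e K p powr (-g)) \<partial>lborel)"
        using si unfolding set_lebesgue_integral_def set_integrable_def
        by (subst nn_integral_eq_integral[symmetric]) auto
      also have "\<dots> \<le> (\<integral>\<^sup>+p. indicator {a..b} (n \<bullet> p) * ennreal (4 * (1 + \<bar>e \<bullet> p\<bar>) powr (-g)) \<partial>lborel)"
        using wt_powr_le[OF K, of g e] g C(2)
        by (intro nn_integral_mono) (auto simp: indicator_def S_def intro!: ennreal_leI)
      also have "\<dots> = ennreal ((b - a) / \<bar>c\<bar>) * (\<integral>\<^sup>+y. ennreal (4 * (1 + \<bar>y\<bar>) powr (-g)) \<partial>lborel)"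
        by (rule nn) measurable
      also have "(\<integral>\<^sup>+y. ennreal (4 * (1 + \<bar>y\<bar>) powr (-g)) \<partial>lborel) =
        ennreal 4 * (\<integral>\<^sup>+y. ennreal ((1 + \<bar>y\<bar>) powr (-g)) \<partial>lborel)"
        by (subst nn_integral_cmult[symmetric]) (auto simp: ennreal_mult')
      also have "ennreal ((b - a) / \<bar>c\<bar>) * (ennreal 4 * (\<integral>\<^sup>+y. ennreal ((1 + \<bar>y\<bar>) powr (-g)) \<partial>lborel))
        \<le> ennreal ((b - a) / \<bar>c\<bar>) * (ennreal 4 * ennreal (2 / (g - 1)))"
        by (intro mult_left_mono nn_integral_powr_tail g) auto
      also have "\<dots> = ennreal (A / (g - 1))"
      proof -
        have "A / (g - 1) = (b - a) / \<bar>c\<bar> * (4 * (2 / (g - 1)))" by (simp add: A_def)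
        also have "ennreal \<dots> = ennreal ((b - a) / \<bar>c\<bar>) * ennreal (4 * (2 / (g - 1)))"
          by (rule ennreal_mult) (use assms g in auto)
        also have "ennreal (4 * (2 / (g - 1))) = ennreal 4 * ennreal (2 / (g - 1))"
          by (rule ennreal_mult) (use assms g in auto)
        finally show ?thesis by (rule sym)
      qed
      finally show ?thesis
        by (subst (asm) ennreal_le_iff) (use assms g in \<open>auto simp: A_def\<close>)
    qed
    have "strip_axis n a b e L A"
      unfolding strip_axis_def
    proof (intro conjI allI impI)
      show "norm e = 1" "L \<ge> 1" "A \<ge> 0" using e assms by (auto simp: L_def A_def)
    qed (use L A S_def in auto)
    then show ?thesis by blast
  qed
  have nrm: "norm p \<le> \<bar>fst p\<bar> + \<bar>snd p\<bar>" for p :: plane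
    unfolding norm_prod_def using sqrt_sum_squares_le_sum_abs[of "fst p" "snd p"] by simp
  show ?thesis
  proof (cases "fst n = 0")
    case False
    have "(0, 1) \<bullet> p = snd p" for p :: plane by (simp add: inner_prod_def)
    moreover have "n \<bullet> p = fst n * fst p + snd n * snd p" for p by (simp add: inner_prod_def)
    ultimately show ?thesis
      using nrm nn_integral_strip(1)[OF _ assms(2) False]
      by (intro main[of "(0,1)" "fst n" fst "snd n"] False) (simp_all add: norm_Pair)
  next
    case True
    then have n: "snd n \<noteq> 0" using assms(1) by (auto simp: prod_eq_iff)
    have "(1, 0) \<bullet> p = fst p" for p :: plane by (simp add: inner_prod_def)
    moreover have "n \<bullet> p = snd n * snd p + fst n * fst p" for p by (simp add: inner_prod_def)
    moreover have "norm p \<le> \<bar>snd p\<bar> + \<bar>fst p\<bar>" for p :: plane using nrm[of p] by simp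
    ultimately show ?thesis
      using nn_integral_strip(2)[OF _ assms(2) n]
      by (intro main[of "(1,0)" "snd n" snd "fst n"] n) (simp_all add: norm_Pair)
  qed
qed

section \<open>Cutoff functions\<close>

lemma has_real_derivative_pos_part:
  fixes F F' :: "real \<Rightarrow> real"
  assumes "\<And>x. 0 \<le> x \<Longrightarrow> (F has_real_derivative F' x) (at x)" "F' 0 = 0"
  shows "((\<lambda>x. F (max 0 x)) has_real_derivative F' (max 0 x)) (at x)"
proof -
  consider "x < 0" | "x = 0" | "x > 0" by linarith
  then show ?thesis
  proof cases
    case 1
    have "((\<lambda>x. F 0) has_real_derivative F' 0) (at x)" using assms(2) by simp
    then have "((\<lambda>x. F (max 0 x)) has_real_derivative F' 0) (at x)"
      by (rule has_field_derivative_transform_within_open[where S="{..<0}"]) (use 1 in auto)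
    then show ?thesis using 1 by (simp add: max_absorb1)
  next
    case 3
    have "(F has_real_derivative F' x) (at x)" using assms(1) 3 by simp
    then have "((\<lambda>x. F (max 0 x)) has_real_derivative F' x) (at x)"
      by (rule has_field_derivative_transform_within_open[where S="{0<..}"]) (use 3 in auto)
    then show ?thesis using 3 by (simp add: max_absorb2)
  next
    case 2
    have "(F has_real_derivative 0) (at 0)" using assms(1)[of 0] assms(2) by simp
    then have lim: "(\<lambda>h. (F h - F 0) / h) \<midarrow>0\<rightarrow> 0" by (simp add: DERIV_def)
    have "(\<lambda>h. (F (max 0 h) - F 0) / h) \<midarrow>0\<rightarrow> 0"
    proof (rule Lim_null_comparison[rotated, OF tendsto_norm_zero[OF lim]])
      have "norm ((F (max 0 h) - F 0) / h) \<le> norm ((F h - F 0) / h)" for h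
      proof (cases "h \<le> 0")
        case True
        then have "max 0 h = 0" by simp
        then show ?thesis by (simp only: diff_self div_0 norm_zero norm_ge_zero)
      next
        case False
        then have "max 0 h = h" by simp
        then show ?thesis by (simp only: order_refl)
      qed
      then show "\<forall>\<^sub>F h in at 0. norm ((F (max 0 h) - F 0) / h) \<le> norm ((F h - F 0) / h)"
        by (intro always_eventually allI)
    qed
    then show ?thesis using 2 assms(2) by (simp add: DERIV_def)
  qed
qed

text \<open>A \<open>C\<^sup>1\<close> step from 0 to 1 on the unit interval, with derivative \<open>step'\<close> between 0 and 2.\<close>

definition step :: "real \<Rightarrow> real" where
  "step y = 2 * (max 0 y)\<^sup>2 - 4 * (max 0 (y - 1/2))\<^sup>2 + 2 * (max 0 (y - 1))\<^sup>2"

definition step' :: "real \<Rightarrow> real" where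
  "step' y = 4 * max 0 y - 8 * max 0 (y - 1/2) + 4 * max 0 (y - 1)"

lemma step_has_derivative: "(step has_real_derivative step' y) (at y)"
proof -
  have d: "((\<lambda>x. (max 0 (x - c))\<^sup>2) has_real_derivative 2 * max 0 (x - c)) (at x)" for x c :: real
  proof -
    have "((\<lambda>x. (max 0 x)\<^sup>2) has_real_derivative 2 * max 0 (x - c)) (at (x - c))"
      by (rule has_real_derivative_pos_part[where F="\<lambda>x. x\<^sup>2" and F'="\<lambda>x. 2 * x"])
        (auto intro!: derivative_eq_intros)
    moreover have "((\<lambda>x. x - c) has_real_derivative 1) (at x)"
      by (auto intro!: derivative_eq_intros)
    ultimately show ?thesis
      using DERIV_chain2[where f="\<lambda>x. (max 0 x)\<^sup>2" and g="\<lambda>x. x - c"] by fastforce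
  qed
  show ?thesis
    unfolding step_def[abs_def] step'_def
    by (rule derivative_eq_intros d[of 0, simplified] d | simp)+
qed

lemma continuous_step': "continuous_on S step'"
  unfolding step'_def[abs_def] by (intro continuous_intros)

lemma step'_bounds: "0 \<le> step' y" "step' y \<le> 2"
  unfolding step'_def by (auto simp: max_def)

lemma step_0: "y \<le> 0 \<Longrightarrow> step y = 0" and step_1: "y \<ge> 1 \<Longrightarrow> step y = 1"
  and step'_0: "y \<le> 0 \<or> y \<ge> 1 \<Longrightarrow> step' y = 0"
  unfolding step_def step'_def by (auto simp: max_def power2_eq_square algebra_simps)

lemma step_mono: "x \<le> y \<Longrightarrow> step x \<le> step y"
  using step_has_derivative step'_bounds(1) DERIV_nonneg_imp_nondecreasing by blast

lemma step_bounds: "0 \<le> step y" "step y \<le> 1"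
  using step_mono[of "min y 0" y] step_0[of "min y 0"] step_mono[of y "max y 1"] step_1[of "max y 1"]
  by auto

lemma C1_on_step: "C1_on S f \<Longrightarrow> C1_on S (\<lambda>p. step (f p))"
  by (rule C1_on_compose[OF _ step_has_derivative continuous_step'])

lemma grad_step: "f differentiable at p \<Longrightarrow> grad (\<lambda>p. step (f p)) p = step' (f p) *\<^sub>R grad f p"
  by (rule grad_compose[OF _ step_has_derivative])

lemma norm_grad_mult_le:
  assumes "f differentiable at p" "g differentiable at p" "\<bar>f p\<bar> \<le> 1" "\<bar>g p\<bar> \<le> 1"
  shows "norm (grad (\<lambda>q. f q * g q) p) \<le> norm (grad f p) + norm (grad g p)"
proof -
  have "norm (grad (\<lambda>q. f q * g q) p) \<le> \<bar>f p\<bar> * norm (grad g p) + \<bar>g p\<bar> * norm (grad f p)"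
    unfolding grad_mult[OF assms(1,2)] by (rule order_trans[OF norm_triangle_ineq]) simp
  also have "\<dots> \<le> 1 * norm (grad g p) + 1 * norm (grad f p)"
    using assms by (intro add_mono mult_right_mono) auto
  finally show ?thesis by simp
qed

text \<open>Admissible cutoff functions. Neither compact support nor any vanishing is included.\<close>

definition cutoff :: "(plane \<Rightarrow> real) \<Rightarrow> bool" where
  "cutoff \<zeta> \<longleftrightarrow> C1_on UNIV \<zeta> \<and> (\<forall>p. 0 \<le> \<zeta> p \<and> \<zeta> p \<le> 1)"

lemma cutoff_mult: "cutoff f \<Longrightarrow> cutoff g \<Longrightarrow> cutoff (\<lambda>p. f p * g p)"
  unfolding cutoff_def by (auto intro: C1_on_mult mult_le_one)

lemma cutoff_grad_mult_le:
  "cutoff f \<Longrightarrow> cutoff g \<Longrightarrow> norm (grad (\<lambda>q. f q * g q) p) \<le> norm (grad f p) + norm (grad g p)"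
  unfolding cutoff_def
  by (intro norm_grad_mult_le C1_on_differentiable[of UNIV]) (auto simp del: split_paired_All)

lemma cutoff_continuous: "cutoff f \<Longrightarrow> continuous_on S f"
  and cutoff_continuous_grad: "cutoff f \<Longrightarrow> continuous_on S (grad f)"
  unfolding cutoff_def by (meson C1_on_continuous C1_on_continuous_grad continuous_on_subset subset_UNIV)+

lemma C1_on_norm_sq: "C1_on S (\<lambda>p::plane. (norm (p - d))\<^sup>2)"
  and grad_norm_sq: "grad (\<lambda>p. (norm (p - d))\<^sup>2) p = 2 *\<^sub>R (p - d)"
proof -
  have d: "((\<lambda>p. (norm (p - d))\<^sup>2) has_derivative (\<lambda>h. (2 *\<^sub>R (p - d)) \<bullet> h)) (at p)" for p
    unfolding power2_norm_eq_inner
    by (auto intro!: derivative_eq_intros simp: inner_commute inner_diff_left inner_diff_right)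
  show "C1_on S (\<lambda>p::plane. (norm (p - d))\<^sup>2)"
    by (rule C1_onI[OF d]) (intro continuous_intros)
  show "grad (\<lambda>p. (norm (p - d))\<^sup>2) p = 2 *\<^sub>R (p - d)" by (rule grad_eqI[OF d])
qed

text \<open>Points have zero capacity for the \<open>L\<^sup>1\<close> norm of the gradient: the gradient is of order \<open>1 / r\<close> on a
disc of area of order \<open>r\<^sup>2\<close>.\<close>

lemma point_cutoff:
  fixes d :: plane
  assumes r: "r > 0"
  shows "\<exists>\<psi>. cutoff \<psi> \<and> (\<forall>p. dist d p \<le> r \<longrightarrow> \<psi> p = 0) \<and> (\<forall>p. dist d p \<ge> 2 * r \<longrightarrow> \<psi> p = 1) \<and>
    (\<forall>C. compact C \<longrightarrow> (LINT p:C|lborel. norm (grad \<psi> p)) \<le> 128 * r)"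
proof -
  define f where "f p = (norm (p - d))\<^sup>2 * (1 / r\<^sup>2) + (- 1)" for p
  define \<psi> where "\<psi> p = step (f p)" for p
  have C1f: "C1_on UNIV f"
    unfolding f_def by (intro C1_on_add C1_on_mult C1_on_norm_sq C1_on_const)
  have gf: "grad f p = (2 / r\<^sup>2) *\<^sub>R (p - d)" for p
  proof (rule grad_eqI)
    have "((\<lambda>p. (norm (p - d))\<^sup>2) has_derivative (\<lambda>h. (2 *\<^sub>R (p - d)) \<bullet> h)) (at p)"
      using has_derivative_grad[OF C1_on_differentiable[OF C1_on_norm_sq[of UNIV d]], of p]
      by (simp add: grad_norm_sq)
    then have "(f has_derivative (\<lambda>h. ((2 *\<^sub>R (p - d)) \<bullet> h) * (1 / r\<^sup>2) + 0)) (at p)"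
      unfolding f_def by (intro has_derivative_add has_derivative_mult_left has_derivative_const)
    moreover have "((2 *\<^sub>R (p - d)) \<bullet> h) * (1 / r\<^sup>2) + 0 = ((2 / r\<^sup>2) *\<^sub>R (p - d)) \<bullet> h" for h
      by simp
    ultimately show "(f has_derivative (\<lambda>h. ((2 / r\<^sup>2) *\<^sub>R (p - d)) \<bullet> h)) (at p)"
      by (simp only:)
  qed
  have cut: "cutoff \<psi>"
    unfolding cutoff_def \<psi>_def using C1_on_step[OF C1f] step_bounds by auto
  have z: "\<psi> p = 0" if "dist d p \<le> r" for p
  proof -
    have "(norm (p - d))\<^sup>2 \<le> r\<^sup>2" using that by (intro power_mono) (auto simp: dist_norm norm_minus_commute)
    then show ?thesis using r unfolding \<psi>_def f_def by (intro step_0) (simp add: field_simps)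
  qed
  have far: "f p \<ge> 1" if "dist d p \<ge> 2 * r" for p
  proof -
    have "(2 * r)\<^sup>2 \<le> (norm (p - d))\<^sup>2"
      using that r by (intro power_mono) (auto simp: dist_norm norm_minus_commute)
    moreover have "2 * r\<^sup>2 \<le> (2 * r)\<^sup>2" by (simp add: power2_eq_square)
    ultimately have "2 * r\<^sup>2 \<le> (norm (p - d))\<^sup>2" by linarith
    then show ?thesis using r by (simp add: f_def field_simps)
  qed
  have gpsi: "grad \<psi> p = step' (f p) *\<^sub>R grad f p" for p
    unfolding \<psi>_def by (intro grad_step C1_on_differentiable[OF C1f UNIV_I])
  have gb: "norm (grad \<psi> p) \<le> 8 / r * indicator (cball d (2 * r)) p" for p
  proof (cases "dist d p \<le> 2 * r")
    case True
    have "norm (grad \<psi> p) = step' (f p) * (2 / r\<^sup>2 * norm (p - d))"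
      using step'_bounds(1)[of "f p"] by (simp add: gpsi gf abs_mult)
    also have "\<dots> \<le> 2 * (2 / r\<^sup>2 * (2 * r))"
      using step'_bounds[of "f p"] True r
      by (intro mult_mono) (auto simp: dist_norm norm_minus_commute)
    also have "\<dots> = 8 / r" using r by (simp add: power2_eq_square)
    finally show ?thesis using True by simp
  next
    case False
    then have "step' (f p) = 0" using far[of p] by (intro step'_0) auto
    then show ?thesis using False by (simp add: gpsi)
  qed
  have int: "(LINT p:C|lborel. norm (grad \<psi> p)) \<le> 128 * r" if C: "compact C" for C
  proof -
    have i: "set_integrable lborel C (\<lambda>p. norm (grad \<psi> p))"
      by (intro set_integrable_continuous_compact C continuous_intros cutoff_continuous_grad cut)
    have "(LINT p:C|lborel. norm (grad \<psi> p)) \<le> (LINT p|lborel. 8 / r * indicator (cball d (2 * r)) p)"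
      unfolding set_lebesgue_integral_def
    proof (rule integral_mono)
      show "integrable lborel (\<lambda>p. indicator C p *\<^sub>R norm (grad \<psi> p))"
        using i by (simp add: set_integrable_def)
      show "integrable lborel (\<lambda>p. 8 / r * indicator (cball d (2 * r)) p)"
        by (intro integrable_mult_right integrable_real_indicator)
          (use emeasure_bounded_finite[OF bounded_cball] in \<open>auto simp: less_top\<close>)
      show "indicator C p *\<^sub>R norm (grad \<psi> p) \<le> 8 / r * indicator (cball d (2 * r)) p" for p
        using gb[of p] r by (auto simp: indicator_def)
    qed
    also have "\<dots> = 8 / r * measure lborel (cball d (2 * r))" by simp
    also have "measure lborel (cball d (2 * r)) = pi * (2 * r)\<^sup>2"
      using r content_cball[of "2 * r" d] by (simp add: unit_ball_vol_2 power2_eq_square)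
    also have "8 / r * (pi * (2 * r)\<^sup>2) = 32 * r * pi"
      using r by (simp add: power2_eq_square field_simps)
    also have "\<dots> \<le> 32 * r * 4" using r pi_less_4 by (intro mult_left_mono) auto
    finally show ?thesis by simp
  qed
  show ?thesis
    using cut z far step_1 int by (intro exI[of _ \<psi>]) (auto simp: \<psi>_def)
qed

lemma set_integral_mono_continuous:
  fixes f g :: "plane \<Rightarrow> real"
  assumes "compact C" "continuous_on C f" "continuous_on C g" "\<And>p. p \<in> C \<Longrightarrow> f p \<le> g p"
  shows "(LINT p:C|lborel. f p) \<le> (LINT p:C|lborel. g p)"
  using assms by (intro set_integral_mono set_integrable_continuous_compact)

lemma set_integral_add_continuous:
  fixes f g :: "plane \<Rightarrow> real"
  assumes "compact C" "continuous_on C f" "continuous_on C g"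
  shows "(LINT p:C|lborel. f p + g p) = (LINT p:C|lborel. f p) + (LINT p:C|lborel. g p)"
  using assms by (intro set_integral_add set_integrable_continuous_compact)

lemma finite_cutoff:
  assumes "finite F" "closed H" "F \<inter> H = {}" "\<epsilon> > 0"
  shows "\<exists>\<psi> V. cutoff \<psi> \<and> (\<forall>p\<in>H. \<psi> p = 1) \<and> open V \<and> F \<subseteq> V \<and> (\<forall>p\<in>V. \<psi> p = 0) \<and>
    (\<forall>C. compact C \<longrightarrow> (LINT p:C|lborel. norm (grad \<psi> p)) \<le> \<epsilon>)"
  using assms
proof (induction arbitrary: \<epsilon> rule: finite_induct)
  case empty
  have "cutoff (\<lambda>_. 1)" by (simp add: cutoff_def)
  then show ?case using empty by (intro exI[of _ "\<lambda>_. 1"] exI[of _ "{}"]) auto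
next
  case (insert d F)
  have "F \<inter> H = {}" "\<epsilon> / 2 > 0" using insert.prems by auto
  from insert.IH[OF insert.prems(1) this] obtain \<psi> V where 1:
    "cutoff \<psi>" "\<forall>p\<in>H. \<psi> p = 1" "open V" "F \<subseteq> V" "\<forall>p\<in>V. \<psi> p = 0"
    "\<forall>C. compact C \<longrightarrow> (LINT p:C|lborel. norm (grad \<psi> p)) \<le> \<epsilon> / 2" by blast
  have "d \<in> - H" "open (- H)" using insert.prems by auto
  then obtain s where s: "s > 0" "ball d s \<subseteq> - H" by (meson open_contains_ball)
  define r where "r = min (s / 2) (\<epsilon> / 256)"
  have r: "r > 0" using s insert.prems by (simp add: r_def)
  from point_cutoff[OF r, of d] obtain \<eta> where 2:
    "cutoff \<eta>" "\<forall>p. dist d p \<le> r \<longrightarrow> \<eta> p = 0" "\<forall>p. dist d p \<ge> 2 * r \<longrightarrow> \<eta> p = 1"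
    "\<forall>C. compact C \<longrightarrow> (LINT p:C|lborel. norm (grad \<eta> p)) \<le> 128 * r" by blast
  have 3: "\<eta> p = 1" if "p \<in> H" for p
  proof -
    have "p \<notin> ball d s" using s that by auto
    then have "dist d p \<ge> 2 * r" by (simp add: r_def)
    then show ?thesis using 2 by blast
  qed
  have 4: "(LINT p:C|lborel. norm (grad (\<lambda>q. \<psi> q * \<eta> q) p)) \<le> \<epsilon>" if C: "compact C" for C
  proof -
    note cont = continuous_on_norm[OF cutoff_continuous_grad]
    have "(LINT p:C|lborel. norm (grad (\<lambda>q. \<psi> q * \<eta> q) p)) \<le>
        (LINT p:C|lborel. norm (grad \<psi> p) + norm (grad \<eta> p))"
      by (intro set_integral_mono_continuous C cutoff_grad_mult_le 1 2 continuous_on_add cont cutoff_mult)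
    also have "\<dots> = (LINT p:C|lborel. norm (grad \<psi> p)) + (LINT p:C|lborel. norm (grad \<eta> p))"
      by (intro set_integral_add_continuous C cont 1 2)
    also have "\<dots> \<le> \<epsilon> / 2 + 128 * r" using 1(6) 2(4) C by (intro add_mono) auto
    also have "\<dots> \<le> \<epsilon>" by (simp add: r_def)
    finally show ?thesis .
  qed
  show ?case
  proof (intro exI[of _ "\<lambda>q. \<psi> q * \<eta> q"] exI[of _ "V \<union> ball d r"] conjI)
    show "cutoff (\<lambda>q. \<psi> q * \<eta> q)" using 1 2 by (intro cutoff_mult)
    show "insert d F \<subseteq> V \<union> ball d r" using 1 r by auto
  qed (use 1 2 3 4 in auto)
qed

text \<open>A cutoff that is 1 on a given compact set, and vanishes near the points of \<open>D\<close> in the strip as well as far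
along the strip, with arbitrarily small weighted gradient. For the cutoff at the ends, of gradient
\<open>O(1/R)\<close> on a piece of length \<open>O(R)\<close>, any negative power of \<open>\<rho>\<close> suffices.\<close>

lemma strip_cutoff:
  assumes ax: "strip_axis n a b e L A" and D: "closed D" "discrete D"
    and H: "compact H" "H \<inter> D = {}" and K: "1 \<le> K" and g: "0 < g" "g \<le> 1" and \<epsilon>: "\<epsilon> > 0"
  shows "\<exists>\<zeta> V R. cutoff \<zeta> \<and> (\<forall>p\<in>H. \<zeta> p = 1) \<and> open V \<and>
    (\<forall>p\<in>D. a \<le> n \<bullet> p \<and> n \<bullet> p \<le> b \<and> \<bar>e \<bullet> p\<bar> \<le> R \<longrightarrow> p \<in> V) \<and> (\<forall>p\<in>V. \<zeta> p = 0) \<and>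
    (\<forall>p. \<bar>e \<bullet> p\<bar> > R \<longrightarrow> \<zeta> p = 0) \<and>
    (\<forall>C. compact C \<longrightarrow> C \<subseteq> {p. a \<le> n \<bullet> p \<and> n \<bullet> p \<le> b} \<longrightarrow>
      (LINT p:C|lborel. norm (grad \<zeta> p) * wt e K p powr (-g)) \<le> \<epsilon>)"
proof -
  have e1: "norm e = 1" and A: "A \<ge> 0"
    and np: "\<And>p. a \<le> n \<bullet> p \<Longrightarrow> n \<bullet> p \<le> b \<Longrightarrow> norm p \<le> L * (1 + \<bar>e \<bullet> p\<bar>)"
    and L: "L \<ge> 1" using ax by (auto simp: strip_axis_def)
  have iA: "\<And>g C. 1 < g \<Longrightarrow> g \<le> 2 \<Longrightarrow> compact C \<Longrightarrow> C \<subseteq> {p. a \<le> n \<bullet> p \<and> n \<bullet> p \<le> b} \<Longrightarrow>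
        (LINT p:C|lborel. wt e K p powr (-g)) \<le> A / (g - 1)"
    using ax K by (auto simp: strip_axis_def)
  obtain B where B: "B > 0" "\<And>p. p \<in> H \<Longrightarrow> norm p \<le> B"
    using compact_imp_bounded[OF H(1)] by (meson bounded_pos)
  have "((\<lambda>R. (24 * A / (g/2)) * R powr (-g/2)) \<longlongrightarrow> (24 * A / (g/2)) * 0) at_top"
    using g by (intro tendsto_mult tendsto_const tendsto_neg_powr filterlim_ident) auto
  then have "\<forall>\<^sub>F R in at_top. (24 * A / (g/2)) * R powr (-g/2) < \<epsilon> / 2"
    using \<epsilon> by (intro order_tendstoD(2)) auto
  then obtain R0 where R0: "\<And>R. R \<ge> R0 \<Longrightarrow> (24 * A / (g/2)) * R powr (-g/2) < \<epsilon> / 2"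
    unfolding eventually_at_top_linorder by blast
  define R where "R = max R0 (max K B)"
  have R: "R \<ge> K" "R \<ge> B" "R \<ge> R0" "R > 0" using K by (auto simp: R_def)
  define f where "f p = (e \<bullet> p) * (e \<bullet> p) * (1 / R\<^sup>2) + (- 1)" for p
  define \<theta> where "\<theta> p = 1 - step (f p)" for p
  have C1f: "C1_on UNIV f"
    unfolding f_def by (intro C1_on_add C1_on_mult C1_on_inner C1_on_const)
  have c: "(\<lambda>q. c) differentiable at p" for c :: real and p :: plane by simp
  have gf: "grad f p = (2 * (e \<bullet> p) / R\<^sup>2) *\<^sub>R e" for p
  proof (rule grad_eqI)
    show "(f has_derivative (\<lambda>h. ((2 * (e \<bullet> p) / R\<^sup>2) *\<^sub>R e) \<bullet> h)) (at p)"
      unfolding f_def by (rule derivative_eq_intros | simp add: mult_ac)+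
  qed
  have df: "f differentiable at p" for p by (rule C1_on_differentiable[OF C1f UNIV_I])
  have C1s: "C1_on UNIV (\<lambda>p. step (f p))" by (rule C1_on_step[OF C1f])
  have cut: "cutoff \<theta>"
    unfolding cutoff_def \<theta>_def using step_bounds by (auto intro!: C1_on_diff C1s)
  have gtheta: "grad \<theta> p = - (step' (f p) *\<^sub>R grad f p)" for p
    unfolding \<theta>_def grad_diff[OF c C1_on_differentiable[OF C1s UNIV_I]] grad_step[OF df] by simp
  have near: "f p \<le> 0" if "\<bar>e \<bullet> p\<bar> \<le> R" for p
  proof -
    have "(e \<bullet> p)\<^sup>2 \<le> R\<^sup>2" using that R by (intro power2_le_iff_abs_le[THEN iffD2]) auto
    then show ?thesis using R by (simp add: f_def power2_eq_square[symmetric] field_simps)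
  qed
  have far: "f p \<ge> 1" if "\<bar>e \<bullet> p\<bar> \<ge> 2 * R" for p
  proof -
    have "(2 * R)\<^sup>2 \<le> \<bar>e \<bullet> p\<bar>\<^sup>2" using that R by (intro power_mono) auto
    then have "(2 * R)\<^sup>2 \<le> (e \<bullet> p)\<^sup>2" by simp
    moreover have "2 * R\<^sup>2 \<le> (2 * R)\<^sup>2" by (simp add: power2_eq_square)
    ultimately have "2 * R\<^sup>2 \<le> (e \<bullet> p)\<^sup>2" by linarith
    then show ?thesis using R by (simp add: f_def power2_eq_square[symmetric] field_simps)
  qed
  have gb: "norm (grad \<theta> p) * wt e K p powr (-g) \<le> 24 * R powr (-g/2) * wt e K p powr (-(1 + g/2))" for p
  proof (cases "R \<le> \<bar>e \<bullet> p\<bar> \<and> \<bar>e \<bullet> p\<bar> \<le> 2 * R")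
    case True
    let ?w = "wt e K p"
    have w: "?w > 0" using wt_pos K by simp
    have wR: "?w \<ge> R" using wt_ge(2)[of e p K] True by simp
    have "?w \<le> K + \<bar>e \<bullet> p\<bar>" unfolding wt_def using sqrt_sum_squares_le_sum_abs[of K "e \<bullet> p"] K by simp
    then have w3: "?w \<le> 3 * R" using True R by simp
    have "norm (grad \<theta> p) = step' (f p) * (2 * \<bar>e \<bullet> p\<bar> / R\<^sup>2)"
      using step'_bounds(1)[of "f p"] e1 by (simp add: gtheta gf abs_mult)
    also have "\<dots> \<le> 2 * (2 * (2 * R) / R\<^sup>2)"
      using step'_bounds[of "f p"] True by (intro mult_mono divide_right_mono) auto
    also have "\<dots> = 8 / R" using R by (simp add: power2_eq_square)
    finally have 1: "norm (grad \<theta> p) \<le> 8 / R" .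
    have "?w powr (-g) = ?w powr (-g/2) * (?w * ?w powr (-(1 + g/2)))"
      using w by (simp add: powr_mult_base powr_add[symmetric])
    also have "\<dots> \<le> R powr (-g/2) * ((3 * R) * ?w powr (-(1 + g/2)))"
      using wR w3 R w g by (intro mult_mono powr_mono2') auto
    finally have 2: "?w powr (-g) \<le> R powr (-g/2) * ((3 * R) * ?w powr (-(1 + g/2)))" .
    have "norm (grad \<theta> p) * ?w powr (-g) \<le> 8 / R * (R powr (-g/2) * ((3 * R) * ?w powr (-(1 + g/2))))"
      using 1 2 R by (intro mult_mono) auto
    also have "\<dots> = 24 * R powr (-g/2) * ?w powr (-(1 + g/2))" using R by simp
    finally show ?thesis .
  next
    case False
    then have "step' (f p) = 0" using near[of p] far[of p] by (intro step'_0) linarith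
    then show ?thesis by (simp add: gtheta)
  qed
  define F where "F = D \<inter> {p. a \<le> n \<bullet> p \<and> n \<bullet> p \<le> b \<and> \<bar>e \<bullet> p\<bar> \<le> 2 * R}"
  have "finite F"
  proof -
    define S where "S = {p. a \<le> n \<bullet> p \<and> n \<bullet> p \<le> b \<and> \<bar>e \<bullet> p\<bar> \<le> 2 * R}"
    have "norm p \<le> L * (1 + 2 * R)" if "p \<in> S" for p
    proof -
      have "norm p \<le> L * (1 + \<bar>e \<bullet> p\<bar>)" using np that by (auto simp: S_def)
      also have "L * (1 + \<bar>e \<bullet> p\<bar>) \<le> L * (1 + 2 * R)"
        using L that by (intro mult_left_mono) (auto simp: S_def)
      finally show ?thesis .
    qed
    then have "bounded S" by (rule boundedI)
    moreover have "S = {p. a \<le> n \<bullet> p} \<inter> {p. n \<bullet> p \<le> b} \<inter> {p. \<bar>e \<bullet> p\<bar> \<le> 2 * R}"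
      by (auto simp: S_def)
    then have "closed S"
      by (simp only:) (intro closed_Int closed_Collect_le continuous_intros)
    ultimately have "compact S" by (simp add: compact_eq_bounded_closed)
    then have "compact F"
      using D(1) closed_Int_compact by (simp add: F_def S_def)
    moreover have "discrete F" using D(2) by (rule discrete_subset) (simp add: F_def)
    ultimately show ?thesis
      using finite_not_islimpt_in_compact[of F F] by (simp add: discrete_def isolated_in_islimpt_iff)
  qed
  moreover have "F \<inter> H = {}" using H(2) by (auto simp: F_def)
  moreover have "\<epsilon> / 2 > 0" using \<epsilon> by simp
  ultimately have "\<exists>\<psi> V. cutoff \<psi> \<and> (\<forall>p\<in>H. \<psi> p = 1) \<and> open V \<and> F \<subseteq> V \<and> (\<forall>p\<in>V. \<psi> p = 0) \<and>
    (\<forall>C. compact C \<longrightarrow> (LINT p:C|lborel. norm (grad \<psi> p)) \<le> \<epsilon> / 2)"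
    by (intro finite_cutoff compact_imp_closed[OF H(1)])
  then obtain \<psi> V where \<psi>: "cutoff \<psi>" "\<forall>p\<in>H. \<psi> p = 1" "open V" "F \<subseteq> V" "\<forall>p\<in>V. \<psi> p = 0"
    "\<forall>C. compact C \<longrightarrow> (LINT p:C|lborel. norm (grad \<psi> p)) \<le> \<epsilon> / 2"
    by blast
  have int: "(LINT p:C|lborel. norm (grad (\<lambda>q. \<theta> q * \<psi> q) p) * wt e K p powr (-g)) \<le> \<epsilon>"
    if C: "compact C" "C \<subseteq> {p. a \<le> n \<bullet> p \<and> n \<bullet> p \<le> b}" for C
  proof -
    note cont = continuous_on_norm[OF cutoff_continuous_grad]
    have K0: "K > 0" using K by simp
    have p1: "norm (grad (\<lambda>q. \<theta> q * \<psi> q) p) * wt e K p powr (-g) \<le>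
       24 * R powr (-g/2) * wt e K p powr (-(1 + g/2)) + norm (grad \<psi> p)" for p
    proof -
      have w1: "wt e K p powr (-g) \<le> 1"
        using powr_mono2'[of "-g" 1 "wt e K p"] wt_ge(1)[of K e p] K g by simp
      have "norm (grad (\<lambda>q. \<theta> q * \<psi> q) p) * wt e K p powr (-g) \<le>
          (norm (grad \<theta> p) + norm (grad \<psi> p)) * wt e K p powr (-g)"
        by (intro mult_right_mono cutoff_grad_mult_le cut \<psi>) auto
      also have "\<dots> \<le> norm (grad \<theta> p) * wt e K p powr (-g) + norm (grad \<psi> p)"
        using w1 by (simp add: algebra_simps mult_left_le)
      finally show ?thesis using gb[of p] by simp
    qed
    have "(LINT p:C|lborel. norm (grad (\<lambda>q. \<theta> q * \<psi> q) p) * wt e K p powr (-g)) \<le>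
      (LINT p:C|lborel. 24 * R powr (-g/2) * wt e K p powr (-(1 + g/2)) + norm (grad \<psi> p))"
      by (intro set_integral_mono_continuous C p1 continuous_on_mult continuous_on_add cont cut \<psi>
          cutoff_mult continuous_wt_powr K0 continuous_on_const)
    also have "\<dots> = (LINT p:C|lborel. 24 * R powr (-g/2) * wt e K p powr (-(1 + g/2))) +
       (LINT p:C|lborel. norm (grad \<psi> p))"
      by (intro set_integral_add_continuous C continuous_on_mult cont \<psi>
          continuous_wt_powr K0 continuous_on_const)
    also have "\<dots> \<le> 24 * R powr (-g/2) * (A / ((1 + g/2) - 1)) + \<epsilon> / 2"
    proof (rule add_mono)
      show "(LINT p:C|lborel. 24 * R powr (-g/2) * wt e K p powr (-(1 + g/2))) \<le>
        24 * R powr (-g/2) * (A / ((1 + g/2) - 1))"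
        unfolding set_integral_mult_right using g C by (intro mult_left_mono iA) auto
    qed (use \<psi> C in blast)
    also have "24 * R powr (-g/2) * (A / ((1 + g/2) - 1)) = (24 * A / (g/2)) * R powr (-g/2)" by simp
    also have "\<dots> + \<epsilon> / 2 \<le> \<epsilon>" using R0[OF R(3)] by linarith
    finally show ?thesis .
  qed
  show ?thesis
  proof (intro exI[of _ "\<lambda>q. \<theta> q * \<psi> q"] exI[of _ V] exI[of _ "2 * R"] conjI)
    show "cutoff (\<lambda>q. \<theta> q * \<psi> q)" by (intro cutoff_mult cut \<psi>)
    show "\<forall>p\<in>H. \<theta> p * \<psi> p = 1"
    proof
      fix p assume p: "p \<in> H"
      have "\<bar>e \<bullet> p\<bar> \<le> norm e * norm p" by (rule Cauchy_Schwarz_ineq2)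
      then have "\<bar>e \<bullet> p\<bar> \<le> R" using B(2)[OF p] R e1 by simp
      then show "\<theta> p * \<psi> p = 1" using near p \<psi>(2) by (simp add: \<theta>_def step_0)
    qed
    show "\<forall>p\<in>D. a \<le> n \<bullet> p \<and> n \<bullet> p \<le> b \<and> \<bar>e \<bullet> p\<bar> \<le> 2 * R \<longrightarrow> p \<in> V"
      using \<psi>(4) by (auto simp: F_def)
    show "\<forall>p. \<bar>e \<bullet> p\<bar> > 2 * R \<longrightarrow> \<theta> p * \<psi> p = 0"
      by (simp add: \<theta>_def step_1 far)
    show "open V" by fact
    show "\<forall>p\<in>V. \<theta> p * \<psi> p = 0" using \<psi>(5) by simp
    show "\<forall>C. compact C \<longrightarrow> C \<subseteq> {p. a \<le> n \<bullet> p \<and> n \<bullet> p \<le> b} \<longrightarrow>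
      (LINT p:C|lborel. norm (grad (\<lambda>q. \<theta> q * \<psi> q) p) * wt e K p powr (-g)) \<le> \<epsilon>"
      using int by blast
  qed
qed

section \<open>Testing with functions of the difference\<close>

text \<open>\<open>F\<close> is a nondecreasing nonnegative \<open>C\<^sup>1\<close> function on the half line, with derivative \<open>F'\<close>, such that \<open>F (max 0 x)\<close> is
\<open>C\<^sup>1\<close> on the whole line.\<close>

definition profile :: "(real \<Rightarrow> real) \<Rightarrow> (real \<Rightarrow> real) \<Rightarrow> bool" where
  "profile F F' \<longleftrightarrow> (\<forall>x\<ge>0. (F has_real_derivative F' x) (at x)) \<and> continuous_on {0..} F' \<and>
     F 0 = 0 \<and> F' 0 = 0 \<and> (\<forall>x\<ge>0. 0 \<le> F x \<and> 0 \<le> F' x)"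

text \<open>The excess of \<open>s\<close> over the level \<open>\<epsilon>\<close>. Testing with functions of the excess, for positive \<open>\<epsilon>\<close>, makes the
supports compact.\<close>

definition excess :: "real \<Rightarrow> real \<Rightarrow> real" where
  "excess \<epsilon> s = max 0 (s - \<epsilon>)"

lemma excess_nonneg: "0 \<le> excess \<epsilon> s"
  by (simp add: excess_def)

lemma profile_excess_has_derivative:
  assumes "profile F F'"
  shows "((\<lambda>s. F (excess \<epsilon> s)) has_real_derivative F' (excess \<epsilon> s)) (at s)"
proof -
  have "((\<lambda>x. F (max 0 x)) has_real_derivative F' (max 0 (s - \<epsilon>))) (at (s - \<epsilon>))"
    using assms unfolding profile_def by (intro has_real_derivative_pos_part) auto
  moreover have "((\<lambda>x. x - \<epsilon>) has_real_derivative 1) (at s)"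
    by (auto intro!: derivative_eq_intros)
  ultimately show ?thesis
    unfolding excess_def
    using DERIV_chain2[where f="\<lambda>x. F (max 0 x)" and g="\<lambda>x. x - \<epsilon>"] by fastforce
qed

lemma profile_continuous:
  assumes "profile F F'"
  shows "continuous_on {0..} F" "continuous_on {0..} F'"
  using assms DERIV_isCont unfolding profile_def
  by (auto intro!: continuous_at_imp_continuous_on) 

lemma continuous_on_excess_compose:
  assumes "continuous_on {0..} F" "continuous_on S w"
  shows "continuous_on S (\<lambda>p. F (excess \<epsilon> (w p)))"
proof (rule continuous_on_compose2[OF assms(1)])
  show "continuous_on S (\<lambda>p. excess \<epsilon> (w p))"
    unfolding excess_def using assms(2) by (intro continuous_intros)
qed (auto simp: excess_nonneg)

lemma C1_on_profile_excess:
  assumes "profile F F'" "C1_on S w"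
  shows "C1_on S (\<lambda>p. F (excess \<epsilon> (w p)))"
proof (rule C1_on_compose[OF assms(2) profile_excess_has_derivative[OF assms(1)]])
  show "continuous_on (w ` S) (\<lambda>s. F' (excess \<epsilon> s))"
    by (intro continuous_on_excess_compose profile_continuous[OF assms(1)] continuous_on_id)
qed

text \<open>The field \<open>Y\<close> of constant divergence \<open>k\<close> is tested with \<open>\<theta> F(w - \<epsilon>)\<close>. This is used with \<open>k = 0\<close>, and with
\<open>k = 1\<close> for the Poincare inequality.\<close>

lemma test_identity:
  assumes \<Omega>: "open \<Omega>" and C: "compact C" "C \<subseteq> \<Omega>"
    and \<theta>: "C1_on \<Omega> \<theta>" and w: "C1_on \<Omega> w" and F: "profile F F'"
    and off: "\<And>p. p \<in> \<Omega> - C \<Longrightarrow> \<theta> p = 0 \<or> w p \<le> \<epsilon>"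
    and Y: "C1_on \<Omega> (\<lambda>q. fst (Y q))" "C1_on \<Omega> (\<lambda>q. snd (Y q))"
    and div: "\<And>p. p \<in> \<Omega> \<Longrightarrow> divergence Y p = k"
  shows "(LINT p:C|lborel. F (excess \<epsilon> (w p)) * (grad \<theta> p \<bullet> Y p) +
      \<theta> p * F' (excess \<epsilon> (w p)) * (grad w p \<bullet> Y p) + k * (\<theta> p * F (excess \<epsilon> (w p)))) = 0" (is "?I = 0")
    and "continuous_on C (\<lambda>p. F (excess \<epsilon> (w p)) * (grad \<theta> p \<bullet> Y p) +
      \<theta> p * F' (excess \<epsilon> (w p)) * (grad w p \<bullet> Y p) + k * (\<theta> p * F (excess \<epsilon> (w p))))"
proof -
  define f where "f p = \<theta> p * F (excess \<epsilon> (w p))" for p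
  note Fw = C1_on_profile_excess[OF F w, of \<epsilon>]
  have C1f: "C1_on \<Omega> f" unfolding f_def by (intro C1_on_mult \<theta> Fw)
  have f0: "f p = 0" if "p \<in> \<Omega> - C" for p
  proof -
    have "w p \<le> \<epsilon> \<Longrightarrow> F (excess \<epsilon> (w p)) = 0"
      using F by (simp add: excess_def profile_def max_absorb1)
    then show ?thesis using off[OF that] by (auto simp: f_def)
  qed
  have gf: "grad f p = F (excess \<epsilon> (w p)) *\<^sub>R grad \<theta> p + (\<theta> p * F' (excess \<epsilon> (w p))) *\<^sub>R grad w p"
    if p: "p \<in> \<Omega>" for p
    unfolding f_def grad_mult[OF C1_on_differentiable[OF \<theta> p] C1_on_differentiable[OF Fw p]]
      grad_compose[OF C1_on_differentiable[OF w p] profile_excess_has_derivative[OF F]]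
    by (simp add: algebra_simps)
  have "0 = (LINT p:C|lborel. grad f p \<bullet> Y p + f p * divergence Y p)"
    using integral_by_parts[OF \<Omega> C C1f f0 Y] by simp
  also have "\<dots> = ?I"
    using C gf div by (intro set_lebesgue_integral_cong)
      (auto simp: compact_imp_closed f_def inner_add_left subset_iff simp del: split_paired_All)
  finally show "?I = 0" by simp
  have cY: "continuous_on C Y"
  proof -
    have "continuous_on C (\<lambda>p. (fst (Y p), snd (Y p)))"
      using Y C by (intro continuous_on_Pair) (blast intro: continuous_on_subset C1_on_continuous)+
    then show ?thesis by simp
  qed
  have "continuous_on C \<theta>" "continuous_on C (grad \<theta>)" "continuous_on C w" "continuous_on C (grad w)"
    using \<theta> w C by (blast intro: continuous_on_subset C1_on_continuous C1_on_continuous_grad)+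
  then show "continuous_on C (\<lambda>p. F (excess \<epsilon> (w p)) * (grad \<theta> p \<bullet> Y p) +
      \<theta> p * F' (excess \<epsilon> (w p)) * (grad w p \<bullet> Y p) + k * (\<theta> p * F (excess \<epsilon> (w p))))"
    by (intro continuous_intros cY continuous_on_excess_compose profile_continuous[OF F])
qed

lemma set_integral_combination:
  fixes f g :: "plane \<Rightarrow> real"
  assumes "compact C" "continuous_on C f" "continuous_on C g"
  shows "(LINT p:C|lborel. c * f p + d * g p) = c * (LINT p:C|lborel. f p) + d * (LINT p:C|lborel. g p)"
proof -
  have "(LINT p:C|lborel. c * f p + d * g p) = (LINT p:C|lborel. c * f p) + (LINT p:C|lborel. d * g p)"
    by (intro set_integral_add_continuous assms continuous_intros)
  then show ?thesis by simp
qed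

lemma set_integral_mono_subset:
  fixes f :: "plane \<Rightarrow> real"
  assumes "compact C" "compact H" "H \<subseteq> C" "continuous_on C f" "\<And>p. p \<in> C \<Longrightarrow> 0 \<le> f p"
  shows "(LINT p:H|lborel. f p) \<le> (LINT p:C|lborel. f p)"
proof -
  have "set_integrable lborel C f" "set_integrable lborel H f"
    using assms by (auto intro: set_integrable_continuous_compact continuous_on_subset)
  then show ?thesis
    unfolding set_lebesgue_integral_def set_integrable_def using assms(3,5)
    by (intro integral_mono) (auto simp: indicator_def simp del: split_paired_All)
qed

text \<open>An open subset \<open>\<Omega>\<close> of a strip and a closed discrete subset \<open>D\<close> of its frontier, on which nothing will be
assumed. Later \<open>D\<close> is the set where the boundary data may jump.\<close>

locale strip_domain =
  fixes n :: plane and a b :: real and e :: plane and L A :: real and \<Omega> D :: "plane set"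
  assumes n: "n \<noteq> 0" and ab: "a \<le> b" and ax: "strip_axis n a b e L A"
    and \<Omega>: "open \<Omega>" and strip: "\<Omega> \<subseteq> {p. a \<le> n \<bullet> p \<and> n \<bullet> p \<le> b}"
    and D: "closed D" "discrete D" "D \<subseteq> frontier \<Omega>"
begin

text \<open>The upper limit of \<open>w\<close> is nonpositive at every frontier point outside \<open>D\<close>.\<close>

definition nonpos_at_boundary :: "(plane \<Rightarrow> real) \<Rightarrow> bool" where
  "nonpos_at_boundary w \<longleftrightarrow>
     (\<forall>q\<in>frontier \<Omega> - D. \<forall>\<epsilon>>0. \<forall>\<^sub>F p in at q within \<Omega>. w p < \<epsilon>)"

text \<open>The Euclidean width of the strip.\<close>

definition width :: real where
  "width = (b - a) / norm n"

lemma width_nonneg: "0 \<le> width"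
  using ab by (simp add: width_def)

lemma axis: "norm e = 1" "1 \<le> L" "0 \<le> A"
  "a \<le> n \<bullet> p \<Longrightarrow> n \<bullet> p \<le> b \<Longrightarrow> norm p \<le> L * (1 + \<bar>e \<bullet> p\<bar>)"
  using ax unfolding strip_axis_def by blast+

lemma integral_wt:
  assumes "1 \<le> K" "0 < \<alpha>" "\<alpha> \<le> 1" "compact C" "C \<subseteq> \<Omega>"
  shows "(LINT p:C|lborel. wt e K p powr (-(1 + \<alpha>))) \<le> A / \<alpha>"
proof -
  have "C \<subseteq> {p. a \<le> n \<bullet> p \<and> n \<bullet> p \<le> b}" using assms(5) strip by (rule order_trans)
  moreover have "1 < 1 + \<alpha>" "1 + \<alpha> \<le> 2" using assms by auto
  ultimately have "(LINT p:C|lborel. wt e K p powr (-(1 + \<alpha>))) \<le> A / ((1 + \<alpha>) - 1)"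
    using ax assms(1,4) unfolding strip_axis_def by blast
  then show ?thesis by simp
qed

text \<open>This is what replaces boundary regularity: once the points of \<open>D\<close> and the ends of the strip are cut
off, the set where \<open>w\<close> is at least \<open>\<epsilon>\<close> is a compact subset of \<open>\<Omega>\<close>.\<close>

lemma compact_superlevel:
  assumes w: "continuous_on \<Omega> w" "nonpos_at_boundary w" and V: "open V"
    and cover: "\<And>p. p \<in> D \<Longrightarrow> a \<le> n \<bullet> p \<Longrightarrow> n \<bullet> p \<le> b \<Longrightarrow> \<bar>e \<bullet> p\<bar> \<le> R \<Longrightarrow> p \<in> V"
    and \<epsilon>: "\<epsilon> > 0"
  shows "compact {p \<in> \<Omega>. \<epsilon> \<le> w p \<and> p \<notin> V \<and> \<bar>e \<bullet> p\<bar> \<le> R}"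
proof -
  define C where "C = {p \<in> \<Omega>. \<epsilon> \<le> w p \<and> p \<notin> V \<and> \<bar>e \<bullet> p\<bar> \<le> R}"
  define B where "B = {p. a \<le> n \<bullet> p} \<inter> {p. n \<bullet> p \<le> b} \<inter> {p. \<bar>e \<bullet> p\<bar> \<le> R} \<inter> - V"
  have "closed B"
    unfolding B_def using V by (intro closed_Int closed_Collect_le continuous_intros) auto
  have CB: "C \<subseteq> B" using strip by (auto simp: C_def B_def)
  have "norm p \<le> L * (1 + \<bar>R\<bar>)" if "p \<in> C" for p
  proof -
    have "a \<le> n \<bullet> p" "n \<bullet> p \<le> b" using CB that by (auto simp: B_def)
    then have "norm p \<le> L * (1 + \<bar>e \<bullet> p\<bar>)" by (rule axis(4))
    also have "\<dots> \<le> L * (1 + \<bar>R\<bar>)"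
    proof (rule mult_left_mono)
      have "\<bar>e \<bullet> p\<bar> \<le> R" using that by (simp add: C_def)
      then show "1 + \<bar>e \<bullet> p\<bar> \<le> 1 + \<bar>R\<bar>" by linarith
    qed (use axis(2) in linarith)
    finally show ?thesis .
  qed
  then have "bounded C" by (rule boundedI)
  have "q \<in> C" if q: "q \<in> closure C" for q
  proof -
    have qB: "q \<in> B" using q CB \<open>closed B\<close> closure_minimal by blast
    have meet: "U \<inter> C \<noteq> {}" if "open U" "q \<in> U" for U
      using q that by (metis closure_iff_nhds_not_empty inf.commute order_refl)
    have False if "\<not> (q \<in> \<Omega> \<and> \<epsilon> \<le> w q)"
    proof (cases "q \<in> \<Omega>")
      case True
      have "open {p \<in> \<Omega>. w p < \<epsilon>}"
        using continuous_open_preimage[OF w(1) \<Omega>, of "{..<\<epsilon>}"] by (simp add: vimage_def Int_def)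
      from meet[OF this] show False using True that by (auto simp: C_def)
    next
      case False
      have "q \<in> closure \<Omega>" using q closure_mono[of C \<Omega>] by (auto simp: C_def)
      then have "q \<in> frontier \<Omega>" using False \<Omega> by (simp add: frontier_def interior_open)
      moreover have "q \<notin> D" using cover[of q] qB by (auto simp: B_def)
      ultimately have "\<forall>\<^sub>F p in at q within \<Omega>. w p < \<epsilon>"
        using w(2) \<epsilon> unfolding nonpos_at_boundary_def by blast
      then obtain U where U: "open U" "q \<in> U" "\<And>p. p \<in> U \<Longrightarrow> p \<noteq> q \<Longrightarrow> p \<in> \<Omega> \<Longrightarrow> w p < \<epsilon>"
        unfolding eventually_at_topological by blast
      from meet[OF U(1,2)] obtain p where p: "p \<in> U" "p \<in> C" by blast
      then have "p \<in> \<Omega>" "\<epsilon> \<le> w p" by (auto simp: C_def)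
      with U(3)[OF p(1)] False show False by force
    qed
    then show ?thesis using qB by (auto simp: C_def B_def)
  qed
  then have "closed C" using closure_subset_eq by blast
  then show ?thesis using \<open>bounded C\<close> by (simp add: compact_eq_bounded_closed C_def)
qed

text \<open>The cutoffs used below. The set \<open>C\<close> contains the support in \<open>\<Omega>\<close> of every test function
\<open>\<zeta> F(w - \<epsilon>)\<close>.\<close>

lemma exhaustion:
  assumes w: "continuous_on \<Omega> w" "nonpos_at_boundary w" and \<epsilon>: "\<epsilon> > 0"
    and H: "compact H" "H \<subseteq> \<Omega>" and K: "1 \<le> K" and g: "0 < g" "g \<le> 1" and \<delta>: "\<delta> > 0"
  obtains \<zeta> C where "cutoff \<zeta>" "\<And>p. p \<in> H \<Longrightarrow> \<zeta> p = 1" "compact C" "C \<subseteq> \<Omega>" "H \<subseteq> C"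
    "\<And>p. p \<in> \<Omega> - C \<Longrightarrow> \<zeta> p = 0 \<or> w p \<le> \<epsilon>"
    "(LINT p:C|lborel. norm (grad \<zeta> p) * wt e K p powr (-g)) \<le> \<delta>"
proof -
  have "H \<inter> D = {}" using H(2) D(3) \<Omega> by (auto simp: frontier_def interior_open)
  from strip_cutoff[OF ax D(1,2) H(1) this K g \<delta>]
  obtain \<zeta> V R where 1: "cutoff \<zeta>" "\<forall>p\<in>H. \<zeta> p = 1" "open V"
    "\<forall>p\<in>D. a \<le> n \<bullet> p \<and> n \<bullet> p \<le> b \<and> \<bar>e \<bullet> p\<bar> \<le> R \<longrightarrow> p \<in> V" "\<forall>p\<in>V. \<zeta> p = 0"
    "\<forall>p. \<bar>e \<bullet> p\<bar> > R \<longrightarrow> \<zeta> p = 0"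
    "\<forall>C. compact C \<longrightarrow> C \<subseteq> {p. a \<le> n \<bullet> p \<and> n \<bullet> p \<le> b} \<longrightarrow>
      (LINT p:C|lborel. norm (grad \<zeta> p) * wt e K p powr (-g)) \<le> \<delta>"
    by (elim exE conjE) (rule that; assumption)
  define C where "C = {p \<in> \<Omega>. \<epsilon> \<le> w p \<and> p \<notin> V \<and> \<bar>e \<bullet> p\<bar> \<le> R} \<union> H"
  have C: "compact C"
    unfolding C_def
  proof (rule compact_Un[OF compact_superlevel[OF w 1(3) _ \<epsilon>] H(1)])
    show "p \<in> V" if "p \<in> D" "a \<le> n \<bullet> p" "n \<bullet> p \<le> b" "\<bar>e \<bullet> p\<bar> \<le> R" for p
      using 1(4) that by blast
  qed
  have C2: "C \<subseteq> \<Omega>" using H(2) by (auto simp: C_def)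
  show thesis
  proof (rule that[of \<zeta> C])
    show "\<zeta> p = 0 \<or> w p \<le> \<epsilon>" if p: "p \<in> \<Omega> - C" for p
    proof -
      have "w p \<le> \<epsilon> \<or> p \<in> V \<or> \<bar>e \<bullet> p\<bar> > R" using p by (auto simp: C_def)
      then show ?thesis using 1(5,6) by blast
    qed
    show "H \<subseteq> C" by (simp add: C_def)
    show "(LINT p:C|lborel. norm (grad \<zeta> p) * wt e K p powr (-g)) \<le> \<delta>"
      using 1(7) C C2 strip by blast
  qed (fact 1(1) C C2 | use 1(2) in blast)+
qed

lemma norm_grad_weighted_le:
  assumes "cutoff \<zeta>" "K \<ge> 1" "g \<ge> 0"
  shows "norm (grad (\<lambda>q. \<zeta> q * wt e K q powr (-g)) p) \<le>
    norm (grad \<zeta> p) * wt e K p powr (-g) + \<zeta> p * (g * wt e K p powr (-g-1))"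
proof -
  have d: "\<zeta> differentiable at p" "(\<lambda>q. wt e K q powr (-g)) differentiable at p"
    using assms C1_on_wt_powr[of K UNIV e g] unfolding cutoff_def
    by (auto intro: C1_on_differentiable[OF _ UNIV_I])
  have \<zeta>: "0 \<le> \<zeta> p" using assms(1) by (simp add: cutoff_def del: split_paired_All)
  have "norm (grad (\<lambda>q. \<zeta> q * wt e K q powr (-g)) p) \<le>
    \<zeta> p * norm (grad (\<lambda>q. wt e K q powr (-g)) p) + wt e K p powr (-g) * norm (grad \<zeta> p)"
    unfolding grad_mult[OF d] by (rule order_trans[OF norm_triangle_ineq]) (simp add: \<zeta>)
  also have "\<dots> \<le> \<zeta> p * (g * wt e K p powr (-g-1)) + wt e K p powr (-g) * norm (grad \<zeta> p)"
    using assms axis(1) by (intro add_right_mono mult_left_mono norm_grad_wt_powr \<zeta>) auto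
  finally show ?thesis by (simp add: mult_ac add_ac)
qed

lemma C1_on_weighted: "cutoff \<zeta> \<Longrightarrow> K \<ge> 1 \<Longrightarrow> C1_on S (\<lambda>q. \<zeta> q * wt e K q powr (-g))"
  by (rule C1_on_subset[OF C1_on_mult[of UNIV]]) (auto simp: cutoff_def intro: C1_on_wt_powr)

text \<open>A field normal to the strip with divergence 1 and norm at most the width. Testing it is the Poincare
inequality across the strip.\<close>

definition crossing :: "plane \<Rightarrow> plane" where
  "crossing p = ((n \<bullet> p - a) / (norm n)\<^sup>2) *\<^sub>R n"

lemma crossing:
  shows "C1_on S (\<lambda>q. fst (crossing q))" "C1_on S (\<lambda>q. snd (crossing q))"
    and "divergence crossing p = 1"
    and "p \<in> \<Omega> \<Longrightarrow> norm (crossing p) \<le> width"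
proof -
  define m where "m = (1 / (norm n)\<^sup>2) *\<^sub>R n"
  have f: "(\<lambda>q. fst (crossing q)) = (\<lambda>q. (n \<bullet> q - a) * fst m)"
    and s: "(\<lambda>q. snd (crossing q)) = (\<lambda>q. (n \<bullet> q - a) * snd m)"
    by (auto simp: crossing_def m_def)
  show "C1_on S (\<lambda>q. fst (crossing q))" "C1_on S (\<lambda>q. snd (crossing q))"
    unfolding f s by (intro C1_on_mult C1_on_diff C1_on_inner C1_on_const)+
  have g: "grad (\<lambda>q. (n \<bullet> q - a) * k) p = k *\<^sub>R n" for k
    by (rule grad_eqI) (auto intro!: derivative_eq_intros)
  have "divergence crossing p = fst m * fst n + snd m * snd n"
    unfolding divergence_def f s pdx_grad pdy_grad g by simp
  also have "\<dots> = m \<bullet> n" by (simp add: inner_prod_def)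
  also have "\<dots> = 1" using n by (simp add: m_def power2_norm_eq_inner)
  finally show "divergence crossing p = 1" .
  assume "p \<in> \<Omega>"
  then have "a \<le> n \<bullet> p" "n \<bullet> p \<le> b" using strip by auto
  moreover have "norm (crossing p) = \<bar>n \<bullet> p - a\<bar> / norm n"
    using n by (simp add: crossing_def power2_eq_square)
  ultimately show "norm (crossing p) \<le> width"
    by (simp add: width_def divide_right_mono)
qed

text \<open>Two identities are combined: that of the divergence free field \<open>X\<close> bounds the gradient of \<open>F(w - \<epsilon>)\<close> by
means of the hypothesis on \<open>grad w\<close>, and that of \<open>crossing\<close> bounds \<open>F(w - \<epsilon>)\<close> by its gradient. The
condition on \<open>K\<close> makes the derivative of the weight small enough to be absorbed on the left.\<close>

lemma moment_step:
  assumes w: "C1_on \<Omega> w"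
    and X: "C1_on \<Omega> (\<lambda>q. fst (X q))" "C1_on \<Omega> (\<lambda>q. snd (X q))"
    and div: "\<And>p. p \<in> \<Omega> \<Longrightarrow> divergence X p = 0"
    and X1: "\<And>p. p \<in> \<Omega> \<Longrightarrow> norm (X p) \<le> 1"
    and grad: "\<And>p. p \<in> \<Omega> \<Longrightarrow> norm (grad w p) \<le> grad w p \<bullet> X p + h p"
    and h: "continuous_on \<Omega> h"
    and F: "profile F F'" and B: "\<And>x. 0 \<le> x \<Longrightarrow> F x \<le> B"
    and K: "1 \<le> K" "4 * width * g \<le> K" "0 \<le> g"
    and \<zeta>: "cutoff \<zeta>" and C: "compact C" "C \<subseteq> \<Omega>"
    and off: "\<And>p. p \<in> \<Omega> - C \<Longrightarrow> \<zeta> p = 0 \<or> w p \<le> \<epsilon>"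
  shows "(LINT p:C|lborel. \<zeta> p * wt e K p powr (-g) * F (excess \<epsilon> (w p))) \<le>
    4 * width * B * (LINT p:C|lborel. norm (grad \<zeta> p) * wt e K p powr (-g)) +
    2 * width * (LINT p:C|lborel. \<zeta> p * wt e K p powr (-g) * (F' (excess \<epsilon> (w p)) * h p))"
proof -
  let ?F = "\<lambda>p. F (excess \<epsilon> (w p))" and ?F' = "\<lambda>p. F' (excess \<epsilon> (w p))"
  let ?\<eta> = "\<lambda>p. wt e K p powr (-g)"
  define \<theta> where "\<theta> p = \<zeta> p * ?\<eta> p" for p
  have \<theta>1: "C1_on \<Omega> \<theta>" unfolding \<theta>_def by (intro C1_on_weighted \<zeta> K)
  have off': "\<theta> p = 0 \<or> w p \<le> \<epsilon>" if "p \<in> \<Omega> - C" for p using off[OF that] by (auto simp: \<theta>_def)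
  define I1 where "I1 p = ?F p * (grad \<theta> p \<bullet> X p) + \<theta> p * ?F' p * (grad w p \<bullet> X p) + 0 * (\<theta> p * ?F p)" for p
  define I2 where "I2 p = ?F p * (grad \<theta> p \<bullet> crossing p) + \<theta> p * ?F' p * (grad w p \<bullet> crossing p) + 1 * (\<theta> p * ?F p)" for p
  have I1: "(LINT p:C|lborel. I1 p) = 0" "continuous_on C I1"
    unfolding I1_def by (rule test_identity[OF \<Omega> C \<theta>1 w F off' X div]; assumption)+
  have I2: "(LINT p:C|lborel. I2 p) = 0" "continuous_on C I2"
    unfolding I2_def by (rule test_identity[OF \<Omega> C \<theta>1 w F off' crossing(1,2,3)]; assumption)+
  define G1 where "G1 p = norm (grad \<zeta> p) * ?\<eta> p" for p
  define G2 where "G2 p = \<zeta> p * ?\<eta> p * (?F' p * h p)" for p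
  have cw: "continuous_on C w" "continuous_on C h"
    using w h C by (blast intro: continuous_on_subset C1_on_continuous)+
  have K0: "K > 0" using K by simp
  note cF = continuous_on_excess_compose[OF profile_continuous(1)[OF F] cw(1), of \<epsilon>]
    continuous_on_excess_compose[OF profile_continuous(2)[OF F] cw(1), of \<epsilon>]
  note cont = continuous_on_mult continuous_on_norm cutoff_continuous_grad[OF \<zeta>] cutoff_continuous[OF \<zeta>]
    continuous_wt_powr[OF K0] cF cw
  have cG: "continuous_on C G1" "continuous_on C G2" "continuous_on C (\<lambda>p. \<theta> p * ?F p)"
    unfolding G1_def G2_def \<theta>_def by (intro cont)+
  have pt: "\<theta> p * ?F p \<le> (2 * I2 p + 2 * width * I1 p) + (4 * width * B * G1 p + 2 * width * G2 p)"
    if p: "p \<in> C" for p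
  proof -
    have p\<Omega>: "p \<in> \<Omega>" using p C by auto
    have \<zeta>0: "0 \<le> \<zeta> p" using \<zeta> by (simp add: cutoff_def del: split_paired_All)
    have w0: "wt e K p > 0" using wt_pos[OF K0] .
    have \<theta>0: "0 \<le> \<theta> p" using \<zeta>0 by (simp add: \<theta>_def)
    have F0: "0 \<le> ?F p" "0 \<le> ?F' p" using F excess_nonneg by (auto simp: profile_def)
    have FB: "?F p \<le> B" using B excess_nonneg by auto
    have c1: "- (grad \<theta> p \<bullet> crossing p) \<le> norm (grad \<theta> p) * width"
      using Cauchy_Schwarz_ineq2[of "grad \<theta> p" "crossing p"] crossing(4)[OF p\<Omega>]
        mult_left_mono[of "norm (crossing p)" width "norm (grad \<theta> p)"] by fastforce
    have c2: "- (grad w p \<bullet> crossing p) \<le> norm (grad w p) * width"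
      using Cauchy_Schwarz_ineq2[of "grad w p" "crossing p"] crossing(4)[OF p\<Omega>]
        mult_left_mono[of "norm (crossing p)" width "norm (grad w p)"] by fastforce
    have c3: "- (grad \<theta> p \<bullet> X p) \<le> norm (grad \<theta> p)"
      using Cauchy_Schwarz_ineq2[of "grad \<theta> p" "X p"] X1[OF p\<Omega>]
        mult_left_mono[of "norm (X p)" 1 "norm (grad \<theta> p)"] by fastforce
    have "\<theta> p * ?F p = I2 p + ?F p * (- (grad \<theta> p \<bullet> crossing p)) + \<theta> p * ?F' p * (- (grad w p \<bullet> crossing p))"
      by (simp add: I2_def algebra_simps)
    also have "\<dots> \<le> I2 p + ?F p * (norm (grad \<theta> p) * width) + \<theta> p * ?F' p * (norm (grad w p) * width)"
      using c1 c2 F0 \<theta>0 by (intro add_mono mult_left_mono) auto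
    finally have 1: "\<theta> p * ?F p \<le> I2 p + ?F p * (norm (grad \<theta> p) * width) + width * (\<theta> p * ?F' p * norm (grad w p))"
      by (simp add: mult_ac)
    have "\<theta> p * ?F' p * norm (grad w p) \<le> \<theta> p * ?F' p * (grad w p \<bullet> X p + h p)"
      using grad[OF p\<Omega>] F0 \<theta>0 by (intro mult_left_mono) auto
    also have "\<dots> = I1 p + ?F p * (- (grad \<theta> p \<bullet> X p)) + G2 p"
      by (simp add: I1_def G2_def \<theta>_def algebra_simps)
    also have "\<dots> \<le> I1 p + ?F p * norm (grad \<theta> p) + G2 p"
      using c3 F0 by (intro add_mono mult_left_mono) auto
    finally have 2: "width * (\<theta> p * ?F' p * norm (grad w p)) \<le> width * (I1 p + ?F p * norm (grad \<theta> p) + G2 p)"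
      using width_nonneg by (rule mult_left_mono)
    have 3: "\<theta> p * ?F p \<le> I2 p + width * I1 p + 2 * width * (?F p * norm (grad \<theta> p)) + width * G2 p"
      using 1 2 by (simp add: algebra_simps)
    have gw: "4 * width * (g * wt e K p powr (-g-1)) \<le> ?\<eta> p"
    proof -
      have "4 * width * (g * wt e K p powr (-g-1)) = (4 * width * g) * wt e K p powr (-g-1)" by simp
      also have "\<dots> \<le> wt e K p * wt e K p powr (-g-1)"
        using K wt_ge(1)[of K e p] by (intro mult_right_mono) auto
      also have "\<dots> = ?\<eta> p" using w0 by (simp add: powr_mult_base)
      finally show ?thesis .
    qed
    have "2 * width * (?F p * norm (grad \<theta> p)) \<le>
      2 * width * (?F p * (G1 p + \<zeta> p * (g * wt e K p powr (-g-1))))"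
      unfolding \<theta>_def G1_def using F0 width_nonneg
      by (intro mult_left_mono norm_grad_weighted_le \<zeta> K) auto
    also have "\<dots> = 2 * width * (?F p * G1 p) + (?F p * \<zeta> p) * (4 * width * (g * wt e K p powr (-g-1))) / 2"
      by (simp add: algebra_simps)
    also have "\<dots> \<le> 2 * width * (B * G1 p) + (?F p * \<zeta> p) * ?\<eta> p / 2"
      using gw F0 \<zeta>0 FB width_nonneg
      by (intro add_mono mult_left_mono mult_right_mono divide_right_mono) (auto simp: G1_def)
    finally have 4: "2 * width * (?F p * norm (grad \<theta> p)) \<le> 2 * width * (B * G1 p) + \<theta> p * ?F p / 2"
      by (simp add: \<theta>_def mult_ac)
    show ?thesis using 3 4 by (simp add: algebra_simps)
  qed
  have "(LINT p:C|lborel. \<theta> p * ?F p) \<le>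
      (LINT p:C|lborel. (2 * I2 p + 2 * width * I1 p) + (4 * width * B * G1 p + 2 * width * G2 p))"
    by (intro set_integral_mono_continuous C pt continuous_intros cG I1 I2)
  also have "\<dots> = (2 * (LINT p:C|lborel. I2 p) + 2 * width * (LINT p:C|lborel. I1 p)) +
     (4 * width * B * (LINT p:C|lborel. G1 p) + 2 * width * (LINT p:C|lborel. G2 p))"
  proof -
    have "continuous_on C (\<lambda>p. 2 * I2 p + 2 * width * I1 p)"
      "continuous_on C (\<lambda>p. 4 * width * B * G1 p + 2 * width * G2 p)"
      by (intro continuous_intros cG I1 I2)+
    from set_integral_add_continuous[OF C(1) this] show ?thesis
      by (simp only: set_integral_combination[OF C(1) I2(2) I1(2)]
          set_integral_combination[OF C(1) cG(1) cG(2)])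
  qed
  finally show ?thesis by (simp add: I1 I2 G1_def G2_def \<theta>_def)
qed

end

section \<open>Second moments\<close>

text \<open>A \<open>C\<^sup>1\<close> substitute for the identity: comparable with \<open>x\<close> for large \<open>x\<close>, and with a double zero at 0.\<close>

definition kap :: "real \<Rightarrow> real" where
  "kap x = x\<^sup>2 / (1 + x)"

lemma kap_nonneg: "0 \<le> x \<Longrightarrow> 0 \<le> kap x"
  by (simp add: kap_def)

lemma kap_le: "0 \<le> x \<Longrightarrow> kap x \<le> x"
  by (simp add: kap_def power2_eq_square divide_simps algebra_simps)

lemma continuous_kap: "continuous_on {0..} kap"
  unfolding kap_def[abs_def] by (intro continuous_intros) auto

text \<open>A truncation of \<open>kap\<close>, equal to \<open>kap x / (1 + kap x / N)\<close>: it is bounded by \<open>N\<close>, has derivative \<open>trunc' N\<close> in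
the unit interval, and increases to \<open>kap x\<close> as \<open>N\<close> grows.\<close>

definition trunc :: "real \<Rightarrow> real \<Rightarrow> real" where
  "trunc N x = x\<^sup>2 / (1 + x + x\<^sup>2 / N)"

definition trunc' :: "real \<Rightarrow> real \<Rightarrow> real" where
  "trunc' N x = (2 * x + x\<^sup>2) / (1 + x + x\<^sup>2 / N)\<^sup>2"

lemma trunc_denom: "N > 0 \<Longrightarrow> 0 \<le> x \<Longrightarrow> 1 \<le> 1 + x + x\<^sup>2 / (N::real)"
  by simp

lemma profile_trunc:
  assumes N: "N > 0"
  shows "profile (trunc N) (trunc' N)"
  unfolding profile_def
proof (intro conjI allI impI)
  fix x :: real assume x: "0 \<le> x"
  have pos: "1 + x + x\<^sup>2 / N \<noteq> 0" using trunc_denom[OF N x] by linarith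
  have "(trunc N has_real_derivative
    (2 * x * (1 + x + x\<^sup>2 / N) - x\<^sup>2 * (1 + 2 * x / N)) / ((1 + x + x\<^sup>2 / N) * (1 + x + x\<^sup>2 / N))) (at x)"
    unfolding trunc_def[abs_def] using pos N by (auto intro!: derivative_eq_intros)
  moreover have "2 * x * (1 + x + x\<^sup>2 / N) - x\<^sup>2 * (1 + 2 * x / N) = 2 * x + x\<^sup>2"
    by (simp add: power2_eq_square algebra_simps)
  ultimately show "(trunc N has_real_derivative trunc' N x) (at x)"
    by (simp add: trunc'_def power2_eq_square)
next
  have "(1 + x + x\<^sup>2 / N)\<^sup>2 \<noteq> 0" if "0 \<le> x" for x using trunc_denom[OF N that] by simp
  then show "continuous_on {0..} (trunc' N)"
    unfolding trunc'_def[abs_def] using N by (intro continuous_intros) auto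
qed (use N in \<open>auto simp: trunc_def trunc'_def\<close>)

lemma trunc_le: "N > 0 \<Longrightarrow> 0 \<le> x \<Longrightarrow> trunc N x \<le> N"
proof -
  assume N: "N > 0" and x: "0 \<le> x"
  have "x\<^sup>2 \<le> N * (1 + x + x\<^sup>2 / N)" using N x by (simp add: algebra_simps)
  then show ?thesis using trunc_denom[OF N x] by (simp add: trunc_def divide_le_eq)
qed

lemma trunc'_le: "N > 0 \<Longrightarrow> 0 \<le> x \<Longrightarrow> trunc' N x \<le> 1"
proof -
  assume N: "N > 0" and x: "0 \<le> x"
  have "(1 + x)\<^sup>2 \<le> (1 + x + x\<^sup>2 / N)\<^sup>2" using N x by (intro power_mono) auto
  moreover have "2 * x + x\<^sup>2 \<le> (1 + x)\<^sup>2" by (simp add: power2_eq_square algebra_simps)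
  ultimately have "2 * x + x\<^sup>2 \<le> (1 + x + x\<^sup>2 / N)\<^sup>2" by linarith
  moreover have "(1 + x + x\<^sup>2 / N)\<^sup>2 > 0" using trunc_denom[OF N x] by simp
  ultimately show ?thesis by (simp add: trunc'_def divide_le_eq)
qed

lemma kap_trunc: "N > 0 \<Longrightarrow> 0 \<le> x \<Longrightarrow> kap x = (1 + kap x / N) * trunc N x"
proof -
  assume N: "N > 0" and x: "0 \<le> x"
  have d: "1 + x + x\<^sup>2 / N = (1 + x) * (1 + kap x / N)"
  proof -
    have "(1 + x) * (kap x / N) = x\<^sup>2 / N" using x by (simp add: kap_def)
    then show ?thesis by (simp only: distrib_left mult_1_right)
  qed
  have "1 + kap x / N > 0" using N kap_nonneg[OF x] by (simp add: add_pos_nonneg)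
  then show ?thesis using x unfolding trunc_def d by (simp add: kap_def)
qed

lemma profile_power2:
  assumes "profile F F'"
  shows "profile (\<lambda>x. (F x)\<^sup>2) (\<lambda>x. 2 * F x * F' x)"
  unfolding profile_def
proof (intro conjI allI impI)
  fix x :: real assume "0 \<le> x"
  then have F: "(F has_real_derivative F' x) (at x)" "0 \<le> F x" "0 \<le> F' x"
    using assms by (auto simp: profile_def)
  show "((\<lambda>x. (F x)\<^sup>2) has_real_derivative 2 * F x * F' x) (at x)"
    by (rule derivative_eq_intros F(1) refl)+ simp
  show "0 \<le> 2 * F x * F' x" using F by simp
next
  show "continuous_on {0..} (\<lambda>x. 2 * F x * F' x)"
    by (intro continuous_on_mult continuous_on_const profile_continuous[OF assms])
qed (use assms in \<open>auto simp: profile_def\<close>)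

context strip_domain
begin

text \<open>The step lemma is applied to the square of the truncation and then to the truncation itself; each
application costs one power of \<open>\<rho>\<close>, because \<open>h\<close> is of order \<open>\<rho>\<close>. The cutoff error, which depends on
\<open>N\<close>, disappears in the limit, so that the bound is independent of \<open>N\<close>.\<close>

lemma second_moment_truncated:
  assumes w: "C1_on \<Omega> w" "nonpos_at_boundary w"
    and X: "C1_on \<Omega> (\<lambda>q. fst (X q))" "C1_on \<Omega> (\<lambda>q. snd (X q))"
    and div: "\<And>p. p \<in> \<Omega> \<Longrightarrow> divergence X p = 0"
    and X1: "\<And>p. p \<in> \<Omega> \<Longrightarrow> norm (X p) \<le> 1"
    and grad: "\<And>p. p \<in> \<Omega> \<Longrightarrow> norm (grad w p) \<le> grad w p \<bullet> X p + h p"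
    and h: "continuous_on \<Omega> h" "\<And>p. p \<in> \<Omega> \<Longrightarrow> 0 \<le> h p" "\<And>p. p \<in> \<Omega> \<Longrightarrow> h p \<le> G * wt e K p"
    and K: "1 \<le> K" "16 * width \<le> K" and \<epsilon>: "\<epsilon> > 0"
    and \<alpha>: "0 < \<alpha>" "\<alpha> \<le> 1" and H: "compact H" "H \<subseteq> \<Omega>" and N: "N > 0" and G: "G \<ge> 0"
  shows "(LINT p:H|lborel. wt e K p powr (-(3 + \<alpha>)) * (trunc N (excess \<epsilon> (w p)))\<^sup>2) \<le>
    8 * width\<^sup>2 * G\<^sup>2 * A / \<alpha>"
proof (rule field_le_epsilon)
  fix d :: real assume d: "d > 0"
  \<comment> \<open>Exceeds the total coefficient of the cutoff error.\<close>
  define E where "E = 4 * width * N\<^sup>2 + 16 * width\<^sup>2 * G * N + 1"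
  have E: "E > 0" using N G width_nonneg by (simp add: E_def add_nonneg_pos)
  have K0: "K > 0" using K by simp
  obtain \<zeta> C where \<zeta>: "cutoff \<zeta>" "\<And>p. p \<in> H \<Longrightarrow> \<zeta> p = 1" and C: "compact C" "C \<subseteq> \<Omega>" "H \<subseteq> C"
    and off: "\<And>p. p \<in> \<Omega> - C \<Longrightarrow> \<zeta> p = 0 \<or> w p \<le> \<epsilon>"
    and small: "(LINT p:C|lborel. norm (grad \<zeta> p) * wt e K p powr (-1)) \<le> d / E"
    using exhaustion[OF C1_on_continuous[OF w(1)] w(2) \<epsilon> H K(1), of 1 "d / E"] d E by auto
  have \<zeta>01: "0 \<le> \<zeta> p" "\<zeta> p \<le> 1" for p using \<zeta>(1) by (simp_all add: cutoff_def del: split_paired_All)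
  have w1: "wt e K p \<ge> 1" for p using wt_ge(1)[of K e p] K by linarith
  have cw: "continuous_on C w" "continuous_on C h"
    using w h C by (blast intro: continuous_on_subset C1_on_continuous)+
  let ?T = "\<lambda>p. trunc N (excess \<epsilon> (w p))" and ?T' = "\<lambda>p. trunc' N (excess \<epsilon> (w p))"
  note pr = profile_trunc[OF N]
  have cT: "continuous_on C ?T" "continuous_on C ?T'"
    by (intro continuous_on_excess_compose profile_continuous[OF pr] cw)+
  have T0: "0 \<le> ?T p" "0 \<le> ?T' p" "?T p \<le> N" "?T' p \<le> 1" for p
    using pr excess_nonneg trunc_le[OF N] trunc'_le[OF N] by (auto simp: profile_def)
  note cont = continuous_on_mult continuous_on_norm cutoff_continuous_grad[OF \<zeta>(1)]
    cutoff_continuous[OF \<zeta>(1)] continuous_wt_powr[OF K0] cT cw continuous_on_const continuous_on_power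
  have small': "(LINT p:C|lborel. norm (grad \<zeta> p) * wt e K p powr (-g)) \<le> d / E" if "g \<ge> 1" for g
  proof -
    have "(LINT p:C|lborel. norm (grad \<zeta> p) * wt e K p powr (-g)) \<le>
       (LINT p:C|lborel. norm (grad \<zeta> p) * wt e K p powr (-1))"
    proof (intro set_integral_mono_continuous C(1))
      show "norm (grad \<zeta> p) * wt e K p powr (-g) \<le> norm (grad \<zeta> p) * wt e K p powr (-1)" for p
        using that w1 by (intro mult_left_mono powr_mono) auto
    qed (intro cont)+
    then show ?thesis using small by linarith
  qed
  have wt_shift: "wt e K p powr (-(k + 1)) * wt e K p = wt e K p powr (-k)" for k p
    using wt_pos[OF K0, of e p] powr_mult_base[of "wt e K p" "-(k+1)"] by (simp add: mult.commute)
  have K4: "4 * width * (3 + \<alpha>) \<le> K" "4 * width * (2 + \<alpha>) \<le> K"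
    using K \<alpha> width_nonneg mult_left_mono[of "3 + \<alpha>" 4 "4 * width"] mult_left_mono[of "2 + \<alpha>" 4 "4 * width"]
    by auto
  have first: "(LINT p:C|lborel. \<zeta> p * wt e K p powr (-(2 + \<alpha>)) * ?T p) \<le>
      4 * width * N * (d / E) + 2 * width * (G * (A / \<alpha>))"
  proof -
    have "(LINT p:C|lborel. \<zeta> p * wt e K p powr (-(2 + \<alpha>)) * ?T p) \<le>
      4 * width * N * (LINT p:C|lborel. norm (grad \<zeta> p) * wt e K p powr (-(2 + \<alpha>))) +
      2 * width * (LINT p:C|lborel. \<zeta> p * wt e K p powr (-(2 + \<alpha>)) * (?T' p * h p))"
      using \<alpha> by (intro moment_step[OF w(1) X div X1 grad h(1) pr trunc_le[OF N] K(1) K4(2) _ \<zeta>(1) C(1,2) off]) auto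
    also have "\<dots> \<le> 4 * width * N * (d / E) + 2 * width * (G * (A / \<alpha>))"
    proof (intro add_mono mult_left_mono)
      show "(LINT p:C|lborel. norm (grad \<zeta> p) * wt e K p powr (-(2 + \<alpha>))) \<le> d / E"
        using \<alpha> by (intro small') auto
      have "(LINT p:C|lborel. \<zeta> p * wt e K p powr (-(2 + \<alpha>)) * (?T' p * h p)) \<le>
        (LINT p:C|lborel. G * wt e K p powr (-(1 + \<alpha>)))"
      proof (intro set_integral_mono_continuous C(1))
        fix p assume "p \<in> C"
        then have p: "p \<in> \<Omega>" using C by auto
        have "?T' p * h p \<le> 1 * (G * wt e K p)" using T0 h(2,3)[OF p] by (intro mult_mono) auto
        then have 1: "?T' p * h p \<le> 1 * (G * wt e K p)" .
        have 2: "\<zeta> p * wt e K p powr (-(2 + \<alpha>)) \<le> 1 * wt e K p powr (-(2 + \<alpha>))"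
          using \<zeta>01 by (intro mult_right_mono) auto
        have "\<zeta> p * wt e K p powr (-(2 + \<alpha>)) * (?T' p * h p) \<le>
          1 * wt e K p powr (-(2 + \<alpha>)) * (1 * (G * wt e K p))"
          by (rule mult_mono[OF 2 1]) (use T0(2)[of p] h(2)[OF p] in auto)
        also have "\<dots> = G * (wt e K p powr (-((1 + \<alpha>) + 1)) * wt e K p)" by (simp add: add_ac)
        also have "\<dots> = G * wt e K p powr (-(1 + \<alpha>))" by (simp only: wt_shift)
        finally show "\<zeta> p * wt e K p powr (-(2 + \<alpha>)) * (?T' p * h p) \<le> G * wt e K p powr (-(1 + \<alpha>))" .
      qed (intro cont)+
      also have "\<dots> = G * (LINT p:C|lborel. wt e K p powr (-(1 + \<alpha>)))" by simp
      also have "\<dots> \<le> G * (A / \<alpha>)" using G by (intro mult_left_mono integral_wt K \<alpha> C)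
      finally show "(LINT p:C|lborel. \<zeta> p * wt e K p powr (-(2 + \<alpha>)) * (?T' p * h p)) \<le> G * (A / \<alpha>)" .
    qed (use width_nonneg N in auto)
    finally show ?thesis .
  qed
  have "(LINT p:H|lborel. wt e K p powr (-(3 + \<alpha>)) * (?T p)\<^sup>2) =
      (LINT p:H|lborel. \<zeta> p * wt e K p powr (-(3 + \<alpha>)) * (?T p)\<^sup>2)"
    using \<zeta>(2) H by (intro set_lebesgue_integral_cong) (auto simp: compact_imp_closed simp del: split_paired_All)
  also have "\<dots> \<le> (LINT p:C|lborel. \<zeta> p * wt e K p powr (-(3 + \<alpha>)) * (?T p)\<^sup>2)"
    using \<zeta>01 by (intro set_integral_mono_subset C H cont) auto
  also have "\<dots> \<le> 4 * width * N\<^sup>2 * (LINT p:C|lborel. norm (grad \<zeta> p) * wt e K p powr (-(3 + \<alpha>))) +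
      2 * width * (LINT p:C|lborel. \<zeta> p * wt e K p powr (-(3 + \<alpha>)) * (2 * ?T p * ?T' p * h p))"
  proof (rule moment_step[OF w(1) X div X1 grad h(1) profile_power2[OF pr] _ K(1) K4(1) _ \<zeta>(1) C(1,2) off])
    show "(trunc N x)\<^sup>2 \<le> N\<^sup>2" if "0 \<le> x" for x
      using that trunc_le[OF N that] pr by (intro power_mono) (auto simp: profile_def)
  qed (use \<alpha> in auto)
  also have "\<dots> \<le> 4 * width * N\<^sup>2 * (d / E) +
      2 * width * (2 * G * (4 * width * N * (d / E) + 2 * width * (G * (A / \<alpha>))))"
  proof (intro add_mono mult_left_mono)
    show "(LINT p:C|lborel. norm (grad \<zeta> p) * wt e K p powr (-(3 + \<alpha>))) \<le> d / E"
      using \<alpha> by (intro small') auto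
    have "(LINT p:C|lborel. \<zeta> p * wt e K p powr (-(3 + \<alpha>)) * (2 * ?T p * ?T' p * h p)) \<le>
      (LINT p:C|lborel. 2 * G * (\<zeta> p * wt e K p powr (-(2 + \<alpha>)) * ?T p))"
    proof (intro set_integral_mono_continuous C(1))
      fix p assume "p \<in> C"
      then have p: "p \<in> \<Omega>" using C by auto
      have "?T' p * h p \<le> 1 * (G * wt e K p)" using T0 h(2,3)[OF p] by (intro mult_mono) auto
      then have "(2 * \<zeta> p * wt e K p powr (-(3 + \<alpha>)) * ?T p) * (?T' p * h p) \<le>
        (2 * \<zeta> p * wt e K p powr (-(3 + \<alpha>)) * ?T p) * (1 * (G * wt e K p))"
        using \<zeta>01 T0 by (intro mult_left_mono) auto
      also have "\<dots> = 2 * G * (\<zeta> p * (wt e K p powr (-((2 + \<alpha>) + 1)) * wt e K p) * ?T p)"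
        by (simp add: add_ac)
      also have "\<dots> = 2 * G * (\<zeta> p * wt e K p powr (-(2 + \<alpha>)) * ?T p)" by (simp only: wt_shift)
      finally show "\<zeta> p * wt e K p powr (-(3 + \<alpha>)) * (2 * ?T p * ?T' p * h p) \<le>
        2 * G * (\<zeta> p * wt e K p powr (-(2 + \<alpha>)) * ?T p)" by (simp add: mult_ac)
    qed (intro cont)+
    also have "\<dots> = 2 * G * (LINT p:C|lborel. \<zeta> p * wt e K p powr (-(2 + \<alpha>)) * ?T p)"
      by (rule set_integral_mult_right)
    also have "\<dots> \<le> 2 * G * (4 * width * N * (d / E) + 2 * width * (G * (A / \<alpha>)))"
      using G first by (intro mult_left_mono) auto
    finally show "(LINT p:C|lborel. \<zeta> p * wt e K p powr (-(3 + \<alpha>)) * (2 * ?T p * ?T' p * h p)) \<le>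
      2 * G * (4 * width * N * (d / E) + 2 * width * (G * (A / \<alpha>)))" .
  qed (use width_nonneg N in auto)
  also have "\<dots> = (E - 1) * (d / E) + 8 * width\<^sup>2 * G\<^sup>2 * A / \<alpha>"
  proof -
    have "4 * width * N\<^sup>2 * y + 2 * width * (2 * G * (4 * width * N * y + 2 * width * (G * z))) =
      (E - 1) * y + 8 * width\<^sup>2 * G\<^sup>2 * z" for y z
      by (simp add: E_def power2_eq_square algebra_simps)
    from this[of "d / E" "A / \<alpha>"] show ?thesis by simp
  qed
  also have "\<dots> \<le> 8 * width\<^sup>2 * G\<^sup>2 * A / \<alpha> + d"
  proof -
    have "(E - 1) * (d / E) \<le> E * (d / E)" using d E by (intro mult_right_mono) auto
    also have "\<dots> = d" using E by simp
    finally show ?thesis by simp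
  qed
  finally show "(LINT p:H|lborel. wt e K p powr (-(3 + \<alpha>)) * (?T p)\<^sup>2) \<le> 8 * width\<^sup>2 * G\<^sup>2 * A / \<alpha> + d" .
qed

text \<open>On a compact set \<open>kap\<close> is bounded, so that \<open>kap\<close> and \<open>trunc N\<close> differ there by a factor that tends to 1.\<close>

lemma second_moment:
  assumes w: "C1_on \<Omega> w" "nonpos_at_boundary w"
    and X: "C1_on \<Omega> (\<lambda>q. fst (X q))" "C1_on \<Omega> (\<lambda>q. snd (X q))"
    and div: "\<And>p. p \<in> \<Omega> \<Longrightarrow> divergence X p = 0"
    and X1: "\<And>p. p \<in> \<Omega> \<Longrightarrow> norm (X p) \<le> 1"
    and grad: "\<And>p. p \<in> \<Omega> \<Longrightarrow> norm (grad w p) \<le> grad w p \<bullet> X p + h p"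
    and h: "continuous_on \<Omega> h" "\<And>p. p \<in> \<Omega> \<Longrightarrow> 0 \<le> h p" "\<And>p. p \<in> \<Omega> \<Longrightarrow> h p \<le> G * wt e K p"
    and K: "1 \<le> K" "16 * width \<le> K" and \<epsilon>: "\<epsilon> > 0"
    and \<alpha>: "0 < \<alpha>" "\<alpha> \<le> 1" and H: "compact H" "H \<subseteq> \<Omega>" and G: "G \<ge> 0"
  shows "(LINT p:H|lborel. wt e K p powr (-(3 + \<alpha>)) * (kap (excess \<epsilon> (w p)))\<^sup>2) \<le>
    8 * width\<^sup>2 * G\<^sup>2 * A / \<alpha>" (is "?I \<le> ?M")
proof -
  let ?\<kappa> = "\<lambda>p. kap (excess \<epsilon> (w p))"
  have cw: "continuous_on H w" using w H by (blast intro: continuous_on_subset C1_on_continuous)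
  have c\<kappa>: "continuous_on H ?\<kappa>"
    by (intro continuous_on_excess_compose continuous_kap cw)
  have "bounded (?\<kappa> ` H)" using H c\<kappa> by (intro compact_imp_bounded compact_continuous_image)
  then obtain B where B: "B > 0" "\<And>p. p \<in> H \<Longrightarrow> ?\<kappa> p \<le> B"
    by (metis abs_le_D1 bounded_pos imageI real_norm_def)
  have K0: "K > 0" using K by simp
  have bound: "?I \<le> (1 + B / N)\<^sup>2 * ?M" if N: "N > 0" for N
  proof -
    let ?T = "\<lambda>p. trunc N (excess \<epsilon> (w p))"
    have cT: "continuous_on H ?T"
      by (intro continuous_on_excess_compose profile_continuous[OF profile_trunc[OF N]] cw)
    note cont = continuous_on_mult continuous_wt_powr[OF K0] cT c\<kappa> continuous_on_const continuous_on_power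
    have "?I \<le> (LINT p:H|lborel. (1 + B / N)\<^sup>2 * (wt e K p powr (-(3 + \<alpha>)) * (?T p)\<^sup>2))"
    proof (intro set_integral_mono_continuous H)
      fix p assume p: "p \<in> H"
      have T0: "0 \<le> ?T p" using profile_trunc[OF N] excess_nonneg by (auto simp: profile_def)
      have "?\<kappa> p = (1 + ?\<kappa> p / N) * ?T p" by (rule kap_trunc[OF N excess_nonneg])
      also have "\<dots> \<le> (1 + B / N) * ?T p"
        using B(2)[OF p] N T0 by (intro mult_right_mono add_left_mono divide_right_mono) auto
      finally have "(?\<kappa> p)\<^sup>2 \<le> ((1 + B / N) * ?T p)\<^sup>2"
        using kap_nonneg[OF excess_nonneg] by (intro power_mono) auto
      then have "wt e K p powr (-(3 + \<alpha>)) * (?\<kappa> p)\<^sup>2 \<le> wt e K p powr (-(3 + \<alpha>)) * ((1 + B / N) * ?T p)\<^sup>2"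
        by (intro mult_left_mono) auto
      then show "wt e K p powr (-(3 + \<alpha>)) * (?\<kappa> p)\<^sup>2 \<le>
        (1 + B / N)\<^sup>2 * (wt e K p powr (-(3 + \<alpha>)) * (?T p)\<^sup>2)"
        by (simp add: power_mult_distrib mult_ac)
    qed (intro cont)+
    also have "\<dots> = (1 + B / N)\<^sup>2 * (LINT p:H|lborel. wt e K p powr (-(3 + \<alpha>)) * (?T p)\<^sup>2)"
      by (rule set_integral_mult_right)
    also have "\<dots> \<le> (1 + B / N)\<^sup>2 * ?M"
      by (intro mult_left_mono second_moment_truncated[OF w X div X1 grad h K \<epsilon> \<alpha> H N G]) auto
    finally show ?thesis .
  qed
  have "((\<lambda>N. B / N) \<longlongrightarrow> 0) at_top"
    by (intro tendsto_divide_0[OF tendsto_const] filterlim_at_top_imp_at_infinity filterlim_ident)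
  then have "((\<lambda>N. (1 + B / N)\<^sup>2 * ?M) \<longlongrightarrow> (1 + 0)\<^sup>2 * ?M) at_top"
    by (intro tendsto_intros)
  moreover have "\<forall>\<^sub>F N in at_top. ?I \<le> (1 + B / N)\<^sup>2 * ?M"
    using eventually_gt_at_top[of 0] by (rule eventually_mono) (rule bound)
  ultimately have "?I \<le> (1 + 0)\<^sup>2 * ?M"
    by (rule tendsto_lowerbound) simp
  then show ?thesis by simp
qed

end

section \<open>The energy estimate and the comparison principle\<close>

text \<open>The test profile of the energy estimate. It is bounded, and its square is exactly \<open>cubic' x (kap x)\<^sup>2 / 3\<close>,
so that the Cauchy-Schwarz inequality leaves only \<open>(kap x)\<^sup>2\<close>. Its triple zero at 0 and its convergence to 1
at the rate \<open>1 / x\<close> match the double zero and the linear growth of \<open>kap\<close>.\<close>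

definition cubic :: "real \<Rightarrow> real" where
  "cubic x = x ^ 3 / (1 + x) ^ 3"

definition cubic' :: "real \<Rightarrow> real" where
  "cubic' x = 3 * x\<^sup>2 / (1 + x) ^ 4"

lemma profile_cubic: "profile cubic cubic'"
  unfolding profile_def
proof (intro conjI allI impI)
  fix x :: real assume x: "0 \<le> x"
  have "(cubic has_real_derivative
    (3 * x\<^sup>2 * (1 + x) ^ 3 - x ^ 3 * (3 * (1 + x)\<^sup>2)) / ((1 + x) ^ 3 * (1 + x) ^ 3)) (at x)"
    unfolding cubic_def[abs_def] using x by (auto intro!: derivative_eq_intros)
  moreover have "3 * x\<^sup>2 * (1 + x) ^ 3 - x ^ 3 * (3 * (1 + x)\<^sup>2) = 3 * x\<^sup>2 * (1 + x)\<^sup>2"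
    by (simp add: power2_eq_square power3_eq_cube algebra_simps)
  moreover have "3 * x\<^sup>2 * (1 + x)\<^sup>2 / ((1 + x) ^ 3 * (1 + x) ^ 3) = cubic' x"
  proof -
    have "(1 + x) ^ 3 * (1 + x) ^ 3 = (1 + x) ^ 4 * (1 + x)\<^sup>2"
      by (simp flip: power_add)
    moreover have "3 * x\<^sup>2 * (1 + x)\<^sup>2 / ((1 + x) ^ 4 * (1 + x)\<^sup>2) = cubic' x"
      using x unfolding cubic'_def by (intro nonzero_mult_divide_mult_cancel_right) auto
    ultimately show ?thesis by (simp only:)
  qed
  ultimately show "(cubic has_real_derivative cubic' x) (at x)" by simp
next
  show "continuous_on {0..} cubic'"
    unfolding cubic'_def[abs_def] by (intro continuous_intros) auto
qed (auto simp: cubic_def cubic'_def)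

lemma cubic_le_1: "0 \<le> x \<Longrightarrow> cubic x \<le> 1"
  by (simp add: cubic_def divide_le_eq power_mono)

lemma cubic_power2: "0 \<le> x \<Longrightarrow> (cubic x)\<^sup>2 = cubic' x * (kap x)\<^sup>2 / 3"
  by (simp add: cubic_def cubic'_def kap_def power_divide flip: power_mult power_add)

lemma cubic'_pos: "0 < x \<Longrightarrow> 0 < cubic' x"
  by (simp add: cubic'_def)

text \<open>Here \<open>z\<close> stands for the norm of \<open>Z\<close> and \<open>k\<close> for the relative size of the derivative of the weight.\<close>

lemma young_cubic:
  assumes x: "0 \<le> x" and k: "0 \<le> k" and z: "0 \<le> z" and om: "0 < om"
  shows "k * cubic x * z \<le> cubic' x * (om * z\<^sup>2) / 2 + k\<^sup>2 * ((kap x)\<^sup>2 / om) / 6"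
proof (cases "x = 0")
  case True
  then show ?thesis by (simp add: cubic_def cubic'_def kap_def)
next
  case False
  define F where "F = cubic' x"
  have F: "F > 0" using False x by (simp add: F_def cubic'_pos)
  have "0 \<le> (F * om * z - k * cubic x)\<^sup>2" by simp
  also have "\<dots> = F\<^sup>2 * om\<^sup>2 * z\<^sup>2 - 2 * (F * om) * (k * cubic x * z) + k\<^sup>2 * (cubic x)\<^sup>2"
    by (simp add: power2_diff power_mult_distrib mult_ac)
  finally have "2 * (F * om) * (k * cubic x * z) \<le> F\<^sup>2 * om\<^sup>2 * z\<^sup>2 + k\<^sup>2 * (F * (kap x)\<^sup>2 / 3)"
    using cubic_power2[OF x] by (simp add: F_def)
  also have "\<dots> = 2 * (F * om) * (F * (om * z\<^sup>2) / 2 + k\<^sup>2 * ((kap x)\<^sup>2 / om) / 6)"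
    using om by (simp add: power2_eq_square field_simps)
  finally show ?thesis using F om by (simp add: F_def)
qed

context strip_domain
begin

text \<open>Testing \<open>Z\<close> with \<open>\<zeta> \<rho> powr (-\<alpha>) cubic(w - \<epsilon>)\<close>. The derivative of the weight brings a factor
\<open>\<alpha> / \<rho>\<close>, so after Cauchy-Schwarz the bound is \<open>\<alpha>\<^sup>2\<close> times a quantity of order \<open>1 / \<alpha>\<close>. On the left the
weight \<open>1 / \<rho>\<close> serves as a lower bound for \<open>\<rho> powr (-\<alpha>)\<close> that does not depend on \<open>\<alpha>\<close>.\<close>

lemma energy_estimate:
  assumes w: "C1_on \<Omega> w" "nonpos_at_boundary w"
    and Z: "C1_on \<Omega> (\<lambda>q. fst (Z q))" "C1_on \<Omega> (\<lambda>q. snd (Z q))"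
    and div: "\<And>p. p \<in> \<Omega> \<Longrightarrow> divergence Z p = 0"
    and Z2: "\<And>p. p \<in> \<Omega> \<Longrightarrow> norm (Z p) \<le> 2"
    and om: "continuous_on \<Omega> \<omega>" "\<And>p. p \<in> \<Omega> \<Longrightarrow> 0 < \<omega> p"
    and Q: "\<And>p. p \<in> \<Omega> \<Longrightarrow> \<omega> p * (norm (Z p))\<^sup>2 \<le> grad w p \<bullet> Z p"
    and K: "1 \<le> K" and \<epsilon>: "\<epsilon> > 0" and \<alpha>: "0 < \<alpha>" "\<alpha> \<le> 1"
    and H: "compact H" "H \<subseteq> \<Omega>"
    and M: "\<And>C. compact C \<Longrightarrow> C \<subseteq> \<Omega> \<Longrightarrow>
      (LINT p:C|lborel. wt e K p powr (-(2 + \<alpha>)) * ((kap (excess \<epsilon> (w p)))\<^sup>2 / \<omega> p)) \<le> M / \<alpha>"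
  shows "(LINT p:H|lborel. wt e K p powr (-1) * (cubic' (excess \<epsilon> (w p)) * (grad w p \<bullet> Z p)))
    \<le> \<alpha> * (4 + M / 3)"
proof -
  have K0: "K > 0" using K by simp
  obtain \<zeta> C where \<zeta>: "cutoff \<zeta>" "\<And>p. p \<in> H \<Longrightarrow> \<zeta> p = 1" and C: "compact C" "C \<subseteq> \<Omega>" "H \<subseteq> C"
    and off: "\<And>p. p \<in> \<Omega> - C \<Longrightarrow> \<zeta> p = 0 \<or> w p \<le> \<epsilon>"
    and small: "(LINT p:C|lborel. norm (grad \<zeta> p) * wt e K p powr (-\<alpha>)) \<le> \<alpha>"
    by (rule exhaustion[OF C1_on_continuous[OF w(1)] w(2) \<epsilon> H K \<alpha> \<alpha>(1)])
      (rule that; assumption)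
  have \<zeta>01: "0 \<le> \<zeta> p" "\<zeta> p \<le> 1" for p using \<zeta>(1) by (simp_all add: cutoff_def del: split_paired_All)
  have w1: "wt e K p \<ge> 1" for p using wt_ge(1)[of K e p] K by linarith
  let ?F = "\<lambda>p. cubic (excess \<epsilon> (w p))" and ?F' = "\<lambda>p. cubic' (excess \<epsilon> (w p))"
  let ?\<kappa> = "\<lambda>p. kap (excess \<epsilon> (w p))"
  let ?Q = "\<lambda>p. grad w p \<bullet> Z p"
  define \<theta> where "\<theta> p = \<zeta> p * wt e K p powr (-\<alpha>)" for p
  have \<theta>1: "C1_on \<Omega> \<theta>" unfolding \<theta>_def by (intro C1_on_weighted \<zeta> K)
  have off': "\<theta> p = 0 \<or> w p \<le> \<epsilon>" if "p \<in> \<Omega> - C" for p using off[OF that] by (auto simp: \<theta>_def)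
  define I where "I p = ?F p * (grad \<theta> p \<bullet> Z p) + \<theta> p * ?F' p * (grad w p \<bullet> Z p) + 0 * (\<theta> p * ?F p)" for p
  have I: "(LINT p:C|lborel. I p) = 0" "continuous_on C I"
    unfolding I_def by (rule test_identity[OF \<Omega> C(1,2) \<theta>1 w(1) profile_cubic off' Z div]; assumption)+
  have cw: "continuous_on C w" "continuous_on C (grad w)" "continuous_on C \<omega>"
    using w om C by (blast intro: continuous_on_subset C1_on_continuous C1_on_continuous_grad)+
  have cZ: "continuous_on C Z"
  proof -
    have "continuous_on C (\<lambda>p. (fst (Z p), snd (Z p)))"
      using Z C by (intro continuous_on_Pair) (blast intro: continuous_on_subset C1_on_continuous)+
    then show ?thesis by simp
  qed
  have om0: "\<forall>p\<in>C. \<omega> p \<noteq> 0" using om(2) C(2) by force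
  have cF: "continuous_on C ?F'" "continuous_on C ?\<kappa>"
    by (intro continuous_on_excess_compose continuous_kap profile_continuous[OF profile_cubic] cw)+
  note cont = continuous_on_mult continuous_on_norm cutoff_continuous_grad[OF \<zeta>(1)] continuous_on_inner
    cutoff_continuous[OF \<zeta>(1)] continuous_wt_powr[OF K0] cF cw cZ continuous_on_const continuous_on_power
    continuous_on_divide om0
  define G1 where "G1 p = norm (grad \<zeta> p) * wt e K p powr (-\<alpha>)" for p
  define G2 where "G2 p = wt e K p powr (-(2 + \<alpha>)) * ((?\<kappa> p)\<^sup>2 / \<omega> p)" for p
  have cG: "continuous_on C G1" "continuous_on C G2"
    unfolding G1_def G2_def by (intro cont)+
  have F0: "0 \<le> ?F p" "0 \<le> ?F' p" "?F p \<le> 1" for p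
    using profile_cubic excess_nonneg cubic_le_1 unfolding profile_def by blast+
  have Q0: "0 \<le> ?Q p" if "p \<in> \<Omega>" for p
  proof -
    have "0 \<le> \<omega> p * (norm (Z p))\<^sup>2" using om(2)[OF that] by (intro mult_nonneg_nonneg) auto
    then show ?thesis using Q[OF that] by linarith
  qed
  have pt: "\<theta> p * (?F' p * ?Q p) \<le> 2 * I p + (4 * G1 p + (\<alpha>\<^sup>2 / 3) * G2 p)" if p: "p \<in> C" for p
  proof -
    have p\<Omega>: "p \<in> \<Omega>" using p C by auto
    define m where "m = wt e K p powr (-1)"
    let ?z = "norm (Z p)" and ?k = "\<alpha> * m" and ?\<eta> = "wt e K p powr (-\<alpha>)"
    have m0: "0 \<le> m" by (simp add: m_def)
    have pw: "wt e K p powr (-\<alpha>-1) = ?\<eta> * m" "wt e K p powr (-(2 + \<alpha>)) = ?\<eta> * m\<^sup>2"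
    proof -
      have "wt e K p powr (-\<alpha> + (-1)) = ?\<eta> * m" unfolding m_def by (rule powr_add)
      moreover have "-\<alpha> + (-1) = -\<alpha>-1" by simp
      ultimately show 1: "wt e K p powr (-\<alpha>-1) = ?\<eta> * m" by (simp only:)
      have "wt e K p powr ((-\<alpha>-1) + (-1)) = wt e K p powr (-\<alpha>-1) * m" unfolding m_def by (rule powr_add)
      moreover have "(-\<alpha>-1) + (-1) = -(2 + \<alpha>)" by simp
      ultimately show "wt e K p powr (-(2 + \<alpha>)) = ?\<eta> * m\<^sup>2"
        by (simp only: 1 power2_eq_square mult.assoc)
    qed
    have "\<theta> p * (?F' p * ?Q p) = I p + ?F p * (- (grad \<theta> p \<bullet> Z p))"
      by (simp add: I_def algebra_simps)
    also have "\<dots> \<le> I p + ?F p * (norm (grad \<theta> p) * ?z)"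
      using Cauchy_Schwarz_ineq2[of "grad \<theta> p" "Z p"] F0
      by (intro add_left_mono mult_left_mono) auto
    also have "\<dots> \<le> I p + ?F p * ((G1 p + \<zeta> p * (\<alpha> * wt e K p powr (-\<alpha>-1))) * ?z)"
      unfolding \<theta>_def G1_def using F0 \<alpha>
      by (intro add_left_mono mult_left_mono mult_right_mono norm_grad_weighted_le \<zeta> K) auto
    also have "\<dots> = I p + ?F p * G1 p * ?z + \<zeta> p * ?\<eta> * (?k * ?F p * ?z)"
      unfolding pw by (simp only: algebra_simps)
    also have "\<dots> \<le> I p + 1 * G1 p * 2 +
        \<zeta> p * ?\<eta> * (?F' p * (\<omega> p * ?z\<^sup>2) / 2 + ?k\<^sup>2 * ((?\<kappa> p)\<^sup>2 / \<omega> p) / 6)"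
    proof (intro add_mono order_refl)
      have "0 \<le> G1 p" by (simp add: G1_def)
      then show "?F p * G1 p * ?z \<le> 1 * G1 p * 2"
        using F0[of p] Z2[OF p\<Omega>] by (intro mult_mono) auto
      have "?k * ?F p * ?z \<le> ?F' p * (\<omega> p * ?z\<^sup>2) / 2 + ?k\<^sup>2 * ((?\<kappa> p)\<^sup>2 / \<omega> p) / 6"
        using \<alpha> m0 by (intro young_cubic excess_nonneg om(2)[OF p\<Omega>]) auto
      then show "\<zeta> p * ?\<eta> * (?k * ?F p * ?z) \<le>
        \<zeta> p * ?\<eta> * (?F' p * (\<omega> p * ?z\<^sup>2) / 2 + ?k\<^sup>2 * ((?\<kappa> p)\<^sup>2 / \<omega> p) / 6)"
        using \<zeta>01[of p] by (intro mult_left_mono) auto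
    qed
    also have "\<dots> \<le> I p + 2 * G1 p + (\<theta> p * (?F' p * ?Q p) / 2 + (\<alpha>\<^sup>2 / 6) * G2 p)"
    proof -
      have "?F' p * (\<omega> p * ?z\<^sup>2) \<le> ?F' p * ?Q p" using Q[OF p\<Omega>] F0 by (intro mult_left_mono) auto
      then have "\<zeta> p * ?\<eta> * (?F' p * (\<omega> p * ?z\<^sup>2)) \<le> \<zeta> p * ?\<eta> * (?F' p * ?Q p)"
        by (rule mult_left_mono) (use \<zeta>01[of p] in auto)
      moreover have "\<zeta> p * ?\<eta> * (?k\<^sup>2 * ((?\<kappa> p)\<^sup>2 / \<omega> p) / 6) \<le> (\<alpha>\<^sup>2 / 6) * G2 p"
      proof -
        have "?\<eta> * ?k\<^sup>2 = \<alpha>\<^sup>2 * wt e K p powr (-(2 + \<alpha>))"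
          unfolding pw by (simp only: power2_eq_square mult_ac)
        moreover have "?\<eta> * (?k\<^sup>2 * ((?\<kappa> p)\<^sup>2 / \<omega> p) / 6) = (?\<eta> * ?k\<^sup>2) * (((?\<kappa> p)\<^sup>2 / \<omega> p) / 6)"
          by simp
        moreover have "(\<alpha>\<^sup>2 * wt e K p powr (-(2 + \<alpha>))) * (((?\<kappa> p)\<^sup>2 / \<omega> p) / 6) = (\<alpha>\<^sup>2 / 6) * G2 p"
          by (simp add: G2_def)
        ultimately have eq: "?\<eta> * (?k\<^sup>2 * ((?\<kappa> p)\<^sup>2 / \<omega> p) / 6) = (\<alpha>\<^sup>2 / 6) * G2 p"
          by (simp only:)
        have "0 \<le> (\<alpha>\<^sup>2 / 6) * G2 p" using om(2)[OF p\<Omega>] by (simp add: G2_def)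
        then have "\<zeta> p * ((\<alpha>\<^sup>2 / 6) * G2 p) \<le> (\<alpha>\<^sup>2 / 6) * G2 p"
          using \<zeta>01[of p] by (rule mult_left_le_one_le)
        then show ?thesis by (simp only: eq mult.assoc)
      qed
      moreover have "\<zeta> p * ?\<eta> * (?F' p * (\<omega> p * ?z\<^sup>2) / 2 + ?k\<^sup>2 * ((?\<kappa> p)\<^sup>2 / \<omega> p) / 6) =
        \<zeta> p * ?\<eta> * (?F' p * (\<omega> p * ?z\<^sup>2)) / 2 + \<zeta> p * ?\<eta> * (?k\<^sup>2 * ((?\<kappa> p)\<^sup>2 / \<omega> p) / 6)"
        by (simp only: distrib_left times_divide_eq_right)
      moreover have "\<theta> p * (?F' p * ?Q p) = \<zeta> p * ?\<eta> * (?F' p * ?Q p)" by (simp only: \<theta>_def)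
      ultimately show ?thesis by linarith
    qed
    finally show ?thesis by (simp add: algebra_simps)
  qed
  have cQ: "continuous_on C (\<lambda>p. \<theta> p * (?F' p * ?Q p))" unfolding \<theta>_def by (intro cont)
  have "(LINT p:H|lborel. wt e K p powr (-1) * (?F' p * ?Q p)) \<le> (LINT p:H|lborel. \<theta> p * (?F' p * ?Q p))"
  proof (rule set_integral_mono_continuous[OF H(1)])
    show "continuous_on H (\<lambda>p. \<theta> p * (?F' p * ?Q p))" using cQ C(3) by (rule continuous_on_subset)
    have "continuous_on C (\<lambda>p. wt e K p powr (-1) * (?F' p * ?Q p))" by (intro cont)
    then show "continuous_on H (\<lambda>p. wt e K p powr (-1) * (?F' p * ?Q p))" using C(3) by (rule continuous_on_subset)
    fix p assume p: "p \<in> H"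
    have "wt e K p powr (-1) \<le> wt e K p powr (-\<alpha>)" using w1 \<alpha> by (intro powr_mono) auto
    then show "wt e K p powr (-1) * (?F' p * ?Q p) \<le> \<theta> p * (?F' p * ?Q p)"
      using F0(2)[of p] Q0[of p] p H(2) \<zeta>(2)[OF p] unfolding \<theta>_def
      by (intro mult_right_mono mult_nonneg_nonneg) auto
  qed
  also have "\<dots> \<le> (LINT p:C|lborel. \<theta> p * (?F' p * ?Q p))"
  proof (rule set_integral_mono_subset[OF C(1) H(1) C(3) cQ])
    fix p assume "p \<in> C"
    then have "p \<in> \<Omega>" using C(2) by auto
    then show "0 \<le> \<theta> p * (?F' p * ?Q p)"
      using F0(2)[of p] Q0[of p] \<zeta>01[of p] by (simp add: \<theta>_def)
  qed
  also have "\<dots> \<le> (LINT p:C|lborel. 2 * I p + (4 * G1 p + (\<alpha>\<^sup>2 / 3) * G2 p))"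
    by (intro set_integral_mono_continuous C pt continuous_intros cQ I cG)
  also have "\<dots> = (LINT p:C|lborel. 2 * I p) + (LINT p:C|lborel. 4 * G1 p + (\<alpha>\<^sup>2 / 3) * G2 p)"
    by (intro set_integral_add_continuous C continuous_intros I cG)
  also have "\<dots> = 4 * (LINT p:C|lborel. G1 p) + (\<alpha>\<^sup>2 / 3) * (LINT p:C|lborel. G2 p)"
    unfolding set_integral_combination[OF C(1) cG] by (simp add: I(1))
  also have "\<dots> \<le> 4 * \<alpha> + (\<alpha>\<^sup>2 / 3) * (M / \<alpha>)"
    using small M[OF C(1,2)] unfolding G1_def G2_def by (intro add_mono mult_left_mono) auto
  also have "\<dots> = \<alpha> * (4 + M / 3)" using \<alpha> by (simp add: power2_eq_square field_simps)
  finally show ?thesis .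
qed

lemma eq_0_if_integral_nonpos:
  fixes f :: "plane \<Rightarrow> real"
  assumes r: "r > 0" and f: "continuous_on (cball p r) f" "\<And>q. q \<in> cball p r \<Longrightarrow> 0 \<le> f q"
    and int: "(LINT q:cball p r|lborel. f q) \<le> 0"
  shows "f p = 0"
proof (rule ccontr)
  assume "f p \<noteq> 0"
  then have fp: "f p > 0" using f(2)[of p] r by fastforce
  have "continuous (at p within cball p r) f" using f(1) r by (simp add: continuous_on_eq_continuous_within)
  then obtain d where d: "d > 0" "\<And>q. q \<in> cball p r \<Longrightarrow> dist q p < d \<Longrightarrow> dist (f q) (f p) < f p / 2"
    using fp unfolding continuous_within_eps_delta by (metis half_gt_zero)
  define s where "s = min r (d / 2)"
  have s: "s > 0" "cball p s \<subseteq> cball p r" using r d by (auto simp: s_def)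
  have low: "f p / 2 \<le> f q" if "q \<in> cball p s" for q
  proof -
    have "dist q p < d" "q \<in> cball p r" using that s d by (auto simp: s_def dist_commute)
    then have "dist (f q) (f p) < f p / 2" using d by blast
    then have "\<bar>f q - f p\<bar> < f p / 2" by (simp only: dist_real_def)
    then show ?thesis by linarith
  qed
  have "0 < (f p / 2) * measure lborel (cball p s)"
    using fp s content_cball_pos[of s p] by simp
  also have "\<dots> = (LINT q:cball p s|lborel. f p / 2)"
    by (simp add: set_lebesgue_integral_def mult.commute)
  also have "\<dots> \<le> (LINT q:cball p s|lborel. f q)"
    using low f(1) s by (intro set_integral_mono_continuous) (auto intro: continuous_on_subset)
  also have "\<dots> \<le> (LINT q:cball p r|lborel. f q)"
    using s f by (intro set_integral_mono_subset) auto
  finally show False using int by simp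
qed

text \<open>The abstract form of the argument of Collin and Krust. The constant \<open>M\<close> must not depend on \<open>\<alpha>\<close>.\<close>

proposition comparison_principle:
  assumes conn: "connected \<Omega>" and q0: "q0 \<in> frontier \<Omega> - D"
    and w: "C1_on \<Omega> w" "nonpos_at_boundary w"
    and Z: "C1_on \<Omega> (\<lambda>q. fst (Z q))" "C1_on \<Omega> (\<lambda>q. snd (Z q))"
    and div: "\<And>p. p \<in> \<Omega> \<Longrightarrow> divergence Z p = 0"
    and Z2: "\<And>p. p \<in> \<Omega> \<Longrightarrow> norm (Z p) \<le> 2"
    and om: "continuous_on \<Omega> \<omega>" "\<And>p. p \<in> \<Omega> \<Longrightarrow> 0 < \<omega> p"
    and Q: "\<And>p. p \<in> \<Omega> \<Longrightarrow> \<omega> p * (norm (Z p))\<^sup>2 \<le> grad w p \<bullet> Z p"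
    and rigid: "\<And>p. p \<in> \<Omega> \<Longrightarrow> grad w p \<bullet> Z p = 0 \<Longrightarrow> grad w p = 0"
    and K: "1 \<le> K"
    and M: "\<And>\<epsilon> \<alpha> C. \<epsilon> > 0 \<Longrightarrow> 0 < \<alpha> \<Longrightarrow> \<alpha> \<le> 1 \<Longrightarrow> compact C \<Longrightarrow> C \<subseteq> \<Omega> \<Longrightarrow>
      (LINT p:C|lborel. wt e K p powr (-(2 + \<alpha>)) * ((kap (excess \<epsilon> (w p)))\<^sup>2 / \<omega> p)) \<le> M / \<alpha>"
    and p0: "p0 \<in> \<Omega>"
  shows "w p0 \<le> 0"
proof (rule ccontr)
  assume "\<not> w p0 \<le> 0"
  then have wp0: "w p0 > 0" by simp
  have K0: "K > 0" using K by simp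
  have zero: "grad w p = 0" if p: "p \<in> \<Omega>" "w p > 0" for p
  proof -
    define \<epsilon> where "\<epsilon> = w p / 2"
    have \<epsilon>: "\<epsilon> > 0" "\<epsilon> < w p" using p by (auto simp: \<epsilon>_def)
    obtain r where r: "r > 0" "cball p r \<subseteq> \<Omega>" using \<Omega> p by (meson open_contains_cball)
    define f where "f q = wt e K q powr (-1) * (cubic' (excess \<epsilon> (w q)) * (grad w q \<bullet> Z q))" for q
    have "(LINT q:cball p r|lborel. f q) \<le> \<alpha> * (4 + M / 3)" if "0 < \<alpha>" "\<alpha> \<le> 1" for \<alpha>
      unfolding f_def
      by (rule energy_estimate[OF w Z div Z2 om Q K \<epsilon>(1) that compact_cball r(2) M[OF \<epsilon>(1) that]])
    then have "\<forall>\<^sub>F \<alpha> in at_right 0. (LINT q:cball p r|lborel. f q) \<le> \<alpha> * (4 + M / 3)"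
      unfolding eventually_at_right_field by (intro exI[of _ 1]) auto
    moreover have "((\<lambda>\<alpha>. \<alpha> * (4 + M / 3)) \<longlongrightarrow> 0 * (4 + M / 3)) (at_right 0)"
      by (intro tendsto_intros)
    ultimately have "(LINT q:cball p r|lborel. f q) \<le> 0 * (4 + M / 3)"
      by (intro tendsto_lowerbound[of "\<lambda>\<alpha>. \<alpha> * (4 + M / 3)"]) auto
    then have int: "(LINT q:cball p r|lborel. f q) \<le> 0" by simp
    have cw: "continuous_on \<Omega> w" "continuous_on \<Omega> (grad w)"
      using w by (auto intro: C1_on_continuous C1_on_continuous_grad)
    have cZ: "continuous_on \<Omega> (\<lambda>p. (fst (Z p), snd (Z p)))"
      using Z by (intro continuous_on_Pair C1_on_continuous)
    have "continuous_on \<Omega> f"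
      unfolding f_def using cZ
      by (intro continuous_on_mult continuous_wt_powr K0 continuous_on_inner cw
          continuous_on_excess_compose profile_continuous[OF profile_cubic]) simp
    then have cf: "continuous_on (cball p r) f" using r(2) by (rule continuous_on_subset)
    have f0: "0 \<le> f q" if "q \<in> cball p r" for q
    proof -
      have q: "q \<in> \<Omega>" using that r by auto
      have "0 \<le> \<omega> q * (norm (Z q))\<^sup>2" using om(2)[OF q] by (intro mult_nonneg_nonneg) auto
      then have "0 \<le> grad w q \<bullet> Z q" using Q[OF q] by linarith
      moreover have "0 \<le> cubic' (excess \<epsilon> (w q))"
        using profile_cubic excess_nonneg unfolding profile_def by blast
      ultimately show ?thesis by (simp add: f_def)
    qed
    have "f p = 0" by (rule eq_0_if_integral_nonpos[OF r(1) cf f0 int])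
    moreover have "cubic' (excess \<epsilon> (w p)) > 0" using \<epsilon> by (intro cubic'_pos) (simp add: excess_def)
    moreover have "wt e K p powr (-1) > 0" using wt_pos[OF K0, of e p] by simp
    ultimately have "grad w p \<bullet> Z p = 0" by (simp add: f_def)
    then show ?thesis by (rule rigid[OF p(1)])
  qed
  define S where "S = {p \<in> \<Omega>. w p = w p0}"
  have "open S"
    unfolding open_contains_ball
  proof
    fix p assume "p \<in> S"
    then have p: "p \<in> \<Omega>" "w p = w p0" by (auto simp: S_def)
    have "open {q \<in> \<Omega>. 0 < w q}"
      using continuous_open_preimage[OF C1_on_continuous[OF w(1)] \<Omega>, of "{0<..}"]
      by (simp add: vimage_def Int_def)
    then obtain r where r: "r > 0" "ball p r \<subseteq> {q \<in> \<Omega>. 0 < w q}"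
      using p wp0 by (metis (no_types, lifting) mem_Collect_eq open_contains_ball)
    have "w q = w p" if "q \<in> ball p r" for q
    proof (rule has_derivative_zero_unique[OF convex_ball _ that])
      fix x assume x: "x \<in> ball p r"
      then have "x \<in> \<Omega>" "grad w x = 0" using r zero[of x] by auto
      then have "(w has_derivative (\<lambda>h. 0)) (at x)"
        using has_derivative_grad[OF C1_on_differentiable[OF w(1)], of x] by simp
      then show "(w has_derivative (\<lambda>h. 0)) (at x within ball p r)" by (rule has_derivative_at_withinI)
    qed (use r in simp)
    then show "\<exists>r>0. ball p r \<subseteq> S" using r p unfolding S_def by (intro exI[of _ r]) auto
  qed
  moreover have "open {p \<in> \<Omega>. w p \<noteq> w p0}"
    using continuous_open_preimage[OF C1_on_continuous[OF w(1)] \<Omega>, of "- {w p0}"]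
    by (simp add: vimage_def Int_def open_Compl)
  ultimately have "S \<inter> \<Omega> = {} \<or> {p \<in> \<Omega>. w p \<noteq> w p0} \<inter> \<Omega> = {}"
    by (rule connectedD[OF conn]) (auto simp: S_def)
  then have all: "w p = w p0" if "p \<in> \<Omega>" for p using p0 that by (auto simp: S_def)
  have "\<forall>\<^sub>F p in at q0 within \<Omega>. w p < w p0"
    using w(2) q0 wp0 unfolding nonpos_at_boundary_def by blast
  moreover have "\<forall>\<^sub>F p in at q0 within \<Omega>. p \<in> \<Omega>"
    by (simp add: eventually_at_filter)
  ultimately have "\<forall>\<^sub>F p in at q0 within \<Omega>. False"
    by eventually_elim (use all in auto)
  then have "at q0 within \<Omega> = bot" by (simp add: trivial_limit_def)
  moreover have "q0 \<notin> \<Omega>" "q0 \<in> closure \<Omega>" using q0 \<Omega> by (auto simp: frontier_def interior_open)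
  ultimately show False by (simp add: at_within_eq_bot_iff)
qed

end

section \<open>The strong maximum principle\<close>

lemma second_derivative_nonneg_at_min:
  fixes f f' :: "real \<Rightarrow> real"
  assumes d: "d > 0" and f: "\<And>t. \<bar>t\<bar> < d \<Longrightarrow> (f has_real_derivative f' t) (at t)"
    and f': "(f' has_real_derivative k) (at 0)" and min: "\<And>t. \<bar>t\<bar> < d \<Longrightarrow> f 0 \<le> f t"
  shows "0 \<le> k"
proof (rule ccontr)
  assume "\<not> 0 \<le> k"
  then have "k < 0" by simp
  have "f' 0 = 0"
    by (rule DERIV_local_min[OF f d]) (use d min in auto)
  from has_real_derivative_neg_dec_right[OF f' \<open>k < 0\<close>] this
  obtain \<delta> where \<delta>: "\<delta> > 0" "\<And>h. 0 < h \<Longrightarrow> h < \<delta> \<Longrightarrow> f' h < 0" by auto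
  define t where "t = min d \<delta> / 2"
  have t: "0 < t" "t < d" "t < \<delta>" using d \<delta> by (auto simp: t_def)
  have "\<exists>z>0. z < t \<and> f t - f 0 = (t - 0) * f' z"
    using t by (intro MVT2) (auto intro!: f)
  then obtain z where z: "0 < z" "z < t" "f t - f 0 = t * f' z" by auto
  have "f' z < 0" using z t \<delta> by auto
  then have "t * f' z < 0" using t by (simp add: mult_pos_neg)
  then have "f t < f 0" using z by linarith
  then show False using min[of t] t by simp
qed

lemma line_has_derivative:
  assumes "u differentiable at (x + t *\<^sub>R v)"
  shows "((\<lambda>t. u (x + t *\<^sub>R v)) has_real_derivative grad u (x + t *\<^sub>R v) \<bullet> v) (at t)"
proof -
  have "((\<lambda>t. u (x + t *\<^sub>R v)) has_derivative (\<lambda>h. grad u (x + t *\<^sub>R v) \<bullet> (h *\<^sub>R v))) (at t)"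
    by (rule has_derivative_compose[where f="\<lambda>t. x + t *\<^sub>R v" and g=u])
      (auto intro!: derivative_eq_intros has_derivative_grad assms)
  then show ?thesis
    unfolding has_field_derivative_def by (rule has_derivative_eq_rhs) (simp add: fun_eq_iff)
qed

text \<open>The second derivative of \<open>u\<close> at \<open>x\<close> in the direction \<open>v\<close>. Both mixed partial derivatives occur, so that
their symmetry is never used.\<close>

definition second_dir :: "(plane \<Rightarrow> real) \<Rightarrow> plane \<Rightarrow> plane \<Rightarrow> real" where
  "second_dir u x v = fst v * (grad (pdx u) x \<bullet> v) + snd v * (grad (pdy u) x \<bullet> v)"

lemma second_dir:
  assumes "C2_on \<Omega> u" "x \<in> \<Omega>"
  shows "((\<lambda>t. grad u (x + t *\<^sub>R v) \<bullet> v) has_real_derivative second_dir u x v) (at 0)"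
proof -
  have "pdx u differentiable at (x + 0 *\<^sub>R v)" "pdy u differentiable at (x + 0 *\<^sub>R v)"
    using assms by (auto simp: C2_on_def intro: C1_on_differentiable)
  from this[THEN line_has_derivative]
  have "((\<lambda>t. pdx u (x + t *\<^sub>R v)) has_real_derivative grad (pdx u) x \<bullet> v) (at 0)"
    "((\<lambda>t. pdy u (x + t *\<^sub>R v)) has_real_derivative grad (pdy u) x \<bullet> v) (at 0)"
    by simp_all
  then have "((\<lambda>t. pdx u (x + t *\<^sub>R v) * fst v + pdy u (x + t *\<^sub>R v) * snd v) has_real_derivative
    (grad (pdx u) x \<bullet> v) * fst v + (grad (pdy u) x \<bullet> v) * snd v) (at 0)"
    by (intro DERIV_add DERIV_cmult_right)
  then show ?thesis
    by (simp add: grad_def inner_prod_def second_dir_def mult.commute)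
qed

lemma norm_line: "(norm (y + t *\<^sub>R v))\<^sup>2 = (norm y)\<^sup>2 + 2 * t * (y \<bullet> v) + t\<^sup>2 * (norm v)\<^sup>2"
  unfolding power2_norm_eq_inner
  by (simp add: inner_add_left inner_add_right inner_commute power2_eq_square algebra_simps)

lemma gauss_line:
  fixes y v :: plane and \<alpha> t :: real
  shows "((\<lambda>t. exp (- \<alpha> * (norm (y + t *\<^sub>R v))\<^sup>2)) has_real_derivative
      - \<alpha> * (2 * (y \<bullet> v) + 2 * t * (norm v)\<^sup>2) * exp (- \<alpha> * (norm (y + t *\<^sub>R v))\<^sup>2)) (at t)"
    and "((\<lambda>t. - \<alpha> * (2 * (y \<bullet> v) + 2 * t * (norm v)\<^sup>2) * exp (- \<alpha> * (norm (y + t *\<^sub>R v))\<^sup>2))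
      has_real_derivative (4 * \<alpha>\<^sup>2 * (y \<bullet> v)\<^sup>2 - 2 * \<alpha> * (norm v)\<^sup>2) * exp (- \<alpha> * (norm y)\<^sup>2)) (at 0)"
  unfolding norm_line
  by (auto intro!: derivative_eq_intros simp: power2_eq_square algebra_simps)

lemma gauss_line_shift:
  fixes y v :: plane and \<alpha> t c :: real
  shows "((\<lambda>t. exp (- \<alpha> * (norm (y + t *\<^sub>R v))\<^sup>2) - c) has_real_derivative
      - \<alpha> * (2 * (y \<bullet> v) + 2 * t * (norm v)\<^sup>2) * exp (- \<alpha> * (norm (y + t *\<^sub>R v))\<^sup>2)) (at t)"
  by (rule DERIV_cong[OF DERIV_diff[OF gauss_line(1) DERIV_const]]) (rule diff_0_right)

text \<open>The classical proof of Hopf. The operator has no zero order term, and its coefficient matrix is the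
identity plus the square of the vector \<open>(Q, -P)\<close>. Hence it is the sum of the second derivatives in the
directions \<open>(1, 0)\<close>, \<open>(0, 1)\<close> and \<open>(Q, -P)\<close>, which are all nonnegative at a minimum. The affine
form of \<open>w\<close> covers both upper and lower bounds for \<open>u\<close>.\<close>

lemma strong_minimum_principle:
  fixes c s :: real and u P Q :: "plane \<Rightarrow> real"
  defines "w \<equiv> \<lambda>x. c + s * u x"
  assumes \<Omega>: "open \<Omega>" "connected \<Omega>" and u: "C2_on \<Omega> u"
    and PQ: "continuous_on \<Omega> P" "continuous_on \<Omega> Q"
    and eq: "\<And>x. x \<in> \<Omega> \<Longrightarrow> (1 + (Q x)\<^sup>2) * pdx (pdx u) x - P x * Q x * (pdy (pdx u) x + pdx (pdy u) x)
        + (1 + (P x)\<^sup>2) * pdy (pdy u) x = 0"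
    and nonneg: "\<And>x. x \<in> \<Omega> \<Longrightarrow> 0 \<le> w x" and z: "z \<in> \<Omega>" "w z = 0" and x: "x \<in> \<Omega>"
  shows "w x = 0"
proof (rule ccontr)
  assume "w x \<noteq> 0"
  have C1: "C1_on \<Omega> u" using u by (simp add: C2_on_def)
  have cw: "continuous_on \<Omega> w"
    unfolding w_def by (intro continuous_intros C1_on_continuous C1)
  have dw: "((\<lambda>t. w (y + t *\<^sub>R v)) has_real_derivative s * (grad u (y + t *\<^sub>R v) \<bullet> v)) (at t)"
    if "y + t *\<^sub>R v \<in> \<Omega>" for y v t
    unfolding w_def
    using line_has_derivative[OF C1_on_differentiable[OF C1 that]] by (auto intro!: derivative_eq_intros)
  have "open {y \<in> \<Omega>. w y \<noteq> 0}"
    using continuous_open_preimage[OF cw \<Omega>(1), of "- {0}"] by (simp add: vimage_def Int_def open_Compl)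
  moreover have "\<not> ({y \<in> \<Omega>. w y = 0} \<inter> \<Omega> = {} \<or> {y \<in> \<Omega>. w y \<noteq> 0} \<inter> \<Omega> = {})"
    using z x \<open>w x \<noteq> 0\<close> by auto
  ultimately have "\<not> open {y \<in> \<Omega>. w y = 0}"
    using connectedD[OF \<Omega>(2), of "{y \<in> \<Omega>. w y = 0}" "{y \<in> \<Omega>. w y \<noteq> 0}"] by auto
  then obtain z0 where z0: "z0 \<in> \<Omega>" "w z0 = 0" "\<And>r. r > 0 \<Longrightarrow> \<not> ball z0 r \<subseteq> {y \<in> \<Omega>. w y = 0}"
    unfolding open_contains_ball by auto
  obtain r0 where r0: "r0 > 0" "cball z0 r0 \<subseteq> \<Omega>" using \<Omega>(1) z0(1) by (meson open_contains_cball)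
  define r where "r = r0 / 2"
  have r: "r > 0" "cball z0 (2 * r) \<subseteq> \<Omega>" using r0 by (auto simp: r_def)
  from z0(3)[OF r(1)] obtain q where q: "dist z0 q < r" "\<not> (q \<in> \<Omega> \<and> w q = 0)" by (auto simp: subset_iff)
  have "q \<in> cball z0 (2 * r)" using q(1) r(1) by simp
  then have "q \<in> \<Omega>" using r(2) by (rule rev_subsetD)
  then have wq: "w q \<noteq> 0" using q by auto
  define S where "S = {y \<in> cball z0 (2 * r). w y = 0}"
  have "compact S"
  proof -
    have "closed S"
      unfolding S_def using continuous_closed_preimage_constant[OF continuous_on_subset[OF cw r(2)]]
      by auto
    moreover have "S \<subseteq> cball z0 (2 * r)" by (auto simp: S_def)
    ultimately show ?thesis by (metis compact_Int_closed compact_cball inf.absorb_iff2)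
  qed
  moreover have z0S: "z0 \<in> S" using z0(2) r(1) by (simp add: S_def)
  then have "S \<noteq> {}" by blast
  ultimately obtain z1 where z1: "z1 \<in> S" "\<And>y. y \<in> S \<Longrightarrow> dist q z1 \<le> dist q y"
    using continuous_attains_inf[of S "\<lambda>y. dist q y"] continuous_on_dist[OF continuous_on_const continuous_on_id]
    by blast
  define R where "R = dist q z1"
  have wz1: "w z1 = 0" "z1 \<in> \<Omega>" using z1 r by (auto simp: S_def)
  have R: "0 < R" "R < r" using z1(2)[OF z0S] q(1) wq wz1(1) by (auto simp: R_def dist_commute)
  have sub: "y \<in> cball z0 (2 * r)" if "dist q y \<le> R" for y
    using dist_triangle[of z0 y q] that q R by simp
  have cb: "cball q R \<subseteq> \<Omega>"
  proof
    fix y assume "y \<in> cball q R"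
    then have "y \<in> cball z0 (2 * r)" by (intro sub) simp
    then show "y \<in> \<Omega>" using r(2) by blast
  qed
  have pos: "0 < w y" if "dist q y < R" for y
  proof -
    have "y \<in> cball q R" using that by simp
    then have "y \<in> \<Omega>" using cb by blast
    moreover have "w y \<noteq> 0" using z1(2)[of y] sub[of y] that by (auto simp: S_def R_def)
    ultimately show ?thesis using nonneg[of y] by simp
  qed
  have "cball q (R / 2) \<subseteq> \<Omega>" using cb R(1) by (intro order_trans[OF subset_cball cb]) simp
  then have "continuous_on (cball q (R / 2)) w" using cw by (rule continuous_on_subset[rotated])
  moreover have "cball q (R / 2) \<noteq> {}" using R(1) by simp
  ultimately obtain y0 where "y0 \<in> cball q (R / 2)" "\<forall>y\<in>cball q (R / 2). w y0 \<le> w y"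
    using continuous_attains_inf[OF compact_cball] by blast
  then have y0: "dist q y0 \<le> R / 2" "\<And>y. dist q y \<le> R / 2 \<Longrightarrow> w y0 \<le> w y"
    by (simp_all del: split_paired_All)
  define \<mu> where "\<mu> = w y0"
  have \<mu>: "\<mu> > 0" using pos[of y0] y0 R by (simp add: \<mu>_def)
  have "bounded ((\<lambda>y. 2 + (P y)\<^sup>2 + (Q y)\<^sup>2) ` cball q R)"
    by (intro compact_imp_bounded compact_continuous_image continuous_intros continuous_on_subset[OF _ cb] PQ compact_cball)
  then obtain B where B: "B > 0" "\<And>y. y \<in> cball q R \<Longrightarrow> 2 + (P y)\<^sup>2 + (Q y)\<^sup>2 \<le> B"
    unfolding bounded_pos by (force simp del: split_paired_All)
  \<comment> \<open>Large enough for the Gaussian to be a strict subsolution on the annulus.\<close>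
  define \<alpha> where "\<alpha> = 4 * B / R\<^sup>2"
  have \<alpha>: "\<alpha> > 0" using B R by (simp add: \<alpha>_def)
  define f where "f y = w y - \<mu> * (exp (- \<alpha> * (norm (y - q))\<^sup>2) - exp (- \<alpha> * R\<^sup>2))" for y
  \<comment> \<open>The annulus on which \<open>w\<close> is compared with a multiple of the Gaussian.\<close>
  define Ann where "Ann = cball q R - ball q (R / 2)"
  have cf: "continuous_on \<Omega> f" unfolding f_def by (intro continuous_intros cw)
  have f0: "0 \<le> f y" if y: "y \<in> Ann" for y
  proof (rule ccontr)
    assume neg: "\<not> 0 \<le> f y"
    have "compact Ann" unfolding Ann_def by (intro compact_diff) auto
    moreover have AnnO: "Ann \<subseteq> \<Omega>" using cb by (auto simp: Ann_def)
    ultimately obtain m where m: "m \<in> Ann" "\<And>y. y \<in> Ann \<Longrightarrow> f m \<le> f y"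
      using continuous_attains_inf[of Ann f] continuous_on_subset[OF cf] y by blast
    have fm: "f m < 0" using m(2)[OF y] neg by simp
    have nm: "norm (m - q) = dist q m" by (simp add: dist_norm norm_minus_commute)
    have "dist q m \<noteq> R"
    proof
      assume "dist q m = R"
      then have "f m = w m" by (simp add: f_def nm)
      then show False using fm nonneg[of m] m AnnO by auto
    qed
    moreover have "dist q m \<noteq> R / 2"
    proof
      assume "dist q m = R / 2"
      then have "\<mu> \<le> w m" using y0 by (simp add: \<mu>_def)
      moreover have "\<mu> * (exp (- \<alpha> * (norm (m - q))\<^sup>2) - exp (- \<alpha> * R\<^sup>2)) \<le> \<mu> * 1"
      proof (intro mult_left_mono)
        have "exp (- \<alpha> * (norm (m - q))\<^sup>2) \<le> 1" using \<alpha> by simp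
        moreover have "0 \<le> exp (- \<alpha> * R\<^sup>2)" by simp
        ultimately show "exp (- \<alpha> * (norm (m - q))\<^sup>2) - exp (- \<alpha> * R\<^sup>2) \<le> 1" by linarith
      qed (use \<mu> in simp)
      ultimately show False using fm by (simp add: f_def)
    qed
    ultimately have "m \<in> ball q R - cball q (R / 2)" using m by (auto simp: Ann_def)
    moreover have "open (ball q R - cball q (R / 2))" by (intro open_Diff) auto
    ultimately obtain d where d: "d > 0" "ball m d \<subseteq> ball q R - cball q (R / 2)"
      by (meson open_contains_ball)
    have ball_Ann: "ball m d \<subseteq> Ann"
    proof -
      have "ball q R - cball q (R / 2) \<subseteq> Ann"
        using ball_subset_cball[of q R] ball_subset_cball[of q "R / 2"] unfolding Ann_def by blast
      then show ?thesis using d(2) by blast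
    qed
    have dir: "0 \<le> s * second_dir u m v -
        \<mu> * ((4 * \<alpha>\<^sup>2 * ((m - q) \<bullet> v)\<^sup>2 - 2 * \<alpha> * (norm v)\<^sup>2) * exp (- \<alpha> * (norm (m - q))\<^sup>2))" for v
    proof -
      define \<delta> where "\<delta> = d / (norm v + 1)"
      have \<delta>: "\<delta> > 0" using d by (simp add: \<delta>_def add_nonneg_pos)
      have inb: "m + t *\<^sub>R v \<in> ball m d" if "\<bar>t\<bar> < \<delta>" for t
      proof -
        have "\<bar>t\<bar> * norm v \<le> \<bar>t\<bar> * (norm v + 1)" by (intro mult_left_mono) auto
        also have "\<dots> < \<delta> * (norm v + 1)" using that by (intro mult_strict_right_mono) (auto simp: add_nonneg_pos)
        also have "\<dots> = d" by (simp add: \<delta>_def add_nonneg_eq_0_iff)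
        finally show ?thesis by (simp add: dist_norm)
      qed
      define g where "g t = f (m + t *\<^sub>R v)" for t
      define g' where "g' t = s * (grad u (m + t *\<^sub>R v) \<bullet> v) -
        \<mu> * (- \<alpha> * (2 * ((m - q) \<bullet> v) + 2 * t * (norm v)\<^sup>2) * exp (- \<alpha> * (norm (m - q + t *\<^sub>R v))\<^sup>2))" for t
      have g_eq: "g = (\<lambda>t. w (m + t *\<^sub>R v) - \<mu> * (exp (- \<alpha> * (norm (m - q + t *\<^sub>R v))\<^sup>2) - exp (- \<alpha> * R\<^sup>2)))"
        by (simp add: g_def f_def fun_eq_iff algebra_simps)
      show ?thesis
      proof (rule second_derivative_nonneg_at_min[OF \<delta>])
        fix t assume t: "\<bar>t\<bar> < \<delta>"
        have "m + t *\<^sub>R v \<in> \<Omega>" using inb[OF t] ball_Ann AnnO by auto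
        from dw[OF this] show "(g has_real_derivative g' t) (at t)"
          unfolding g_eq g'_def
          by (rule DERIV_diff[OF _ DERIV_cmult[OF gauss_line_shift]])
        have "m + t *\<^sub>R v \<in> Ann" using inb[OF t] ball_Ann by blast
        then have "f m \<le> f (m + t *\<^sub>R v)" by (rule m(2))
        then show "g 0 \<le> g t" by (simp add: g_def)
      next
        show "(g' has_real_derivative s * second_dir u m v -
          \<mu> * ((4 * \<alpha>\<^sup>2 * ((m - q) \<bullet> v)\<^sup>2 - 2 * \<alpha> * (norm v)\<^sup>2) * exp (- \<alpha> * (norm (m - q))\<^sup>2))) (at 0)"
          unfolding g'_def using m AnnO
          by (intro DERIV_diff DERIV_cmult gauss_line(2) second_dir[OF u]) auto
      qed
    qed
    have mO: "m \<in> \<Omega>" using m AnnO by auto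
    define E where "E = exp (- \<alpha> * (norm (m - q))\<^sup>2)"
    have E: "E > 0" by (simp add: E_def)
    define v where "v = (Q m, - P m)"
    have "second_dir u m (1, 0) + second_dir u m (0, 1) + second_dir u m v = 0"
      using eq[OF mO] by (simp add: second_dir_def v_def grad_def inner_prod_def power2_eq_square algebra_simps)
    then have "s * second_dir u m (1, 0) + s * second_dir u m (0, 1) + s * second_dir u m v = 0"
      by (metis distrib_left mult_zero_right)
    with dir[of "(1, 0)"] dir[of "(0, 1)"] dir[of v]
    have "\<mu> * ((4 * \<alpha>\<^sup>2 * ((m - q) \<bullet> (1, 0))\<^sup>2 - 2 * \<alpha> * (norm ((1, 0)::plane))\<^sup>2) * E) +
      \<mu> * ((4 * \<alpha>\<^sup>2 * ((m - q) \<bullet> (0, 1))\<^sup>2 - 2 * \<alpha> * (norm ((0, 1)::plane))\<^sup>2) * E) +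
      \<mu> * ((4 * \<alpha>\<^sup>2 * ((m - q) \<bullet> v)\<^sup>2 - 2 * \<alpha> * (norm v)\<^sup>2) * E) \<le> 0"
      unfolding E_def by linarith
    then have prod: "(\<mu> * E) * ((4 * \<alpha>\<^sup>2 * ((m - q) \<bullet> (1, 0))\<^sup>2 - 2 * \<alpha> * (norm ((1, 0)::plane))\<^sup>2) +
      (4 * \<alpha>\<^sup>2 * ((m - q) \<bullet> (0, 1))\<^sup>2 - 2 * \<alpha> * (norm ((0, 1)::plane))\<^sup>2) +
      (4 * \<alpha>\<^sup>2 * ((m - q) \<bullet> v)\<^sup>2 - 2 * \<alpha> * (norm v)\<^sup>2)) \<le> 0"
      by (simp only: algebra_simps)
    have key: "z \<le> k" if "(x1 - 2 * \<alpha> * n1) + (x2 - 2 * \<alpha> * n2) + (x3 - y) \<le> 0" "x1 + x2 = z"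
      "n1 = 1" "n2 = 1" "y = k - 4 * \<alpha>" "0 \<le> x3" for x1 x2 x3 n1 n2 y z k :: real
      using that(1,2,5,6) unfolding that(3,4) by linarith
    from prod have "(4 * \<alpha>\<^sup>2 * ((m - q) \<bullet> (1, 0))\<^sup>2 - 2 * \<alpha> * (norm ((1, 0)::plane))\<^sup>2) +
      (4 * \<alpha>\<^sup>2 * ((m - q) \<bullet> (0, 1))\<^sup>2 - 2 * \<alpha> * (norm ((0, 1)::plane))\<^sup>2) +
      (4 * \<alpha>\<^sup>2 * ((m - q) \<bullet> v)\<^sup>2 - 2 * \<alpha> * (norm v)\<^sup>2) \<le> 0"
      using \<mu> E by (simp add: mult_le_0_iff)
    moreover have "4 * \<alpha>\<^sup>2 * ((m - q) \<bullet> (1, 0))\<^sup>2 + 4 * \<alpha>\<^sup>2 * ((m - q) \<bullet> (0, 1))\<^sup>2 =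
        4 * \<alpha>\<^sup>2 * (norm (m - q))\<^sup>2"
    proof -
      have "((m - q) \<bullet> (1, 0))\<^sup>2 + ((m - q) \<bullet> (0, 1))\<^sup>2 = (norm (m - q))\<^sup>2"
        by (simp add: inner_prod_def norm_prod_def)
      then show ?thesis by (simp only: distrib_left[symmetric])
    qed
    moreover have "(norm ((1, 0)::plane))\<^sup>2 = 1" "(norm ((0, 1)::plane))\<^sup>2 = 1"
      "2 * \<alpha> * (norm v)\<^sup>2 = 2 * \<alpha> * (2 + (P m)\<^sup>2 + (Q m)\<^sup>2) - 4 * \<alpha>"
      by (simp_all add: norm_Pair v_def algebra_simps)
    moreover have "0 \<le> 4 * \<alpha>\<^sup>2 * ((m - q) \<bullet> v)\<^sup>2" by simp
    ultimately have le: "4 * \<alpha>\<^sup>2 * (norm (m - q))\<^sup>2 \<le> 2 * \<alpha> * (2 + (P m)\<^sup>2 + (Q m)\<^sup>2)"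
      by (rule key)
    have "2 * \<alpha> * (2 + (P m)\<^sup>2 + (Q m)\<^sup>2) \<le> 2 * \<alpha> * B"
      using B(2)[of m] m \<alpha> by (intro mult_left_mono) (auto simp: Ann_def)
    moreover have "4 * \<alpha>\<^sup>2 * (R / 2)\<^sup>2 \<le> 4 * \<alpha>\<^sup>2 * (norm (m - q))\<^sup>2"
      using m R by (intro mult_left_mono power_mono) (auto simp: Ann_def nm)
    moreover have "4 * \<alpha>\<^sup>2 * (R / 2)\<^sup>2 = 4 * \<alpha> * B"
      using R by (simp add: \<alpha>_def power2_eq_square)
    moreover have "0 < \<alpha> * B" using \<alpha> B by simp
    ultimately show False using le by linarith
  qed
  \<comment> \<open>Now \<open>w\<close> has vanishing gradient at \<open>z1\<close>, whereas the Gaussian increases strictly inwards.\<close>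
  define v where "v = q - z1"
  have nv: "norm v = R" by (simp add: v_def R_def dist_norm)
  define k where "k = - \<alpha> * (2 * ((z1 - q) \<bullet> v) + 2 * 0 * (norm v)\<^sup>2) * exp (- \<alpha> * (norm (z1 - q + 0 *\<^sub>R v))\<^sup>2)"
  have k: "k = 2 * \<alpha> * R\<^sup>2 * exp (- \<alpha> * R\<^sup>2)"
  proof -
    have "(z1 - q) \<bullet> v = - (v \<bullet> v)" by (simp add: v_def algebra_simps)
    then have "(z1 - q) \<bullet> v = - R\<^sup>2" by (simp only: power2_norm_eq_inner[symmetric] nv)
    moreover have "norm (z1 - q) = R" by (simp add: R_def dist_norm norm_minus_commute)
    ultimately show ?thesis by (simp add: k_def)
  qed
  obtain d0 where d0: "d0 > 0" "ball z1 d0 \<subseteq> \<Omega>" using \<Omega>(1) wz1(2) by (meson open_contains_ball)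
  have D1: "((\<lambda>t. w (z1 + t *\<^sub>R v)) has_real_derivative s * (grad u (z1 + 0 *\<^sub>R v) \<bullet> v)) (at 0)"
    by (rule dw) (simp add: wz1)
  have "s * (grad u (z1 + 0 *\<^sub>R v) \<bullet> v) = 0"
  proof (rule DERIV_local_min[OF D1])
    show "0 < d0 / R" using d0 R by simp
    show "\<forall>t. \<bar>0 - t\<bar> < d0 / R \<longrightarrow> w (z1 + 0 *\<^sub>R v) \<le> w (z1 + t *\<^sub>R v)"
    proof (intro allI impI)
      fix t assume "\<bar>0 - t\<bar> < d0 / R"
      then have "z1 + t *\<^sub>R v \<in> ball z1 d0" using R by (simp add: dist_norm nv field_simps)
      then have "z1 + t *\<^sub>R v \<in> \<Omega>" using d0(2) by blast
      then show "w (z1 + 0 *\<^sub>R v) \<le> w (z1 + t *\<^sub>R v)" using nonneg wz1(1) by simp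
    qed
  qed
  with D1 have "((\<lambda>t. w (z1 + t *\<^sub>R v)) has_real_derivative 0) (at 0)" by (simp only:)
  from DERIV_diff[OF this DERIV_cmult[OF gauss_line_shift]]
  have der: "((\<lambda>t. w (z1 + t *\<^sub>R v) - \<mu> * (exp (- \<alpha> * (norm (z1 - q + t *\<^sub>R v))\<^sup>2) - exp (- \<alpha> * R\<^sup>2)))
     has_real_derivative 0 - \<mu> * k) (at 0)"
    unfolding k_def .
  have "(\<lambda>t. w (z1 + t *\<^sub>R v) - \<mu> * (exp (- \<alpha> * (norm (z1 - q + t *\<^sub>R v))\<^sup>2) - exp (- \<alpha> * R\<^sup>2))) =
     (\<lambda>t. f (z1 + t *\<^sub>R v))"
    by (simp add: f_def fun_eq_iff algebra_simps)
  with der have "((\<lambda>t. f (z1 + t *\<^sub>R v)) has_real_derivative 0 - \<mu> * k) (at 0)" by simp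
  moreover have "0 - \<mu> * k < 0" using \<mu> \<alpha> R by (simp add: k)
  ultimately obtain d where d: "d > 0" "\<And>h. 0 < h \<Longrightarrow> h < d \<Longrightarrow> f (z1 + h *\<^sub>R v) < f (z1 + 0 *\<^sub>R v)"
    using has_real_derivative_neg_dec_right by fastforce
  define h where "h = min (d / 2) (1 / 2)"
  have h: "0 < h" "h < d" "h \<le> 1 / 2" using d by (auto simp: h_def)
  have "f z1 = 0"
    using wz1 by (simp add: f_def R_def dist_norm norm_minus_commute)
  then have "f (z1 + h *\<^sub>R v) < 0" using d(2)[OF h(1,2)] by simp
  moreover have "z1 + h *\<^sub>R v \<in> Ann"
  proof -
    have "q - (z1 + h *\<^sub>R v) = (1 - h) *\<^sub>R v" by (simp add: v_def algebra_simps)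
    then have "dist q (z1 + h *\<^sub>R v) = (1 - h) * R" using h by (simp add: dist_norm nv)
    moreover have "(1 - h) * R \<le> 1 * R" "(1 / 2) * R \<le> (1 - h) * R"
      using h R by (intro mult_right_mono; simp)+
    ultimately show ?thesis by (simp add: Ann_def)
  qed
  ultimately show False using f0 by fastforce
qed

section \<open>Minimal Killing graphs in the Heisenberg group\<close>

text \<open>The area element \<open>W\<close> of a graph with generalized gradient \<open>g\<close>.\<close>

definition graph_area :: "plane \<Rightarrow> real" where
  "graph_area g = sqrt (1 + (norm g)\<^sup>2)"

text \<open>The horizontal part \<open>g / W\<close> of the unit normal of such a graph, up to sign.\<close>

definition slope :: "plane \<Rightarrow> plane" where
  "slope g = g /\<^sub>R graph_area g"

lemma graph_area: "1 \<le> graph_area g" "norm g \<le> graph_area g" "(graph_area g)\<^sup>2 = 1 + (norm g)\<^sup>2"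
  unfolding graph_area_def by (auto intro: real_le_rsqrt)

lemma graph_area_pos: "0 < graph_area g"
  using graph_area(1)[of g] by linarith

lemma scaleR_slope: "graph_area g *\<^sub>R slope g = g"
  using graph_area_pos[of g] by (simp add: slope_def)

lemma norm_slope_le: "norm (slope g) \<le> 1"
  using graph_area(2)[of g] graph_area_pos[of g] by (simp add: slope_def field_simps)

lemma norm_slope_square: "(norm (slope g))\<^sup>2 = 1 - 1 / (graph_area g)\<^sup>2"
proof -
  have "(norm (slope g))\<^sup>2 = (norm g)\<^sup>2 / (graph_area g)\<^sup>2"
    using graph_area_pos[of g] by (simp add: slope_def power_mult_distrib power_divide divide_inverse power_inverse)
  also have "\<dots> = ((graph_area g)\<^sup>2 - 1) / (graph_area g)\<^sup>2" by (simp add: graph_area(3))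
  also have "\<dots> = 1 - 1 / (graph_area g)\<^sup>2" using graph_area_pos[of g] by (simp add: diff_divide_distrib)
  finally show ?thesis .
qed

lemma inj_slope:
  assumes "slope g = slope h"
  shows "g = h"
proof -
  have "1 / (graph_area g)\<^sup>2 = 1 / (graph_area h)\<^sup>2"
    using norm_slope_square[of g] norm_slope_square[of h] assms by simp
  then have "(graph_area g)\<^sup>2 = (graph_area h)\<^sup>2" by simp
  then have "graph_area g = graph_area h"
    using graph_area_pos[of g] graph_area_pos[of h] by (metis less_le power2_eq_imp_eq)
  then show ?thesis by (metis assms scaleR_slope)
qed

text \<open>The monotonicity inequality behind the estimate of Collin and Krust.\<close>

lemma slope_monotone:
  "(graph_area g + graph_area h) / 2 * (norm (slope g - slope h))\<^sup>2 \<le> (g - h) \<bullet> (slope g - slope h)"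
proof -
  let ?a = "graph_area g" and ?b = "graph_area h" and ?x = "slope g" and ?y = "slope h"
  have gx: "g = ?a *\<^sub>R ?x" and hy: "h = ?b *\<^sub>R ?y" by (simp_all add: scaleR_slope)
  have sq: "?x \<bullet> ?x = 1 - 1 / ?a\<^sup>2" "?y \<bullet> ?y = 1 - 1 / ?b\<^sup>2"
    by (simp_all add: norm_slope_square flip: power2_norm_eq_inner)
  have i1: "(g - h) \<bullet> (?x - ?y) = ?a * (?x \<bullet> ?x) + ?b * (?y \<bullet> ?y) - (?a + ?b) * (?x \<bullet> ?y)"
    by (subst gx, subst hy) (simp add: inner_diff_left inner_diff_right inner_commute algebra_simps)
  have i2: "(norm (?x - ?y))\<^sup>2 = ?x \<bullet> ?x + ?y \<bullet> ?y - 2 * (?x \<bullet> ?y)"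
    unfolding power2_norm_eq_inner by (simp add: inner_diff_left inner_diff_right inner_commute algebra_simps)
  have "(g - h) \<bullet> (?x - ?y) - (?a + ?b) / 2 * (norm (?x - ?y))\<^sup>2 =
      (?a - ?b) / 2 * (?x \<bullet> ?x - ?y \<bullet> ?y)"
    unfolding i1 i2 by (simp add: field_simps)
  also have "\<dots> = (?a - ?b) / 2 * (1 / ?b\<^sup>2 - 1 / ?a\<^sup>2)" by (simp add: sq)
  also have "0 \<le> \<dots>"
  proof (cases "?b \<le> ?a")
    case True
    then have "?b\<^sup>2 \<le> ?a\<^sup>2" using graph_area_pos[of h] by (intro power_mono) auto
    then have "1 / ?a\<^sup>2 \<le> 1 / ?b\<^sup>2" using graph_area_pos[of h] by (intro divide_left_mono mult_pos_pos zero_less_power graph_area_pos) auto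
    then show ?thesis using True by (intro mult_nonneg_nonneg) auto
  next
    case False
    then have "?a\<^sup>2 \<le> ?b\<^sup>2" using graph_area_pos[of g] by (intro power_mono) auto
    then have "1 / ?b\<^sup>2 \<le> 1 / ?a\<^sup>2" using graph_area_pos[of g] by (intro divide_left_mono mult_pos_pos zero_less_power graph_area_pos) auto
    then show ?thesis using False by (intro mult_nonpos_nonpos) auto
  qed
  finally show ?thesis by simp
qed

text \<open>Used with \<open>g\<close> the gradient of \<open>u\<close> and \<open>h\<close> the rotation field \<open>\<tau> (y, -x)\<close>.\<close>

lemma norm_le_inner_slope: "norm g \<le> g \<bullet> slope (g + h) + (1 + 2 * norm h)"
proof -
  let ?f = "g + h"
  let ?A = "graph_area ?f"
  have "?f \<bullet> slope ?f = ?A * (norm (slope ?f))\<^sup>2"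
    by (subst (1) scaleR_slope[symmetric]) (simp add: power2_norm_eq_inner)
  also have "\<dots> = ?A - 1 / ?A"
    using graph_area_pos[of ?f] unfolding norm_slope_square
    by (simp add: right_diff_distrib power2_eq_square)
  also have "\<dots> \<ge> ?A - 1"
    using graph_area(1)[of ?f] by simp
  finally have "norm ?f - 1 \<le> ?f \<bullet> slope ?f" using graph_area(2)[of ?f] by linarith
  moreover have "h \<bullet> slope ?f \<le> norm h"
    using norm_cauchy_schwarz[of h "slope ?f"] norm_slope_le[of ?f]
      mult_left_mono[of "norm (slope ?f)" 1 "norm h"] by simp
  moreover have "?f \<bullet> slope ?f = g \<bullet> slope ?f + h \<bullet> slope ?f" by (rule inner_add_left)
  moreover have "norm g \<le> norm ?f + norm h" using norm_triangle_ineq4[of ?f h] by simp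
  ultimately show ?thesis by linarith
qed

text \<open>The field whose divergence is twice the mean curvature of the graph of \<open>u\<close>.\<close>

definition nil3_field :: "real \<Rightarrow> (plane \<Rightarrow> real) \<Rightarrow> plane \<Rightarrow> plane" where
  "nil3_field \<tau> u p = slope (nil3_gradient \<tau> u p)"

lemma nil3_mean_curvature_eq: "nil3_mean_curvature \<tau> u p = 1/2 * divergence (nil3_field \<tau> u) p"
  by (simp add: nil3_mean_curvature_def nil3_field_def[abs_def] slope_def graph_area_def)

text \<open>The graph of \<open>u\<close> over \<open>\<Omega>\<close> is minimal.\<close>

definition minimal_graph_on :: "real \<Rightarrow> plane set \<Rightarrow> (plane \<Rightarrow> real) \<Rightarrow> bool" where
  "minimal_graph_on \<tau> \<Omega> u \<longleftrightarrow> C2_on \<Omega> u \<and> (\<forall>p\<in>\<Omega>. nil3_mean_curvature \<tau> u p = 0)"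

lemma nil3_gradient_eq: "nil3_gradient \<tau> u p = grad u p + \<tau> *\<^sub>R (snd p, - fst p)"
  by (simp add: nil3_gradient_def grad_def)

lemma inverse_sqrt_has_derivative:
  assumes "0 \<le> s"
  shows "((\<lambda>s. inverse (sqrt (1 + s))) has_real_derivative - ((inverse (sqrt (1 + s))) ^ 3 / 2)) (at s)"
  using assms by (auto intro!: derivative_eq_intros simp: power3_eq_cube divide_simps)

lemma slope_field:
  assumes p: "C1_on \<Omega> p" and q: "C1_on \<Omega> q"
  shows "C1_on \<Omega> (\<lambda>z. fst (slope (p z, q z)))" "C1_on \<Omega> (\<lambda>z. snd (slope (p z, q z)))"
    and "x \<in> \<Omega> \<Longrightarrow> divergence (\<lambda>z. slope (p z, q z)) x =
      ((1 + (q x)\<^sup>2) * pdx p x - p x * q x * (pdy p x + pdx q x) + (1 + (p x)\<^sup>2) * pdy q x)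
        / graph_area (p x, q x) ^ 3"
proof -
  define m where "m z = p z * p z + q z * q z" for z
  define R where "R z = inverse (sqrt (1 + m z))" for z
  have m0: "0 \<le> m z" for z by (simp add: m_def)
  have m: "C1_on \<Omega> m" unfolding m_def by (intro C1_on_add C1_on_mult p q)
  have R: "C1_on \<Omega> R"
    unfolding R_def
  proof (rule C1_on_compose[OF m])
    show "continuous_on (m ` \<Omega>) (\<lambda>s. - ((inverse (sqrt (1 + s))) ^ 3 / 2))"
      using m0 by (intro continuous_intros) (auto simp: add_nonneg_eq_0_iff)
  qed (rule inverse_sqrt_has_derivative[OF m0])
  have area: "graph_area (p z, q z) = sqrt (1 + m z)" for z
    by (simp add: graph_area_def norm_Pair m_def power2_eq_square)
  have f: "(\<lambda>z. fst (slope (p z, q z))) = (\<lambda>z. R z * p z)"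
    and s: "(\<lambda>z. snd (slope (p z, q z))) = (\<lambda>z. R z * q z)"
    by (simp_all add: slope_def area R_def fun_eq_iff)
  show "C1_on \<Omega> (\<lambda>z. fst (slope (p z, q z)))" "C1_on \<Omega> (\<lambda>z. snd (slope (p z, q z)))"
    unfolding f s by (intro C1_on_mult R p q)+
  assume x: "x \<in> \<Omega>"
  note d = C1_on_differentiable[OF p x] C1_on_differentiable[OF q x]
  note dm = C1_on_differentiable[OF m x] and dR = C1_on_differentiable[OF R x]
  have gm: "grad m x = (2 * p x) *\<^sub>R grad p x + (2 * q x) *\<^sub>R grad q x"
    unfolding m_def
    using C1_on_differentiable[OF C1_on_mult[OF p p] x] C1_on_differentiable[OF C1_on_mult[OF q q] x]
    by (simp add: grad_add grad_mult d flip: scaleR_2)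
  have gR: "grad R x = (- ((R x) ^ 3 / 2)) *\<^sub>R grad m x"
    unfolding R_def by (rule grad_compose[OF dm inverse_sqrt_has_derivative[OF m0]])
  have Rm: "(R x)\<^sup>2 * (1 + m x) = 1"
    using m0[of x] by (simp add: R_def power_inverse)
  have R3: "R x = (R x) ^ 3 * (1 + m x)"
    using Rm by (simp add: power3_eq_cube power2_eq_square mult.assoc)
  have R0: "R x ^ 3 = 1 / graph_area (p x, q x) ^ 3"
    by (simp add: R_def area power_inverse divide_inverse)
  have "divergence (\<lambda>z. slope (p z, q z)) x =
     R x * pdx p x + p x * (- ((R x) ^ 3 / 2) * (2 * p x * pdx p x + 2 * q x * pdx q x)) +
     (R x * pdy q x + q x * (- ((R x) ^ 3 / 2) * (2 * p x * pdy p x + 2 * q x * pdy q x)))"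
    unfolding divergence_def f s pdx_grad pdy_grad
    unfolding grad_mult[OF dR d(1)] grad_mult[OF dR d(2)] gR gm by simp
  also have "\<dots> = R x * (pdx p x + pdy q x) - (R x) ^ 3 *
      (p x * (p x * pdx p x + q x * pdx q x) + q x * (p x * pdy p x + q x * pdy q x))"
    by (simp add: field_simps)
  also have "\<dots> = (R x) ^ 3 * ((1 + m x) * (pdx p x + pdy q x) -
      (p x * (p x * pdx p x + q x * pdx q x) + q x * (p x * pdy p x + q x * pdy q x)))"
    by (subst (1) R3) (simp only: right_diff_distrib mult.assoc)
  also have "(1 + m x) * (pdx p x + pdy q x) -
      (p x * (p x * pdx p x + q x * pdx q x) + q x * (p x * pdy p x + q x * pdy q x)) =
      (1 + (q x)\<^sup>2) * pdx p x - p x * q x * (pdy p x + pdx q x) + (1 + (p x)\<^sup>2) * pdy q x"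
    by (simp add: m_def power2_eq_square algebra_simps)
  finally show "divergence (\<lambda>z. slope (p z, q z)) x =
      ((1 + (q x)\<^sup>2) * pdx p x - p x * q x * (pdy p x + pdx q x) + (1 + (p x)\<^sup>2) * pdy q x)
        / graph_area (p x, q x) ^ 3"
    by (simp add: R0)
qed

lemma C2_on_imp_C1_on: "C2_on S u \<Longrightarrow> C1_on S u"
  by (simp add: C2_on_def)

lemma
  assumes u: "C2_on \<Omega> u"
  shows C1_nil3_p: "C1_on \<Omega> (\<lambda>z. fst (nil3_gradient \<tau> u z))"
    and C1_nil3_q: "C1_on \<Omega> (\<lambda>z. snd (nil3_gradient \<tau> u z))"
    and grad_nil3_p: "x \<in> \<Omega> \<Longrightarrow> grad (\<lambda>z. fst (nil3_gradient \<tau> u z)) x = grad (pdx u) x + (0, \<tau>)"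
    and grad_nil3_q: "x \<in> \<Omega> \<Longrightarrow> grad (\<lambda>z. snd (nil3_gradient \<tau> u z)) x = grad (pdy u) x - (\<tau>, 0)"
proof -
  have c: "C1_on \<Omega> (pdx u)" "C1_on \<Omega> (pdy u)" using u by (simp_all add: C2_on_def)
  have p: "(\<lambda>z. fst (nil3_gradient \<tau> u z)) = (\<lambda>z. pdx u z + (0, \<tau>) \<bullet> z)"
    and q: "(\<lambda>z. snd (nil3_gradient \<tau> u z)) = (\<lambda>z. pdy u z - (\<tau>, 0) \<bullet> z)"
    by (simp_all add: nil3_gradient_def fun_eq_iff)
  show "C1_on \<Omega> (\<lambda>z. fst (nil3_gradient \<tau> u z))" "C1_on \<Omega> (\<lambda>z. snd (nil3_gradient \<tau> u z))"
    unfolding p q by (intro C1_on_add C1_on_diff C1_on_inner c)+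
  assume x: "x \<in> \<Omega>"
  note d = C1_on_differentiable[OF c(1) x] C1_on_differentiable[OF c(2) x]
    C1_on_differentiable[OF C1_on_inner[of \<Omega>] x]
  show "grad (\<lambda>z. fst (nil3_gradient \<tau> u z)) x = grad (pdx u) x + (0, \<tau>)"
    unfolding p grad_add[OF d(1) d(3)] by simp
  show "grad (\<lambda>z. snd (nil3_gradient \<tau> u z)) x = grad (pdy u) x - (\<tau>, 0)"
    unfolding q grad_diff[OF d(2) d(3)] by simp
qed

text \<open>The minimal surface equation in nondivergence form. The constants \<open>\<plusminus>\<tau>\<close> coming from the derivatives of
the generalized gradient cancel, so that no lower order term is left.\<close>

lemma nil3_field:
  assumes u: "C2_on \<Omega> u"
  shows "C1_on \<Omega> (\<lambda>z. fst (nil3_field \<tau> u z))" "C1_on \<Omega> (\<lambda>z. snd (nil3_field \<tau> u z))"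
    and "x \<in> \<Omega> \<Longrightarrow> nil3_mean_curvature \<tau> u x =
      ((1 + (snd (nil3_gradient \<tau> u x))\<^sup>2) * pdx (pdx u) x
        - fst (nil3_gradient \<tau> u x) * snd (nil3_gradient \<tau> u x) * (pdy (pdx u) x + pdx (pdy u) x)
        + (1 + (fst (nil3_gradient \<tau> u x))\<^sup>2) * pdy (pdy u) x)
      / (2 * graph_area (nil3_gradient \<tau> u x) ^ 3)"
proof -
  let ?p = "\<lambda>z. fst (nil3_gradient \<tau> u z)" and ?q = "\<lambda>z. snd (nil3_gradient \<tau> u z)"
  have eq: "nil3_field \<tau> u = (\<lambda>z. slope (?p z, ?q z))" by (simp add: nil3_field_def fun_eq_iff)
  note C = C1_nil3_p[OF u, of \<tau>] C1_nil3_q[OF u, of \<tau>]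
  show "C1_on \<Omega> (\<lambda>z. fst (nil3_field \<tau> u z))" "C1_on \<Omega> (\<lambda>z. snd (nil3_field \<tau> u z))"
    unfolding eq by (rule slope_field[OF C])+
  assume x: "x \<in> \<Omega>"
  have "pdx ?p x = pdx (pdx u) x" "pdy ?p x = pdy (pdx u) x + \<tau>"
    "pdx ?q x = pdx (pdy u) x - \<tau>" "pdy ?q x = pdy (pdy u) x"
    by (simp_all add: pdx_grad pdy_grad grad_nil3_p[OF u x] grad_nil3_q[OF u x])
  then show "nil3_mean_curvature \<tau> u x =
      ((1 + (?q x)\<^sup>2) * pdx (pdx u) x - ?p x * ?q x * (pdy (pdx u) x + pdx (pdy u) x)
        + (1 + (?p x)\<^sup>2) * pdy (pdy u) x) / (2 * graph_area (nil3_gradient \<tau> u x) ^ 3)"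
    unfolding nil3_mean_curvature_eq eq slope_field(3)[OF C x] by simp
qed

lemma minimal_graph_const: "minimal_graph_on \<tau> \<Omega> (\<lambda>_. c)"
proof -
  have z: "pdx (\<lambda>_. k) = (\<lambda>_. 0)" "pdy (\<lambda>_. k) = (\<lambda>_. 0)" for k
    by (simp_all add: pdx_grad pdy_grad fun_eq_iff)
  have "C2_on \<Omega> (\<lambda>_. c)" by (simp add: C2_on_def z)
  then show ?thesis by (simp add: minimal_graph_on_def nil3_field(3) z)
qed

lemma minimal_graph_divergence:
  "minimal_graph_on \<tau> \<Omega> u \<Longrightarrow> p \<in> \<Omega> \<Longrightarrow> divergence (nil3_field \<tau> u) p = 0"
  by (simp add: minimal_graph_on_def nil3_mean_curvature_eq)

lemma divergence_lin:
  assumes "(\<lambda>q. fst (X q)) differentiable at p" "(\<lambda>q. snd (X q)) differentiable at p"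
    and "(\<lambda>q. fst (Y q)) differentiable at p" "(\<lambda>q. snd (Y q)) differentiable at p"
  shows "divergence (\<lambda>q. X q - Y q) p = divergence X p - divergence Y p"
  using assms by (simp add: divergence_def pdx_grad pdy_grad grad_diff)

lemma minimal_graph_comparison_data:
  assumes u: "minimal_graph_on \<tau> \<Omega> u" and v: "minimal_graph_on \<tau> \<Omega> v"
  defines "w \<equiv> \<lambda>p. u p - v p" and "Z \<equiv> \<lambda>p. nil3_field \<tau> u p - nil3_field \<tau> v p"
  shows "C1_on \<Omega> w" "C1_on \<Omega> (\<lambda>q. fst (Z q))" "C1_on \<Omega> (\<lambda>q. snd (Z q))"
    and "p \<in> \<Omega> \<Longrightarrow> divergence Z p = 0"
    and "norm (Z p) \<le> 2"
    and "p \<in> \<Omega> \<Longrightarrow> (graph_area (nil3_gradient \<tau> u p) + graph_area (nil3_gradient \<tau> v p)) / 2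
      * (norm (Z p))\<^sup>2 \<le> grad w p \<bullet> Z p"
    and "p \<in> \<Omega> \<Longrightarrow> grad w p \<bullet> Z p = 0 \<Longrightarrow> grad w p = 0"
proof -
  have C: "C2_on \<Omega> u" "C2_on \<Omega> v" using u v by (auto simp: minimal_graph_on_def)
  note F = nil3_field(1,2)[OF C(1), of \<tau>] nil3_field(1,2)[OF C(2), of \<tau>]
  show "C1_on \<Omega> w" unfolding w_def by (intro C1_on_diff C2_on_imp_C1_on C)
  show "C1_on \<Omega> (\<lambda>q. fst (Z q))" "C1_on \<Omega> (\<lambda>q. snd (Z q))"
    unfolding Z_def fst_diff snd_diff by (intro C1_on_diff F)+
  show "norm (Z p) \<le> 2"
    using norm_triangle_ineq4[of "nil3_field \<tau> u p" "nil3_field \<tau> v p"]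
      norm_slope_le[of "nil3_gradient \<tau> u p"] norm_slope_le[of "nil3_gradient \<tau> v p"]
    by (simp add: Z_def nil3_field_def)
  assume p: "p \<in> \<Omega>"
  show "divergence Z p = 0"
    unfolding Z_def using C1_on_differentiable[OF _ p] F
    by (subst divergence_lin) (auto simp: minimal_graph_divergence[OF u p] minimal_graph_divergence[OF v p])
  have gw: "grad w p = nil3_gradient \<tau> u p - nil3_gradient \<tau> v p"
    unfolding w_def grad_diff[OF C1_on_differentiable[OF C2_on_imp_C1_on[OF C(1)] p]
        C1_on_differentiable[OF C2_on_imp_C1_on[OF C(2)] p]]
    by (simp add: nil3_gradient_eq)
  show mono: "(graph_area (nil3_gradient \<tau> u p) + graph_area (nil3_gradient \<tau> v p)) / 2
      * (norm (Z p))\<^sup>2 \<le> grad w p \<bullet> Z p"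
    unfolding gw Z_def nil3_field_def by (rule slope_monotone)
  assume "grad w p \<bullet> Z p = 0"
  moreover have "0 < (graph_area (nil3_gradient \<tau> u p) + graph_area (nil3_gradient \<tau> v p)) / 2"
    using graph_area_pos[of "nil3_gradient \<tau> u p"] graph_area_pos[of "nil3_gradient \<tau> v p"] by simp
  ultimately have "(norm (Z p))\<^sup>2 \<le> 0" using mono by (simp add: mult_le_0_iff)
  then have "nil3_field \<tau> u p = nil3_field \<tau> v p" by (simp add: Z_def)
  then show "grad w p = 0" unfolding gw nil3_field_def using inj_slope by auto
qed

context strip_domain
begin

text \<open>For a bounded difference only \<open>W \<ge> 1\<close> is used.\<close>

lemma bounded_comparison:
  assumes conn: "connected \<Omega>" and q0: "q0 \<in> frontier \<Omega> - D"
    and u: "minimal_graph_on \<tau> \<Omega> u" and v: "minimal_graph_on \<tau> \<Omega> v"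
    and bdry: "nonpos_at_boundary (\<lambda>p. u p - v p)"
    and B: "B \<ge> 0" "\<And>p. p \<in> \<Omega> \<Longrightarrow> u p - v p \<le> B"
    and p0: "p0 \<in> \<Omega>"
  shows "u p0 \<le> v p0"
proof -
  let ?w = "\<lambda>p. u p - v p" and ?Z = "\<lambda>p. nil3_field \<tau> u p - nil3_field \<tau> v p"
  note data = minimal_graph_comparison_data[OF u v]
  have Q: "1 * (norm (?Z p))\<^sup>2 \<le> grad ?w p \<bullet> ?Z p" if p: "p \<in> \<Omega>" for p
  proof -
    have "1 * (norm (?Z p))\<^sup>2 \<le>
      (graph_area (nil3_gradient \<tau> u p) + graph_area (nil3_gradient \<tau> v p)) / 2 * (norm (?Z p))\<^sup>2"
      using graph_area(1)[of "nil3_gradient \<tau> u p"] graph_area(1)[of "nil3_gradient \<tau> v p"]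
      by (intro mult_right_mono) auto
    then show ?thesis using data(6)[OF p] by linarith
  qed
  have M: "(LINT p:C|lborel. wt e 1 p powr (-(2 + \<alpha>)) * ((kap (excess \<epsilon> (?w p)))\<^sup>2 / 1)) \<le> B\<^sup>2 * A / \<alpha>"
    if \<epsilon>: "\<epsilon> > 0" and \<alpha>: "0 < \<alpha>" "\<alpha> \<le> 1" and C: "compact C" "C \<subseteq> \<Omega>" for \<epsilon> \<alpha> C
  proof -
    have cw: "continuous_on C ?w" using data(1) C(2) by (blast intro: continuous_on_subset C1_on_continuous)
    have c\<kappa>: "continuous_on C (\<lambda>p. kap (excess \<epsilon> (?w p)))"
      by (intro continuous_on_excess_compose continuous_kap cw)
    have cwt: "continuous_on C (\<lambda>p. wt e 1 p powr k)" for k by (rule continuous_wt_powr) simp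
    have "(LINT p:C|lborel. wt e 1 p powr (-(2 + \<alpha>)) * ((kap (excess \<epsilon> (?w p)))\<^sup>2 / 1)) \<le>
      (LINT p:C|lborel. B\<^sup>2 * wt e 1 p powr (-(1 + \<alpha>)))"
    proof (rule set_integral_mono_continuous[OF C(1)])
      show "continuous_on C (\<lambda>p. wt e 1 p powr (-(2 + \<alpha>)) * ((kap (excess \<epsilon> (?w p)))\<^sup>2 / 1))"
        by (intro continuous_on_mult continuous_on_divide continuous_on_power cwt c\<kappa> continuous_on_const) simp
      show "continuous_on C (\<lambda>p. B\<^sup>2 * wt e 1 p powr (-(1 + \<alpha>)))"
        by (intro continuous_on_mult continuous_on_const cwt)
      fix p assume "p \<in> C"
      then have "p \<in> \<Omega>" using C(2) by blast
      have "kap (excess \<epsilon> (?w p)) \<le> excess \<epsilon> (?w p)" by (rule kap_le[OF excess_nonneg])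
      also have "\<dots> \<le> B" using B(1) B(2)[OF \<open>p \<in> \<Omega>\<close>] \<epsilon> by (simp add: excess_def)
      finally have 1: "(kap (excess \<epsilon> (?w p)))\<^sup>2 \<le> B\<^sup>2"
        using kap_nonneg[OF excess_nonneg] by (intro power_mono) auto
      have "1 \<le> wt e 1 p" using wt_ge(1)[of 1 e p] by simp
      then have 2: "wt e 1 p powr (-(2 + \<alpha>)) \<le> wt e 1 p powr (-(1 + \<alpha>))" by (intro powr_mono) auto
      have "wt e 1 p powr (-(2 + \<alpha>)) * (kap (excess \<epsilon> (?w p)))\<^sup>2 \<le> wt e 1 p powr (-(1 + \<alpha>)) * B\<^sup>2"
        by (rule mult_mono[OF 2 1]) auto
      then show "wt e 1 p powr (-(2 + \<alpha>)) * ((kap (excess \<epsilon> (?w p)))\<^sup>2 / 1) \<le> B\<^sup>2 * wt e 1 p powr (-(1 + \<alpha>))"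
        by (simp add: mult.commute)
    qed
    also have "\<dots> = B\<^sup>2 * (LINT p:C|lborel. wt e 1 p powr (-(1 + \<alpha>)))" by (rule set_integral_mult_right)
    also have "\<dots> \<le> B\<^sup>2 * (A / \<alpha>)" using integral_wt[of 1 \<alpha> C] \<alpha> C by (intro mult_left_mono) auto
    finally show ?thesis by simp
  qed
  have "?w p0 \<le> 0"
    by (rule comparison_principle[where Z="?Z" and \<omega>="\<lambda>_. 1" and K=1 and M="B\<^sup>2 * A",
          OF conn q0 data(1) bdry data(2,3,4,5) continuous_on_const _ Q data(7) _ M p0]) auto
  then show ?thesis by simp
qed

text \<open>No bound on \<open>u\<close> is assumed. The area element of the constant graph at \<open>p\<close> is at least a multiple of the weight
because \<open>\<tau> \<noteq> 0\<close>, and this compensates exactly for the possible linear growth allowed by the second moments.\<close>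

lemma one_sided_bound:
  assumes conn: "connected \<Omega>" and q0: "q0 \<in> frontier \<Omega> - D" and \<tau>: "\<tau> \<noteq> 0"
    and u: "minimal_graph_on \<tau> \<Omega> u" and s: "s = 1 \<or> s = - 1"
    and bdry: "nonpos_at_boundary (\<lambda>p. s * (u p - c))"
    and p0: "p0 \<in> \<Omega>"
  shows "s * (u p0 - c) \<le> 0"
proof -
  let ?v = "\<lambda>_::plane. c"
  let ?w = "\<lambda>p. s * (u p - c)"
  let ?Y = "\<lambda>p. nil3_field \<tau> u p - nil3_field \<tau> ?v p"
  let ?Z = "\<lambda>p. s *\<^sub>R ?Y p" and ?X = "\<lambda>p. s *\<^sub>R nil3_field \<tau> u p"
  have ss: "s * s = 1" "\<bar>s\<bar> = 1" using s by auto
  note data = minimal_graph_comparison_data[OF u minimal_graph_const[of \<tau> \<Omega> c]]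
  have C2: "C2_on \<Omega> u" using u by (simp add: minimal_graph_on_def)
  have w: "C1_on \<Omega> ?w" by (intro C1_on_mult C1_on_const data(1))
  have dconst: "(\<lambda>_. k) differentiable at p" for k :: real and p :: plane by (rule differentiable_const)
  have gscale: "grad (\<lambda>q. s * f q) p = s *\<^sub>R grad f p" if "f differentiable at p" for f p
    unfolding grad_mult[OF dconst that] by simp
  have div_scale: "divergence (\<lambda>q. s *\<^sub>R X q) p = s * divergence X p"
    if "(\<lambda>q. fst (X q)) differentiable at p" "(\<lambda>q. snd (X q)) differentiable at p" for X p
    using that by (simp add: divergence_def pdx_grad pdy_grad gscale distrib_left)
  have gw0: "grad (\<lambda>p. u p - c) p = grad u p" if "p \<in> \<Omega>" for p
    unfolding grad_diff[OF C1_on_differentiable[OF C2_on_imp_C1_on[OF C2] that] dconst] by simp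
  have gw: "grad ?w p = s *\<^sub>R grad (\<lambda>p. u p - c) p" if "p \<in> \<Omega>" for p
    by (rule gscale[OF C1_on_differentiable[OF data(1) that]])
  have CZ: "C1_on \<Omega> (\<lambda>q. fst (?Z q))" "C1_on \<Omega> (\<lambda>q. snd (?Z q))"
    using C1_on_mult[OF C1_on_const data(2)] C1_on_mult[OF C1_on_const data(3)] by simp_all
  have CX: "C1_on \<Omega> (\<lambda>q. fst (?X q))" "C1_on \<Omega> (\<lambda>q. snd (?X q))"
    using C1_on_mult[OF C1_on_const nil3_field(1)[OF C2]] C1_on_mult[OF C1_on_const nil3_field(2)[OF C2]]
    by simp_all
  have dX: "divergence ?X p = 0" if p: "p \<in> \<Omega>" for p
    using div_scale[OF C1_on_differentiable[OF nil3_field(1)[OF C2] p]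
        C1_on_differentiable[OF nil3_field(2)[OF C2] p], of \<tau>] minimal_graph_divergence[OF u p]
    by simp
  have dZ: "divergence ?Z p = 0" if p: "p \<in> \<Omega>" for p
    using div_scale[OF C1_on_differentiable[OF data(2) p] C1_on_differentiable[OF data(3) p]] data(4)[OF p]
    by simp
  have X1: "norm (?X p) \<le> 1" for p using ss norm_slope_le by (simp add: nil3_field_def)
  have Z2: "norm (?Z p) \<le> 2" for p using ss data(5)[of p] by simp
  have inner_sign: "(s *\<^sub>R x) \<bullet> (s *\<^sub>R y) = x \<bullet> y" for x y :: plane
    using ss(1) by (simp flip: mult.assoc)
  have inner: "grad ?w p \<bullet> ?Z p = grad (\<lambda>p. u p - c) p \<bullet> ?Y p" if "p \<in> \<Omega>" for p
    by (simp only: gw[OF that] inner_sign)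
  have norm_rot: "norm (snd p, - fst p) = norm p" for p :: plane
    by (simp add: norm_prod_def add.commute)
  define h where "h p = 1 + 2 * (\<bar>\<tau>\<bar> * norm p)" for p :: plane
  have h: "norm (grad ?w p) \<le> grad ?w p \<bullet> ?X p + h p" if p: "p \<in> \<Omega>" for p
  proof -
    have "norm (grad u p) \<le> grad u p \<bullet> nil3_field \<tau> u p + h p"
      using norm_le_inner_slope[of "grad u p" "\<tau> *\<^sub>R (snd p, - fst p)"]
      by (simp only: nil3_field_def nil3_gradient_eq h_def norm_scaleR norm_rot)
    moreover have "norm (grad ?w p) = norm (grad u p)" unfolding gw[OF p] gw0[OF p] using ss by simp
    moreover have "grad ?w p \<bullet> ?X p = grad u p \<bullet> nil3_field \<tau> u p"
      by (simp only: gw[OF p] gw0[OF p] inner_sign)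
    ultimately show ?thesis by simp
  qed
  \<comment> \<open>The exponents of the weight in the moment estimates are at most 4.\<close>
  define K where "K = max 1 (16 * width)"
  have K: "1 \<le> K" "16 * width \<le> K" by (auto simp: K_def)
  define G where "G = 1 + 4 * \<bar>\<tau>\<bar> * L"
  have G: "0 \<le> G" using axis(2) by (simp add: G_def)
  have hG: "h p \<le> G * wt e K p" if "p \<in> \<Omega>" for p
  proof -
    have wt: "1 \<le> wt e K p" "\<bar>e \<bullet> p\<bar> \<le> wt e K p" using wt_ge(1)[of K e p] K(1) wt_ge(2)[of e p K] by auto
    have "a \<le> n \<bullet> p" "n \<bullet> p \<le> b" using strip that by auto
    then have "norm p \<le> L * (1 + \<bar>e \<bullet> p\<bar>)" by (rule axis(4))
    also have "\<dots> \<le> L * (2 * wt e K p)" using wt axis(2) by (intro mult_left_mono) auto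
    finally have "2 * (\<bar>\<tau>\<bar> * norm p) \<le> 2 * (\<bar>\<tau>\<bar> * (L * (2 * wt e K p)))"
      by (intro mult_left_mono) auto
    also have "\<dots> = 4 * \<bar>\<tau>\<bar> * L * wt e K p" by simp
    finally have "h p \<le> wt e K p + 4 * \<bar>\<tau>\<bar> * L * wt e K p" unfolding h_def using wt(1) by linarith
    then show ?thesis by (simp add: G_def distrib_right)
  qed
  define k where "k = K + 1 / \<bar>\<tau>\<bar>"
  define m where "m = 1 / (2 * k)"
  have k: "0 < k" using K \<tau> by (simp add: k_def add_pos_nonneg)
  then have m: "m > 0" by (simp add: m_def)
  \<comment> \<open>A lower bound for half the area element of the constant graph.\<close>
  define \<omega> where "\<omega> p = m * wt e K p" for p
  have om0: "0 < \<omega> p" for p using m wt_pos[of K e p] K by (simp add: \<omega>_def)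
  have Q: "\<omega> p * (norm (?Z p))\<^sup>2 \<le> grad ?w p \<bullet> ?Z p" if p: "p \<in> \<Omega>" for p
  proof -
    let ?A = "graph_area (nil3_gradient \<tau> ?v p)"
    have "nil3_gradient \<tau> ?v p = \<tau> *\<^sub>R (snd p, - fst p)" by (simp add: nil3_gradient_eq)
    then have "norm (nil3_gradient \<tau> ?v p) = \<bar>\<tau>\<bar> * norm p" by (simp only: norm_scaleR norm_rot)
    then have A: "\<bar>\<tau>\<bar> * norm p \<le> ?A" "1 \<le> ?A" using graph_area[of "nil3_gradient \<tau> ?v p"] by auto
    have "wt e K p \<le> K + \<bar>e \<bullet> p\<bar>"
      unfolding wt_def using sqrt_sum_squares_le_sum_abs[of K "e \<bullet> p"] K by simp
    moreover have "\<bar>e \<bullet> p\<bar> \<le> norm p" using Cauchy_Schwarz_ineq2[of e p] axis(1) by simp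
    moreover have "norm p \<le> 1 / \<bar>\<tau>\<bar> * ?A" using A(1) \<tau> by (simp add: field_simps)
    moreover have "K \<le> K * ?A" using A(2) K by simp
    ultimately have "wt e K p \<le> K * ?A + 1 / \<bar>\<tau>\<bar> * ?A" by linarith
    then have "wt e K p \<le> k * ?A" by (simp only: k_def distrib_right)
    then have "m * wt e K p \<le> m * (k * ?A)" using m by (intro mult_left_mono) auto
    also have "m * (k * ?A) = ?A / 2" using k by (simp add: m_def)
    finally have "\<omega> p \<le> ?A / 2" by (simp add: \<omega>_def)
    also have "\<dots> \<le> (graph_area (nil3_gradient \<tau> u p) + ?A) / 2"
      using graph_area_pos[of "nil3_gradient \<tau> u p"] by simp
    finally have "\<omega> p * (norm (?Y p))\<^sup>2 \<le>
      (graph_area (nil3_gradient \<tau> u p) + ?A) / 2 * (norm (?Y p))\<^sup>2" by (intro mult_right_mono) auto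
    also have "\<dots> \<le> grad ?w p \<bullet> ?Z p" unfolding inner[OF p] by (rule data(6)[OF p])
    finally show ?thesis using ss by simp
  qed
  have rigid: "grad ?w p = 0" if "p \<in> \<Omega>" "grad ?w p \<bullet> ?Z p = 0" for p
  proof -
    have "grad (\<lambda>p. u p - c) p \<bullet> ?Y p = 0" by (rule trans[OF inner[OF that(1), symmetric] that(2)])
    from data(7)[OF that(1) this] show ?thesis unfolding gw[OF that(1)] by simp
  qed
  have M: "(LINT p:C|lborel. wt e K p powr (-(2 + \<alpha>)) * ((kap (excess \<epsilon> (?w p)))\<^sup>2 / \<omega> p)) \<le>
      (8 * width\<^sup>2 * G\<^sup>2 * A / m) / \<alpha>"
    if \<epsilon>: "\<epsilon> > 0" and \<alpha>: "0 < \<alpha>" "\<alpha> \<le> 1" and C: "compact C" "C \<subseteq> \<Omega>" for \<epsilon> \<alpha> C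
  proof -
    have "wt e K p powr (-(2 + \<alpha>)) * (y / \<omega> p) = 1 / m * (wt e K p powr (-(3 + \<alpha>)) * y)" for p y
    proof -
      have w0: "0 < wt e K p" using wt_pos[of K e p] K by simp
      have "wt e K p powr (-(2 + \<alpha>) + (-1)) = wt e K p powr (-(2 + \<alpha>)) * wt e K p powr (-1)"
        by (rule powr_add)
      moreover have "-(2 + \<alpha>) + (-1) = -(3 + \<alpha>)" by simp
      ultimately have "wt e K p powr (-(3 + \<alpha>)) = wt e K p powr (-(2 + \<alpha>)) * wt e K p powr (-1)"
        by (simp only:)
      moreover have "wt e K p powr (-1) = 1 / wt e K p" using w0 by (simp add: powr_minus_divide)
      ultimately have "wt e K p powr (-(3 + \<alpha>)) = wt e K p powr (-(2 + \<alpha>)) / wt e K p" by (simp only: times_divide_eq_right mult_1_right)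
      then show ?thesis by (simp add: \<omega>_def)
    qed
    then have "(LINT p:C|lborel. wt e K p powr (-(2 + \<alpha>)) * ((kap (excess \<epsilon> (?w p)))\<^sup>2 / \<omega> p)) =
      1 / m * (LINT p:C|lborel. wt e K p powr (-(3 + \<alpha>)) * (kap (excess \<epsilon> (?w p)))\<^sup>2)"
      by (simp only: set_integral_mult_right)
    also have "\<dots> \<le> 1 / m * (8 * width\<^sup>2 * G\<^sup>2 * A / \<alpha>)"
    proof (rule mult_left_mono)
      show "(LINT p:C|lborel. wt e K p powr (-(3 + \<alpha>)) * (kap (excess \<epsilon> (?w p)))\<^sup>2) \<le> 8 * width\<^sup>2 * G\<^sup>2 * A / \<alpha>"
      proof (rule second_moment[OF w bdry CX dX X1 h _ _ hG K \<epsilon> \<alpha> C G])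
        show "continuous_on \<Omega> h" unfolding h_def by (intro continuous_intros)
        show "0 \<le> h p" for p by (simp add: h_def)
      qed
    qed (use m in simp)
    finally show ?thesis by simp
  qed
  have com: "continuous_on \<Omega> \<omega>" unfolding \<omega>_def by (intro continuous_intros)
  show ?thesis
    by (rule comparison_principle[where Z="?Z" and \<omega>=\<omega> and w="?w",
          OF conn q0 w bdry CZ dZ Z2 com om0 Q rigid K(1) M p0])
qed

end

section \<open>Boundary values and the Dirichlet problem\<close>

lemma continuous_if_continuous_param:
  assumes par: "local_param S p \<delta> c" and f: "continuous_on {-\<delta><..<\<delta>} (f \<circ> c)"
  shows "continuous (at p within S) f"
proof -
  obtain U g where U: "open U" and hom: "homeomorphism {-\<delta><..<\<delta>} (S \<inter> U) c g"
    and \<delta>: "0 < \<delta>" and c0: "c 0 = p"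
    using par by (auto simp: local_param_def)
  have "c 0 \<in> S \<inter> U" using hom \<delta> unfolding homeomorphism_def by (metis greaterThanLessThan_iff imageI neg_less_0_iff_less)
  then have p: "p \<in> S \<inter> U" by (simp add: c0)
  have g: "continuous_on (S \<inter> U) g" "g ` (S \<inter> U) = {-\<delta><..<\<delta>}" and cg: "\<And>x. x \<in> S \<inter> U \<Longrightarrow> c (g x) = x"
    using hom by (auto simp: homeomorphism_def)
  have "continuous_on (S \<inter> U) (\<lambda>x. (f \<circ> c) (g x))"
    by (rule continuous_on_compose2[OF f g(1)]) (simp add: g(2))
  moreover have "(f \<circ> c) (g x) = f x" if "x \<in> S \<inter> U" for x using cg[OF that] by simp
  ultimately have "continuous_on (S \<inter> U) f" by (metis (no_types, lifting) continuous_on_cong)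
  then have "continuous (at p within S \<inter> U) f" using p by (simp add: continuous_on_eq_continuous_within)
  moreover have "at p within S \<inter> U = at p within S"
    using p U by (intro at_within_nhd[of p U]) auto
  ultimately show ?thesis by (simp add: continuous_within)
qed

lemma piecewise_C2_on_boundary_jumps:
  assumes "piecewise_C2_on_boundary \<Omega> \<phi>"
  obtains D where "closed D" "discrete D" "D \<subseteq> frontier \<Omega>"
    "\<And>p. p \<in> frontier \<Omega> - D \<Longrightarrow> continuous (at p within frontier \<Omega>) \<phi>"
proof -
  obtain D where D: "D \<subseteq> frontier \<Omega>" "closed D" "discrete D"
    and par: "\<forall>p \<in> frontier \<Omega> - D. \<exists>\<delta> c. regular_C2_param (frontier \<Omega>) p \<delta> c \<and>
           C2_curve_on {-\<delta><..<\<delta>} (\<phi> \<circ> c)"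
    using assms unfolding piecewise_C2_on_boundary_def by blast
  have "continuous (at p within frontier \<Omega>) \<phi>" if p: "p \<in> frontier \<Omega> - D" for p
  proof -
    obtain \<delta> c where "regular_C2_param (frontier \<Omega>) p \<delta> c" "C2_curve_on {-\<delta><..<\<delta>} (\<phi> \<circ> c)"
      using par p by blast
    then have par: "local_param (frontier \<Omega>) p \<delta> c"
      and diff: "\<And>t. t \<in> {-\<delta><..<\<delta>} \<Longrightarrow> (\<phi> \<circ> c) differentiable (at t)"
      unfolding regular_C2_param_def C2_curve_on_def by blast+
    have "continuous_on {-\<delta><..<\<delta>} (\<phi> \<circ> c)"
      by (intro continuous_at_imp_continuous_on ballI differentiable_imp_continuous_within diff)
    with par show ?thesis by (rule continuous_if_continuous_param)
  qed
  with D show thesis by (intro that[of D])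
qed

text \<open>Otherwise the complement of the frontier would be connected, since a discrete set is countable, although it is
the disjoint union of \<open>\<Omega>\<close> and its exterior.\<close>

lemma frontier_not_subset_discrete:
  assumes \<Omega>: "open \<Omega>" "\<Omega> \<noteq> {}" "closure \<Omega> \<noteq> UNIV" and D: "closed D" "discrete D"
  shows "\<exists>q. q \<in> frontier \<Omega> - (D :: plane set)"
proof (rule ccontr)
  assume "\<nexists>q. q \<in> frontier \<Omega> - D"
  then have fD: "frontier \<Omega> \<subseteq> D" by blast
  have "countable D"
  proof -
    have "countable (D \<inter> cball 0 (real k))" for k
    proof -
      have "compact (D \<inter> cball 0 (real k))" using D(1) by (intro closed_Int_compact) auto
      moreover have "discrete (D \<inter> cball 0 (real k))" using D(2) by (rule discrete_subset) auto
      ultimately have "finite (D \<inter> cball 0 (real k))"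
        using finite_not_islimpt_in_compact[of "D \<inter> cball 0 (real k)" "D \<inter> cball 0 (real k)"]
        by (simp add: discrete_def isolated_in_islimpt_iff)
      then show ?thesis by (rule countable_finite)
    qed
    then have "countable (\<Union>k. D \<inter> cball 0 (real k))" by (intro countable_UN) auto
    moreover have "D \<subseteq> (\<Union>k. D \<inter> cball 0 (real k))"
    proof
      fix x assume "x \<in> D"
      moreover obtain k where "norm x \<le> real k" using real_arch_simple by blast
      ultimately show "x \<in> (\<Union>k. D \<inter> cball 0 (real k))" by (auto simp: dist_norm)
    qed
    ultimately show ?thesis by (rule countable_subset[rotated])
  qed
  then have "countable (frontier \<Omega>)" using fD countable_subset by blast
  then have conn: "connected (UNIV - frontier \<Omega>)"
    by (intro connected_open_diff_countable) (auto simp: connected_UNIV)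
  have "\<Omega> \<inter> (UNIV - frontier \<Omega>) = {} \<or> (- closure \<Omega>) \<inter> (UNIV - frontier \<Omega>) = {}"
    using \<Omega>(1) closure_subset[of \<Omega>]
    by (intro connectedD[OF conn]) (auto simp: frontier_def interior_open)
  moreover have "\<Omega> \<inter> (UNIV - frontier \<Omega>) = \<Omega>"
    using \<Omega>(1) by (auto simp: frontier_def interior_open)
  moreover have "(- closure \<Omega>) \<inter> (UNIV - frontier \<Omega>) = - closure \<Omega>" by (auto simp: frontier_def)
  ultimately show False using \<Omega>(2,3) by auto
qed

text \<open>If equality occurred at one point it would occur everywhere, against the boundary value at \<open>q\<close>.\<close>

lemma minimal_graph_strict_bound:
  assumes \<Omega>: "open \<Omega>" "connected \<Omega>" and u: "minimal_graph_on \<tau> \<Omega> u"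
    and le: "\<And>p. p \<in> \<Omega> \<Longrightarrow> 0 \<le> c + s * u p"
    and q: "q \<in> frontier \<Omega>" "((\<lambda>p. c + s * u p) \<longlongrightarrow> l) (at q within \<Omega>)" "l > 0"
    and p: "p \<in> \<Omega>"
  shows "0 < c + s * u p"
proof (rule ccontr)
  assume "\<not> 0 < c + s * u p"
  then have z: "c + s * u p = 0" using le[OF p] by simp
  have C2: "C2_on \<Omega> u" using u by (simp add: minimal_graph_on_def)
  have "c + s * u x = 0" if x: "x \<in> \<Omega>" for x
  proof (rule strong_minimum_principle[OF \<Omega> C2 _ _ _ le p z x])
    show "continuous_on \<Omega> (\<lambda>z. fst (nil3_gradient \<tau> u z))" "continuous_on \<Omega> (\<lambda>z. snd (nil3_gradient \<tau> u z))"
      by (rule C1_on_continuous, rule C1_nil3_p[OF C2], rule C1_on_continuous, rule C1_nil3_q[OF C2])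
    fix y assume y: "y \<in> \<Omega>"
    have "nil3_mean_curvature \<tau> u y = 0" using u y by (simp add: minimal_graph_on_def)
    then show "(1 + (snd (nil3_gradient \<tau> u y))\<^sup>2) * pdx (pdx u) y
        - fst (nil3_gradient \<tau> u y) * snd (nil3_gradient \<tau> u y) * (pdy (pdx u) y + pdx (pdy u) y)
        + (1 + (fst (nil3_gradient \<tau> u y))\<^sup>2) * pdy (pdy u) y = 0"
      unfolding nil3_field(3)[OF C2 y] using graph_area_pos[of "nil3_gradient \<tau> u y"] by simp
  qed
  then have "((\<lambda>p. c + s * u p) \<longlongrightarrow> 0) (at q within \<Omega>)"
    by (intro tendsto_eventually) (simp add: eventually_at_filter)
  moreover have "at q within \<Omega> \<noteq> bot"
  proof -
    have "q \<notin> \<Omega>" "q \<in> closure \<Omega>" using q(1) \<Omega>(1) by (auto simp: frontier_def interior_open)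
    then show ?thesis by (simp add: at_within_eq_bot_iff)
  qed
  ultimately have "l = 0" using q(2) tendsto_unique by blast
  then show False using q(3) by simp
qed

theorem corollary5p4:
  fixes \<tau> :: real and \<Omega> :: "plane set" and n :: plane and a b :: real
    and \<phi> :: "plane \<Rightarrow> real" and m M :: real
  assumes "\<tau> \<noteq> 0"
    and "open \<Omega>" and "connected \<Omega>" and "\<Omega> \<noteq> {}"
    and "n \<noteq> 0" and "a < b" and "\<Omega> \<subseteq> strip n a b"
    and "nonneg_curved_boundary \<Omega>"
    and "piecewise_C2_on_boundary \<Omega> \<phi>"
    and "\<forall>p\<in>frontier \<Omega>. m < \<phi> p \<and> \<phi> p < M"
  shows "(\<forall>u v. solves_dirichlet \<tau> \<Omega> \<phi> u \<longrightarrow> solves_dirichlet \<tau> \<Omega> \<phi> v \<longrightarrow> (\<forall>p\<in>\<Omega>. u p = v p)) \<and>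
         (\<forall>u. solves_dirichlet \<tau> \<Omega> \<phi> u \<longrightarrow> (\<forall>p\<in>\<Omega>. m < u p \<and> u p < M))"
proof -
  obtain D where D: "closed D" "discrete D" "D \<subseteq> frontier \<Omega>"
    and cont: "\<And>p. p \<in> frontier \<Omega> - D \<Longrightarrow> continuous (at p within frontier \<Omega>) \<phi>"
    using piecewise_C2_on_boundary_jumps[OF assms(9)] by blast
  obtain e L A where ax: "strip_axis n a b e L A"
    using ex_strip_axis[OF assms(5), of a b] assms(6) by auto
  have sub: "\<Omega> \<subseteq> {p. a \<le> n \<bullet> p \<and> n \<bullet> p \<le> b}" using assms(7) by (auto simp: strip_def)
  interpret strip_domain n a b e L A \<Omega> D
    by (unfold_locales) (use assms(2,5,6) ax sub D in auto)
  have "closure \<Omega> \<noteq> UNIV"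
  proof
    assume U: "closure \<Omega> = UNIV"
    have "closed ({p. a \<le> n \<bullet> p} \<inter> {p. n \<bullet> p \<le> b})"
      by (intro closed_Int closed_Collect_le continuous_intros)
    moreover have "\<Omega> \<subseteq> {p. a \<le> n \<bullet> p} \<inter> {p. n \<bullet> p \<le> b}" using sub by auto
    ultimately have "closure \<Omega> \<subseteq> {p. a \<le> n \<bullet> p} \<inter> {p. n \<bullet> p \<le> b}" by (intro closure_minimal)
    then have "((b + 1) / (n \<bullet> n)) *\<^sub>R n \<in> {p. n \<bullet> p \<le> b}" using U by blast
    then show False using assms(5) by simp
  qed
  from frontier_not_subset_discrete[OF assms(2,4) this D(1,2)]
  obtain q0 where q0: "q0 \<in> frontier \<Omega> - D" by blast
  have min: "minimal_graph_on \<tau> \<Omega> u" if "solves_dirichlet \<tau> \<Omega> \<phi> u" for u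
    using that by (simp add: solves_dirichlet_def minimal_graph_on_def)
  have lim: "(u \<longlongrightarrow> \<phi> q) (at q within \<Omega>)"
    if "solves_dirichlet \<tau> \<Omega> \<phi> u" "q \<in> frontier \<Omega> - D" for u q
    using that cont[of q] unfolding solves_dirichlet_def by blast
  have bnd: "m < \<phi> q" "\<phi> q < M" if "q \<in> frontier \<Omega> - D" for q using assms(10) that by blast+
  have upper: "u p \<le> M" if u: "solves_dirichlet \<tau> \<Omega> \<phi> u" and p: "p \<in> \<Omega>" for u p
  proof -
    have "nonpos_at_boundary (\<lambda>p. 1 * (u p - M))"
      unfolding nonpos_at_boundary_def
    proof (intro ballI allI impI)
      fix q \<epsilon> assume q: "q \<in> frontier \<Omega> - D" and \<epsilon>: "(\<epsilon>::real) > 0"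
      have "((\<lambda>p. 1 * (u p - M)) \<longlongrightarrow> 1 * (\<phi> q - M)) (at q within \<Omega>)"
        by (intro tendsto_intros lim[OF u q])
      then show "\<forall>\<^sub>F p in at q within \<Omega>. 1 * (u p - M) < \<epsilon>"
        by (rule order_tendstoD(2)) (use bnd(2)[OF q] \<epsilon> in simp)
    qed
    from one_sided_bound[OF assms(3) q0 assms(1) min[OF u] _ this p] show ?thesis by simp
  qed
  have lower: "m \<le> u p" if u: "solves_dirichlet \<tau> \<Omega> \<phi> u" and p: "p \<in> \<Omega>" for u p
  proof -
    have "nonpos_at_boundary (\<lambda>p. (- 1) * (u p - m))"
      unfolding nonpos_at_boundary_def
    proof (intro ballI allI impI)
      fix q \<epsilon> assume q: "q \<in> frontier \<Omega> - D" and \<epsilon>: "(\<epsilon>::real) > 0"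
      have "((\<lambda>p. (- 1) * (u p - m)) \<longlongrightarrow> (- 1) * (\<phi> q - m)) (at q within \<Omega>)"
        by (intro tendsto_intros lim[OF u q])
      then show "\<forall>\<^sub>F p in at q within \<Omega>. (- 1) * (u p - m) < \<epsilon>"
        by (rule order_tendstoD(2)) (use bnd(1)[OF q] \<epsilon> in simp)
    qed
    from one_sided_bound[OF assms(3) q0 assms(1) min[OF u] _ this p] show ?thesis by simp
  qed
  have compare: "u p \<le> v p"
    if u: "solves_dirichlet \<tau> \<Omega> \<phi> u" and v: "solves_dirichlet \<tau> \<Omega> \<phi> v" and p: "p \<in> \<Omega>" for u v p
  proof (rule bounded_comparison[OF assms(3) q0 min[OF u] min[OF v] _ _ _ p, where B="M - m"])
    show "nonpos_at_boundary (\<lambda>p. u p - v p)"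
      unfolding nonpos_at_boundary_def
    proof (intro ballI allI impI)
      fix q \<epsilon> assume q: "q \<in> frontier \<Omega> - D" and \<epsilon>: "(\<epsilon>::real) > 0"
      have "((\<lambda>p. u p - v p) \<longlongrightarrow> \<phi> q - \<phi> q) (at q within \<Omega>)"
        by (intro tendsto_intros lim q u v)
      then show "\<forall>\<^sub>F p in at q within \<Omega>. u p - v p < \<epsilon>"
        by (rule order_tendstoD(2)) (use \<epsilon> in simp)
    qed
    show "0 \<le> M - m" using bnd[OF q0] by simp
    show "u y - v y \<le> M - m" if "y \<in> \<Omega>" for y
      using upper[OF u that] lower[OF v that] by simp
  qed
  have strict: "m < u p \<and> u p < M" if u: "solves_dirichlet \<tau> \<Omega> \<phi> u" and p: "p \<in> \<Omega>" for u p
  proof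
    have "0 < M + (- 1) * u p"
    proof (rule minimal_graph_strict_bound[OF assms(2,3) min[OF u] _ _ _ _ p])
      show "0 \<le> M + (- 1) * u y" if "y \<in> \<Omega>" for y using upper[OF u that] by simp
      show "((\<lambda>p. M + (- 1) * u p) \<longlongrightarrow> M + (- 1) * \<phi> q0) (at q0 within \<Omega>)"
        by (intro tendsto_intros lim[OF u q0])
    qed (use q0 bnd[OF q0] in auto)
    then show "u p < M" by simp
    have "0 < - m + 1 * u p"
    proof (rule minimal_graph_strict_bound[OF assms(2,3) min[OF u] _ _ _ _ p])
      show "0 \<le> - m + 1 * u y" if "y \<in> \<Omega>" for y using lower[OF u that] by simp
      show "((\<lambda>p. - m + 1 * u p) \<longlongrightarrow> - m + 1 * \<phi> q0) (at q0 within \<Omega>)"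
        by (intro tendsto_intros lim[OF u q0])
    qed (use q0 bnd[OF q0] in auto)
    then show "m < u p" by simp
  qed
  show ?thesis using compare strict by (meson order_antisym)
qed

end
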